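(* Let $d\ge3$, and let $W>0$ be a function on $\mathbb Z^d$ such that $\mathbf W=\mathcal J W$ is a normalized Hardy weight on $\mathbb R^d$. Suppose $\frac d2<q<\infty$ and let $V\ge0$ be a function on $\mathbb Z^d$. There is a constant $C$, depending only on $d$ and $q$, such that if $V/W\in\ell_{q,w}(W^{d/2})$, then $$N_-(-\Delta-\alpha V)\le C\,\alpha^q\,\|V/W\|^q_{\ell_{q,w}(W^{d/2})}\qquad\text{for all }\alpha>0.$$ If, besides, $$\lim_{t\to0}\Big(t^q\sum_{x:\,V(x)>tW(x)}W(x)^{d/2}\Big)=0\quad\text{and}\quad \lim_{t\to\infty}\Big(t^q\sum_{x:\,V(x)>tW(x)}W(x)^{d/2}\Big)=0,$$ then $N_-(-\Delta-\alpha V)=o(\alpha^q)$ as $\alpha\to\infty$.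
   Context: The discrete Laplacian on $\mathbb Z^d$ is $(\Delta u)(x)=\sum_{j=1}^d\big(u(x+1_j)+u(x-1_j)-2u(x)\big)$, where $1_j$ is the $j$-th standard basis vector. $N_-(-\Delta-\alpha V)$ is the number of negative eigenvalues, counted with multiplicities, of the discrete Schrödinger operator $-\Delta-\alpha V$ in $\ell_2(\mathbb Z^d)$. For a function $W\ge0$ on $\mathbb Z^d$, $\mathcal JW$ is the function on $\mathbb R^d$ that equals $W(x)$ on the unit cell $[0,1]^d+x$, for each $x\in\mathbb Z^d$ (values on the measure-zero cell boundaries are irrelevant). $\mathcal H^1(\mathbb R^d)$, $d\ge3$, is the homogeneous Sobolev space, with metric given by the Dirichlet integral $\int_{\mathbb R^d}|\nabla U|^2d\xi$ (the completion of $C_0^\infty(\mathbb R^d)$). A function $\mathbf W\ge0$ on $\mathbb R^d$ is a Hardy weight on $\mathbb R^d$ if there is a finite constant $H$ such that $\int_{\mathbb R^d}\mathbf W|U|^2d\xi\le H\int_{\mathbb R^d}|\nabla U|^2d\xi$ for all $U\in\mathcal H^1(\mathbb R^d)$; the best possible constant is denoted $H(\mathbf W)$, and $\mathbf W$ is normalized if $H(\mathbf W)=1$. For a function $F\ge0$ on $\mathbb Z^d$, $F\in\ell_{q,w}(W^{d/2})$ means that $$\|F\|^q_{\ell_{q,w}(W^{d/2})}:=\sup_{t>0}\Big(t^q\sum_{x:\,F(x)>tW(x)}W(x)^{d/2}\Big)<\infty\quad\text{is understood for }F=V/W\text{ as}\quad \|V/W\|^q_{\ell_{q,w}(W^{d/2})}=\sup_{t>0}\Big(t^q\sum_{x:\,V(x)>tW(x)}W(x)^{d/2}\Big)<\infty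 .$$ That is, it is the weak $\ell_q$ quasi-norm of the function $V/W$ with respect to the measure on $\mathbb Z^d$ with mass $W(x)^{d/2}$ at $x$. *)

theory Defs
  imports "HOL-Analysis.Analysis" "HOL-Library.Function_Algebras"
begin

section \<open>The discrete Schroedinger operator and its negative eigenvalues\<close>

text \<open>The lattice is \<open>int ^ 'd\<close>, the space is \<open>real ^ 'd\<close>, and the dimension is \<open>CARD('d)\<close>.\<close>

definition l2 :: "('a \<Rightarrow> complex) set" where
  "l2 = {u. (\<lambda>x. (cmod (u x))\<^sup>2) summable_on UNIV}"

definition discrete_laplacian :: "(int ^ 'd \<Rightarrow> complex) \<Rightarrow> int ^ 'd \<Rightarrow> complex" where
  "discrete_laplacian u x = (\<Sum>j\<in>UNIV. u (x + axis j 1) + u (x - axis j 1) - 2 * u x)"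

definition schroedinger ::
    "real \<Rightarrow> (int ^ 'd \<Rightarrow> real) \<Rightarrow> (int ^ 'd \<Rightarrow> complex) \<Rightarrow> int ^ 'd \<Rightarrow> complex" where
  "schroedinger \<alpha> V u x = - discrete_laplacian u x - of_real (\<alpha> * V x) * u x"

text \<open>
  The Laplacian is bounded on \<^const>\<open>l2\<close>, so an \<^const>\<open>l2\<close> solution of the eigenvalue equation
  satisfies \<open>\<alpha> V u \<in> l2\<close> automatically: it lies in the maximal domain of multiplication by \<open>\<alpha> V\<close>,
  on which the operator is self-adjoint. No separate domain condition is needed, and real
  \<open>\<mu>\<close> suffices.
\<close>

definition eigenspace ::
    "real \<Rightarrow> (int ^ 'd \<Rightarrow> real) \<Rightarrow> real \<Rightarrow> (int ^ 'd \<Rightarrow> complex) set" where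
  "eigenspace \<alpha> V \<mu> = {u \<in> l2. \<forall>x. schroedinger \<alpha> V u x = of_real \<mu> * u x}"

definition cscale :: "complex \<Rightarrow> ('a \<Rightarrow> complex) \<Rightarrow> 'a \<Rightarrow> complex" where
  "cscale c f = (\<lambda>x. c * f x)"

interpretation cfun: vector_space cscale
  by standard (auto simp: cscale_def algebra_simps)

text \<open>
  Complex dimension with value \<open>\<infinity>\<close> for infinite-dimensional subspaces
  (the library's \<open>dim\<close> would be \<open>0\<close> there).
\<close>

definition edim :: "('a \<Rightarrow> complex) set \<Rightarrow> enat" where
  "edim E = (SUP B\<in>{B. finite B \<and> B \<subseteq> E \<and> cfun.independent B}. enat (card B))"

text \<open>A sum of extended naturals always exists; only eigenvalues contribute nonzero terms.\<close>

definition N_minus :: "real \<Rightarrow> (int ^ 'd \<Rightarrow> real) \<Rightarrow> enat" where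
  "N_minus \<alpha> V = (\<Sum>\<^sub>\<infinity>\<mu>\<in>{..<0}. edim (eigenspace \<alpha> V \<mu>))"


section \<open>The homogeneous Sobolev space and Hardy weights\<close>

definition partial_derivative :: "'d \<Rightarrow> (real ^ 'd \<Rightarrow> complex) \<Rightarrow> real ^ 'd \<Rightarrow> complex" where
  "partial_derivative j f \<xi> = frechet_derivative f (at \<xi>) (axis j 1)"

definition gradient :: "(real ^ 'd \<Rightarrow> complex) \<Rightarrow> real ^ 'd \<Rightarrow> complex ^ 'd" where
  "gradient f \<xi> = (\<chi> j. partial_derivative j f \<xi>)"

text \<open>
  \<open>C\<^sub>0\<^sup>\<infinity>\<close>: the list \<open>js\<close> runs over all iterated partial derivatives, of all orders.
\<close>

definition test_function :: "(real ^ 'd \<Rightarrow> complex) \<Rightarrow> bool" where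
  "test_function \<phi> \<longleftrightarrow>
     (\<forall>js. foldr partial_derivative js \<phi> differentiable_on UNIV) \<and>
     compact (closure {\<xi>. \<phi> \<xi> \<noteq> 0})"

text \<open>
  The completion of the test functions in the Dirichlet norm, realized as a space of functions:
  \<open>U\<close> belongs to it, with gradient \<open>G\<close>, if \<open>U\<close> is the almost everywhere limit of test functions
  whose gradients converge to \<open>G\<close> in \<open>L\<^sub>2\<close>. For \<open>d \<ge> 3\<close>, by the Sobolev inequality, a Dirichlet-Cauchy
  sequence of test functions converges in \<open>L\<^sub>p\<close> with \<open>p = 2d/(d-2)\<close>, hence a subsequence converges
  almost everywhere; so each element of the completion is such a \<open>U\<close>, and \<open>U\<close> and \<open>G\<close> determine
  each other up to null sets. The almost everywhere convergence of the functions themselves is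
  what excludes nonzero constants.
\<close>

definition in_H1 :: "(real ^ 'd \<Rightarrow> complex) \<Rightarrow> (real ^ 'd \<Rightarrow> complex ^ 'd) \<Rightarrow> bool" where
  "in_H1 U G \<longleftrightarrow>
     U \<in> borel_measurable lebesgue \<and> G \<in> borel_measurable lebesgue \<and>
     (\<exists>\<phi>. (\<forall>n. test_function (\<phi> n)) \<and>
       (AE \<xi> in lebesgue. (\<lambda>n. \<phi> n \<xi>) \<longlonglongrightarrow> U \<xi>) \<and>
       (\<lambda>n. \<integral>\<^sup>+\<xi>. ennreal ((norm (gradient (\<phi> n) \<xi> - G \<xi>))\<^sup>2) \<partial>lebesgue) \<longlonglongrightarrow> 0)"

definition hardy_inequality :: "(real ^ 'd \<Rightarrow> real) \<Rightarrow> real \<Rightarrow> bool" where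
  "hardy_inequality W H \<longleftrightarrow>
     (\<forall>U G. in_H1 U G \<longrightarrow>
       (\<integral>\<^sup>+\<xi>. ennreal (W \<xi> * (cmod (U \<xi>))\<^sup>2) \<partial>lebesgue)
         \<le> ennreal H * (\<integral>\<^sup>+\<xi>. ennreal ((norm (G \<xi>))\<^sup>2) \<partial>lebesgue))"

definition hardy_weight :: "(real ^ 'd \<Rightarrow> real) \<Rightarrow> bool" where
  "hardy_weight W \<longleftrightarrow>
     W \<in> borel_measurable lebesgue \<and> (\<forall>\<xi>. 0 \<le> W \<xi>) \<and> (\<exists>H\<ge>0. hardy_inequality W H)"

definition hardy_constant :: "(real ^ 'd \<Rightarrow> real) \<Rightarrow> real" where
  "hardy_constant W = Inf {H. 0 \<le> H \<and> hardy_inequality W H}"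

definition normalized_hardy_weight :: "(real ^ 'd \<Rightarrow> real) \<Rightarrow> bool" where
  "normalized_hardy_weight W \<longleftrightarrow> hardy_weight W \<and> hardy_constant W = 1"

text \<open>The operator \<open>\<J>\<close>, with the half-open cells \<open>[0,1)\<^sup>d + x\<close>.\<close>

definition cell_extension :: "(int ^ 'd \<Rightarrow> real) \<Rightarrow> real ^ 'd \<Rightarrow> real" where
  "cell_extension W \<xi> = W (\<chi> j. \<lfloor>\<xi> $ j\<rfloor>)"


section \<open>The weak quasi-norm\<close>

text \<open>
  The expression \<open>t\<^sup>q \<Sum> {W(x)\<^sup>d\<^sup>/\<^sup>2 | V(x) > t W(x)}\<close>; its supremum over \<open>t > 0\<close> is the \<open>q\<close>-th power of the
  weak quasi-norm of \<open>V/W\<close>.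
\<close>

definition weak_tail :: "real \<Rightarrow> (int ^ 'd \<Rightarrow> real) \<Rightarrow> (int ^ 'd \<Rightarrow> real) \<Rightarrow> real \<Rightarrow> ennreal" where
  "weak_tail q W V t =
     ennreal (t powr q) *
       (\<Sum>\<^sub>\<infinity>x\<in>{x. V x > t * W x}. ennreal (W x powr (real CARD('d) / 2)))"

definition weak_quasinorm_power ::
    "real \<Rightarrow> (int ^ 'd \<Rightarrow> real) \<Rightarrow> (int ^ 'd \<Rightarrow> real) \<Rightarrow> ennreal" where
  "weak_quasinorm_power q W V = (SUP t\<in>{0<..}. weak_tail q W V t)"

end

theory Submission
  imports Defs
begin

text \<open>
  The potential is split at a level \<open>t\<close>. On the set \<open>V \<le> t W\<close> it is controlled by the Hardy inequality:
  sampling the continuous inequality on smooth interpolants of lattice functions gives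
  \<open>\<Sum> W \<bar>u\<bar>\<^sup>2 \<le> c \<D>(u)\<close> on the lattice, \<open>\<D>\<close> being the discrete Dirichlet form
  (\<open>hardy_inequality_lattice\<close>). For \<open>t\<close> a small multiple of \<open>1/\<alpha>\<close> this part of \<open>\<alpha> V\<close> costs at most half
  of \<open>\<D>\<close>, so only the part of \<open>V\<close> on the set \<open>V > t W\<close> can create negative eigenvalues. Their number is
  at most a constant times \<open>\<alpha>\<^sup>d\<^sup>/\<^sup>2 \<Sum> V\<^sup>d\<^sup>/\<^sup>2\<close>, summed over \<open>V > t W\<close>, by the Cwikel-Lieb-Rozenblum inequality
  (\<open>card_le_large_potential\<close>). Since \<open>q > d/2\<close>, a dyadic decomposition bounds this sum by
  \<open>t\<^sup>d\<^sup>/\<^sup>2\<^sup>-\<^sup>q\<close> times a weighted average of the weak tails at the levels \<open>2\<^sup>l t\<close> (\<open>sum_large_potential_le\<close>).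
  With \<open>t\<close> proportional to \<open>1/\<alpha>\<close> the powers combine to \<open>\<alpha>\<^sup>q\<close>. The average is at most a multiple of the
  quasi-norm, and it tends to zero with \<open>t\<close> if the tails do, by dominated convergence.

  The Cwikel-Lieb-Rozenblum inequality is proved in the manner of Rumin, with powers of a random walk
  in place of spectral projections. Let \<open>P\<close> average over one step of the walk whose coordinates move
  independently, each by the sum of two half-steps with fair signs. Its return probabilities
  are powers of central binomial probabilities and decay like \<open>m\<^sup>-\<^sup>d\<^sup>/\<^sup>2\<close>. Take functions
  \<open>u\<^sub>i\<close>, \<open>i < n\<close>, orthonormal in the energy form \<open>\<langle>(1 - P) u, v\<rangle>\<close>, which is dominated by \<open>\<D>\<close>. Two
  facts are combined. First, \<open>\<Sum>\<^sub>i \<bar>P\<^sup>m u\<^sub>i(x)\<bar>\<^sup>2\<close> is at most a tail of the series of return probabilities,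
  hence of order \<open>m\<^sup>1\<^sup>-\<^sup>d\<^sup>/\<^sup>2\<close> (\<open>sum_walk_pow_pointwise_le\<close>). Second, the weighted sum over \<open>k\<close> of the
  defects of \<open>u\<close> under \<open>P\<close> to the power \<open>2\<^sup>k\<close> telescopes to at most the energy
  (\<open>sum_walk_defects_le\<close>). Choosing at every site the scale \<open>k\<close> that matches the size of the potential
  there bounds \<open>\<Sum> p \<Sum>\<^sub>i \<bar>u\<^sub>i\<bar>\<^sup>2\<close> by \<open>n/2\<close> plus a multiple of \<open>\<Sum> p\<^sup>d\<^sup>/\<^sup>2\<close>
  (\<open>sum_potential_density_le\<close>). For a space of dimension \<open>n\<close> on which the quadratic form is not
  positive, the left side is at least \<open>n\<close>, which bounds \<open>n\<close>.
\<close>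

section \<open>Square summable functions\<close>

lemma sum_fun_apply: "(\<Sum>i\<in>A. f i) x = (\<Sum>i\<in>A. f i x)"
  for f :: "'b \<Rightarrow> 'a \<Rightarrow> complex"
  by (induction A rule: infinite_finite_induct) auto

lemma cmod_add_sq_le: "(cmod (a + b))\<^sup>2 \<le> 2 * (cmod a)\<^sup>2 + 2 * (cmod b)\<^sup>2"
proof -
  have "(cmod (a + b))\<^sup>2 \<le> (cmod a + cmod b)\<^sup>2"
    by (intro power_mono norm_triangle_ineq norm_ge_zero)
  also have "\<dots> \<le> 2 * (cmod a)\<^sup>2 + 2 * (cmod b)\<^sup>2"
    using sum_squares_bound[of "cmod a" "cmod b"] by (simp add: power2_sum)
  finally show ?thesis .
qed

lemma l2_summable: "u \<in> l2 \<Longrightarrow> (\<lambda>x. (cmod (u x))\<^sup>2) summable_on UNIV"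
  by (simp add: l2_def)

lemma l2_add: "u \<in> l2 \<Longrightarrow> v \<in> l2 \<Longrightarrow> u + v \<in> l2"
  unfolding l2_def mem_Collect_eq
  by (rule summable_on_comparison_test[where f = "\<lambda>x. 2 * (cmod (u x))\<^sup>2 + 2 * (cmod (v x))\<^sup>2"])
     (auto intro!: summable_on_add summable_on_cmult_right cmod_add_sq_le)

lemma l2_scale: "u \<in> l2 \<Longrightarrow> cscale c u \<in> l2"
  by (auto simp: l2_def cscale_def norm_mult power_mult_distrib intro!: summable_on_cmult_right)

lemma l2_subspace: "cfun.subspace l2"
  by (auto simp: cfun.subspace_def l2_add l2_scale) (simp add: l2_def)

lemma l2_zero: "0 \<in> l2"
  using cfun.subspace_0[OF l2_subspace] .

lemma l2_diff: "u \<in> l2 \<Longrightarrow> v \<in> l2 \<Longrightarrow> u - v \<in> l2"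
  using cfun.subspace_diff[OF l2_subspace] .

lemma l2_sum: "(\<And>i. i \<in> A \<Longrightarrow> f i \<in> l2) \<Longrightarrow> (\<Sum>i\<in>A. f i) \<in> l2"
  using cfun.subspace_sum[OF l2_subspace] .

lemma l2_finite_support:
  assumes "finite {x. u x \<noteq> 0}"
  shows "u \<in> l2"
proof -
  have "(\<lambda>x. (cmod (u x))\<^sup>2) summable_on {x. u x \<noteq> 0}"
    using assms by simp
  then show ?thesis
    unfolding l2_def mem_Collect_eq by (rule summable_on_cong_neutral[THEN iffD1, rotated -1]) auto
qed

definition ip :: "('a \<Rightarrow> complex) \<Rightarrow> ('a \<Rightarrow> complex) \<Rightarrow> complex" where
  "ip u v = (\<Sum>\<^sub>\<infinity>x. u x * cnj (v x))"

abbreviation nsq :: "('a \<Rightarrow> complex) \<Rightarrow> real" where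
  "nsq u \<equiv> Re (ip u u)"

lemma ip_summable:
  assumes "u \<in> l2" "v \<in> l2"
  shows "(\<lambda>x. u x * cnj (v x)) summable_on UNIV"
proof (rule abs_summable_summable, rule summable_on_comparison_test)
  show "(\<lambda>x. (cmod (u x))\<^sup>2 + (cmod (v x))\<^sup>2) summable_on UNIV"
    using assms by (intro summable_on_add l2_summable)
  show "norm (u x * cnj (v x)) \<le> (cmod (u x))\<^sup>2 + (cmod (v x))\<^sup>2" for x
    using sum_squares_bound[of "cmod (u x)" "cmod (v x)"]
    using mult_nonneg_nonneg[of "cmod (u x)" "cmod (v x)"]
    by (simp add: norm_mult del: mult_nonneg_nonneg)
qed auto

lemma ip_cnj: "ip v u = cnj (ip u v)"
  unfolding ip_def by (subst infsum_cnj[symmetric]) (simp add: mult.commute)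

lemma Re_ip_commute: "Re (ip v u) = Re (ip u v)"
  by (subst ip_cnj) simp

lemma ip_add_left: "u \<in> l2 \<Longrightarrow> v \<in> l2 \<Longrightarrow> w \<in> l2 \<Longrightarrow> ip (u + v) w = ip u w + ip v w"
  unfolding ip_def by (subst infsum_add[symmetric]) (auto intro: ip_summable simp: algebra_simps)

lemma ip_scale_left: "ip (cscale c u) w = c * ip u w"
  unfolding ip_def by (subst infsum_cmult_right'[symmetric]) (simp add: cscale_def algebra_simps)

lemma nsq_eq: "u \<in> l2 \<Longrightarrow> nsq u = (\<Sum>\<^sub>\<infinity>x. (cmod (u x))\<^sup>2)"
  unfolding ip_def by (subst infsum_Re[symmetric]) (auto intro: ip_summable simp: cmod_power2 simp flip: power2_eq_square)

lemma nsq_nonneg: "u \<in> l2 \<Longrightarrow> 0 \<le> nsq u"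
  by (simp add: nsq_eq infsum_nonneg)

text \<open>
  The Hilbert space facts that are needed hold for every positive semidefinite Hermitian form
  on a space of functions; they are used for the inner product of \<open>l2\<close> and for the Dirichlet form
  of a random walk.
\<close>

locale hermitian_form =
  fixes S :: "('a \<Rightarrow> complex) set" and B :: "('a \<Rightarrow> complex) \<Rightarrow> ('a \<Rightarrow> complex) \<Rightarrow> complex"
  assumes subspace: "cfun.subspace S"
    and add_left: "u \<in> S \<Longrightarrow> v \<in> S \<Longrightarrow> w \<in> S \<Longrightarrow> B (u + v) w = B u w + B v w"
    and scale_left: "u \<in> S \<Longrightarrow> w \<in> S \<Longrightarrow> B (cscale c u) w = c * B u w"
    and conj_sym: "u \<in> S \<Longrightarrow> w \<in> S \<Longrightarrow> B w u = cnj (B u w)"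
    and nonneg: "u \<in> S \<Longrightarrow> 0 \<le> Re (B u u)"
begin

lemma zero_left: "w \<in> S \<Longrightarrow> B 0 w = 0"
  using scale_left[of 0 w 0] cfun.subspace_0[OF subspace] by (simp add: cscale_def flip: zero_fun_def)

lemma add_right: "u \<in> S \<Longrightarrow> v \<in> S \<Longrightarrow> w \<in> S \<Longrightarrow> B w (u + v) = B w u + B w v"
  using conj_sym[of "u + v" w] conj_sym[of u w] conj_sym[of v w] cfun.subspace_add[OF subspace]
  by (simp add: add_left)

lemma scale_right: "u \<in> S \<Longrightarrow> w \<in> S \<Longrightarrow> B w (cscale c u) = cnj c * B w u"
  using conj_sym[of "cscale c u" w] conj_sym[of u w] cfun.subspace_scale[OF subspace]
  by (simp add: scale_left)

lemma diff_left: "u \<in> S \<Longrightarrow> v \<in> S \<Longrightarrow> w \<in> S \<Longrightarrow> B (u - v) w = B u w - B v w"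
  using add_left[of "u - v" v w] cfun.subspace_diff[OF subspace] by simp

lemma diff_right: "u \<in> S \<Longrightarrow> v \<in> S \<Longrightarrow> w \<in> S \<Longrightarrow> B w (u - v) = B w u - B w v"
  using conj_sym[of "u - v" w] conj_sym[of u w] conj_sym[of v w] cfun.subspace_diff[OF subspace]
  by (simp add: diff_left)

lemma sum_left:
  assumes "\<And>i. i \<in> A \<Longrightarrow> f i \<in> S" "w \<in> S"
  shows "B (\<Sum>i\<in>A. f i) w = (\<Sum>i\<in>A. B (f i) w)"
  using assms
  by (induction A rule: infinite_finite_induct)
     (auto simp: zero_left add_left cfun.subspace_sum[OF subspace])

lemma sum_right:
  assumes "\<And>i. i \<in> A \<Longrightarrow> f i \<in> S" "w \<in> S"
  shows "B w (\<Sum>i\<in>A. f i) = (\<Sum>i\<in>A. B w (f i))"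
proof -
  have "B w (\<Sum>i\<in>A. f i) = cnj (B (\<Sum>i\<in>A. f i) w)"
    using assms by (intro conj_sym cfun.subspace_sum[OF subspace]) auto
  also have "\<dots> = (\<Sum>i\<in>A. cnj (B (f i) w))"
    by (simp add: sum_left assms)
  also have "\<dots> = (\<Sum>i\<in>A. B w (f i))"
    using assms by (intro sum.cong refl conj_sym[symmetric]) auto
  finally show ?thesis .
qed

lemma real_diag: "u \<in> S \<Longrightarrow> B u u = of_real (Re (B u u))"
  using conj_sym[of u u] by (simp add: complex_eq_iff)

definition orthonormal :: "nat \<Rightarrow> (nat \<Rightarrow> 'a \<Rightarrow> complex) \<Rightarrow> bool" where
  "orthonormal n v \<longleftrightarrow> (\<forall>i<n. v i \<in> S) \<and> (\<forall>i<n. \<forall>j<n. B (v i) (v j) = (if i = j then 1 else 0))"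

lemma orthogonal_remainder:
  assumes "orthonormal n v" "w \<in> S" "j < n"
  shows "B (w - (\<Sum>i<n. cscale (B w (v i)) (v i))) (v j) = 0"
proof -
  have v: "v i \<in> S" if "i < n" for i
    using assms that by (auto simp: orthonormal_def)
  have "B (w - (\<Sum>i<n. cscale (B w (v i)) (v i))) (v j)
      = B w (v j) - (\<Sum>i<n. B w (v i) * B (v i) (v j))"
    using assms v
    by (subst diff_left; (subst sum_left)?)
       (auto intro!: cfun.subspace_sum[OF subspace] cfun.subspace_scale[OF subspace] simp: scale_left)
  also have "(\<Sum>i<n. B w (v i) * B (v i) (v j)) = (\<Sum>i<n. if i = j then B w (v i) else 0)"
    using assms by (intro sum.cong) (auto simp: orthonormal_def)
  finally show ?thesis using assms by (simp del: minus_apply)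
qed

lemma remainder_in: 
  assumes "orthonormal n v" "w \<in> S"
  shows "w - (\<Sum>i<n. cscale (B w (v i)) (v i)) \<in> S"
  using assms by (auto simp: orthonormal_def intro!: cfun.subspace_diff[OF subspace]
      cfun.subspace_sum[OF subspace] cfun.subspace_scale[OF subspace])

lemma bessel:
  assumes "orthonormal n v" "w \<in> S"
  shows "(\<Sum>i<n. (cmod (B (v i) w))\<^sup>2) \<le> Re (B w w)"
proof -
  define p where "p = (\<Sum>i<n. cscale (B w (v i)) (v i))"
  have v: "v i \<in> S" if "i < n" for i
    using assms that by (auto simp: orthonormal_def)
  have wp: "w - p \<in> S" unfolding p_def by (rule remainder_in[OF assms])
  have p: "p \<in> S" using cfun.subspace_diff[OF subspace assms(2) wp] by simp
  have "B (w - p) p = (\<Sum>i<n. B (w - p) (cscale (B w (v i)) (v i)))"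
    using v wp unfolding p_def[abs_def, symmetric] 
    by (subst (2) p_def, subst sum_right) (auto intro: cfun.subspace_scale[OF subspace])
  also have "\<dots> = 0"
    using v wp orthogonal_remainder[OF assms, folded p_def] by (intro sum.neutral) (auto simp: scale_right)
  finally have "B (w - p) (w - p) = B (w - p) w"
    using wp assms p by (simp add: diff_right)
  also have "\<dots> = B w w - B p w"
    using assms p by (simp add: diff_left)
  also have "B p w = (\<Sum>i<n. B w (v i) * B (v i) w)"
    using v assms unfolding p_def
    by (subst sum_left) (auto intro: cfun.subspace_scale[OF subspace] simp: scale_left)
  also have "\<dots> = (\<Sum>i<n. of_real ((cmod (B (v i) w))\<^sup>2))"
    using v assms conj_sym[of _ w]
    by (intro sum.cong refl) (metis complex_norm_square lessThan_iff mult.commute)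
  finally have "Re (B (w - p) (w - p)) = Re (B w w) - (\<Sum>i<n. (cmod (B (v i) w))\<^sup>2)"
    by (simp del: minus_apply)
  then show ?thesis using nonneg[OF wp] by simp
qed

lemma gram_schmidt:
  assumes def: "\<And>u. u \<in> S \<Longrightarrow> Re (B u u) = 0 \<Longrightarrow> u = 0"
    and F: "cfun.subspace F" "F \<subseteq> S"
    and I: "finite I" "I \<subseteq> F" "cfun.independent I"
    and "n \<le> card I"
  shows "\<exists>v. orthonormal n v \<and> (\<forall>i<n. v i \<in> F)"
  using \<open>n \<le> card I\<close>
proof (induction n)
  case 0
  then show ?case by (auto simp: orthonormal_def)
next
  case (Suc n)
  then obtain v where v: "orthonormal n v" "\<And>i. i < n \<Longrightarrow> v i \<in> F" by auto
  have "\<not> I \<subseteq> cfun.span (v ` {..<n})"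
  proof
    assume "I \<subseteq> cfun.span (v ` {..<n})"
    then have "card I \<le> card (v ` {..<n})"
      using cfun.independent_span_bound[of "v ` {..<n}" I] I by auto
    also have "\<dots> \<le> n" using card_image_le[of "{..<n}" v] by simp
    finally show False using Suc by simp
  qed
  then obtain w where w: "w \<in> I" "w \<notin> cfun.span (v ` {..<n})" by auto
  define p where "p = (\<Sum>i<n. cscale (B w (v i)) (v i))"
  have wS: "w \<in> S" "w \<in> F" using w I F by auto
  have pspan: "p \<in> cfun.span (v ` {..<n})"
    unfolding p_def by (intro cfun.span_sum cfun.span_scale cfun.span_base) auto
  have pF: "p \<in> F"
    unfolding p_def using v by (intro cfun.subspace_sum[OF F(1)] cfun.subspace_scale[OF F(1)]) auto
  have zF: "w - p \<in> F" using cfun.subspace_diff[OF F(1)] wS pF by auto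
  then have zS: "w - p \<in> S" using F by auto
  have ne: "w - p \<noteq> 0" using w pspan by auto
  define r where "r = Re (B (w - p) (w - p))"
  have r: "r > 0" using def[OF zS] ne nonneg[OF zS] by (auto simp: r_def order_less_le)
  define z where "z = cscale (of_real (1 / sqrt r)) (w - p)"
  have zz: "z \<in> F" "z \<in> S" unfolding z_def using zF zS
    by (auto intro: cfun.subspace_scale[OF F(1)] cfun.subspace_scale[OF subspace])
  have s: "complex_of_real (sqrt r) * complex_of_real (sqrt r) = of_real r"
    using r by (simp flip: of_real_mult)
  have "B z z = (1 / of_real (sqrt r)) * (1 / of_real (sqrt r)) * B (w - p) (w - p)"
    unfolding z_def using zS cfun.subspace_scale[OF subspace zS]
    by (simp add: scale_left scale_right)
  also have "B (w - p) (w - p) = of_real r" using real_diag[OF zS] by (simp add: r_def)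
  finally have one: "B z z = 1" using r s by (simp add: field_simps)
  have orth: "B z (v j) = 0" if "j < n" for j
    using orthogonal_remainder[OF v(1) wS(1) that] v(1) that zS
    unfolding z_def p_def by (simp add: scale_left orthonormal_def)
  have orth': "B (v j) z = 0" if "j < n" for j
    using orth[OF that] conj_sym[of z "v j"] zz v(1) that by (simp add: orthonormal_def)
  have "orthonormal (Suc n) (v(n := z))"
    using v(1) one orth orth' zz by (auto simp: orthonormal_def less_Suc_eq)
  moreover have "\<forall>i<Suc n. (v(n := z)) i \<in> F"
    using v(2) zz by (auto simp: less_Suc_eq)
  ultimately show ?case by blast
qed

end

interpretation l2: hermitian_form l2 ip
  by standard (auto simp: l2_subspace ip_add_left ip_scale_left nsq_nonneg intro: ip_cnj)

lemma nsq_eq_0: "u \<in> l2 \<Longrightarrow> nsq u = 0 \<Longrightarrow> u = 0"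
proof
  fix x assume u: "u \<in> l2" "nsq u = 0"
  have "(cmod (u x))\<^sup>2 \<le> (\<Sum>\<^sub>\<infinity>x. (cmod (u x))\<^sup>2)"
    using finite_sum_le_infsum[of "\<lambda>x. (cmod (u x))\<^sup>2" UNIV "{x}"] u by (simp add: l2_summable)
  then show "u x = 0 x" using u by (simp add: nsq_eq)
qed

lemma nsq_diff:
  assumes "u \<in> l2" "v \<in> l2"
  shows "nsq (u - v) = nsq u - 2 * Re (ip u v) + nsq v"
  using assms Re_ip_commute[of u v]
  by (simp add: l2.diff_left l2.diff_right l2_diff algebra_simps)

lemma Re_ip_le:
  assumes "u \<in> l2" "v \<in> l2"
  shows "2 * Re (ip u v) \<le> nsq u + nsq v"
  using nsq_nonneg[OF l2_diff[OF assms]] nsq_diff[OF assms] by simp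

lemma nsq_add_le:
  assumes "u \<in> l2" "v \<in> l2"
  shows "nsq (u + v) \<le> 2 * nsq u + 2 * nsq v"
proof -
  have "nsq (u + v) = nsq u + 2 * Re (ip u v) + nsq v"
    using assms Re_ip_commute[of u v] by (simp add: l2.add_left l2.add_right l2_add algebra_simps)
  then show ?thesis using Re_ip_le[OF assms] by simp
qed

text \<open>The weight \<open>c\<close> is a free parameter, so this serves as the Cauchy-Schwarz inequality.\<close>

lemma norm_ip_le:
  assumes "u \<in> l2" "v \<in> l2" "0 < c"
  shows "cmod (ip u v) \<le> (c * nsq u + nsq v / c) / 2"
proof -
  have "cmod (ip u v) \<le> (\<Sum>\<^sub>\<infinity>x. cmod (u x * cnj (v x)))"
    unfolding ip_def
    using ip_summable[OF assms(1,2)] by (intro norm_infsum_bound) (simp only: summable_on_iff_abs_summable_on_complex)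
  also have "\<dots> \<le> (\<Sum>\<^sub>\<infinity>x. c / 2 * (cmod (u x))\<^sup>2 + 1 / (2 * c) * (cmod (v x))\<^sup>2)"
  proof (rule infsum_mono)
    show "(\<lambda>x. cmod (u x * cnj (v x))) summable_on UNIV"
      using ip_summable[OF assms(1,2)] by (simp only: summable_on_iff_abs_summable_on_complex)
    show "(\<lambda>x. c / 2 * (cmod (u x))\<^sup>2 + 1 / (2 * c) * (cmod (v x))\<^sup>2) summable_on UNIV"
      using assms by (intro summable_on_add summable_on_cmult_right l2_summable)
    show "cmod (u x * cnj (v x)) \<le> c / 2 * (cmod (u x))\<^sup>2 + 1 / (2 * c) * (cmod (v x))\<^sup>2" for x
      using sum_squares_bound[of "c * cmod (u x)" "cmod (v x)"] assms(3)
      by (simp add: norm_mult field_simps power2_eq_square)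
  qed
  also have "\<dots> = c / 2 * nsq u + 1 / (2 * c) * nsq v"
    using assms
    by (simp only: nsq_eq infsum_add summable_on_cmult_right l2_summable infsum_cmult_right')
  finally show ?thesis using assms by (simp add: field_simps)
qed

section \<open>Translations and difference energies\<close>

definition shift :: "'a::ab_group_add \<Rightarrow> ('a \<Rightarrow> complex) \<Rightarrow> 'a \<Rightarrow> complex" where
  "shift a u = (\<lambda>x. u (x + a))"

lemma bij_add_right: "bij (\<lambda>x. x + a)" for a :: "'a::ab_group_add"
  by (rule bij_betw_byWitness[where f' = "\<lambda>x. x - a"]) auto

lemma shift_l2 [simp]: "u \<in> l2 \<Longrightarrow> shift a u \<in> l2"
  unfolding l2_def shift_def mem_Collect_eq
  using summable_on_reindex_bij_betw[OF bij_add_right[of a], of "\<lambda>x. (cmod (u x))\<^sup>2"] by simp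

lemma ip_shift_shift: "ip (shift a u) (shift a v) = ip u v"
  unfolding ip_def shift_def
  using infsum_reindex_bij_betw[OF bij_add_right[of a], of "\<lambda>x. u x * cnj (v x)"] by simp

lemma shift_shift: "shift a (shift b u) = shift (a + b) u"
  by (simp add: shift_def add_ac)

lemma shift_zero [simp]: "shift 0 u = u"
  by (simp add: shift_def)

lemma ip_shift_left: "ip (shift a u) v = ip u (shift (- a) v)"
  using ip_shift_shift[of a u "shift (- a) v"] by (simp add: shift_shift)

definition diff_energy :: "'a::ab_group_add \<Rightarrow> ('a \<Rightarrow> complex) \<Rightarrow> real" where
  "diff_energy a u = nsq (shift a u - u)"

lemma diff_energy_nonneg: "u \<in> l2 \<Longrightarrow> 0 \<le> diff_energy a u"
  by (simp add: diff_energy_def nsq_nonneg l2_diff)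

lemma diff_energy_eq: "u \<in> l2 \<Longrightarrow> diff_energy a u = 2 * nsq u - 2 * Re (ip (shift a u) u)"
  by (simp add: diff_energy_def nsq_diff ip_shift_shift)

lemma diff_energy_minus: "u \<in> l2 \<Longrightarrow> diff_energy (- a) u = diff_energy a u"
  using ip_shift_left[of a u u] Re_ip_commute[of u "shift (-a) u"] by (simp add: diff_energy_eq)

lemma diff_energy_zero [simp]: "diff_energy 0 u = 0"
  by (simp add: diff_energy_def ip_def)

lemma diff_energy_add: 
  assumes "u \<in> l2"
  shows "diff_energy (a + b) u \<le> 2 * diff_energy a u + 2 * diff_energy b u"
proof -
  have "shift (a + b) u - u = shift a (shift b u - u) + (shift a u - u)"
    by (auto simp: shift_def add_ac)
  then have "diff_energy (a + b) u \<le> 2 * nsq (shift a (shift b u - u)) + 2 * nsq (shift a u - u)"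
    unfolding diff_energy_def using assms nsq_add_le[of "shift a (shift b u - u)" "shift a u - u"]
    by (simp only: l2_diff shift_l2)
  then show ?thesis by (simp add: diff_energy_def ip_shift_shift)
qed

lemma diff_energy_sum:
  assumes "u \<in> l2" "finite J"
  shows "diff_energy (\<Sum>j\<in>J. a j) u \<le> 2 ^ card J * (\<Sum>j\<in>J. diff_energy (a j) u)"
  using assms(2)
proof (induction J)
  case (insert i J)
  have "diff_energy (\<Sum>j\<in>insert i J. a j) u \<le> 2 * diff_energy (a i) u + 2 * diff_energy (\<Sum>j\<in>J. a j) u"
    using insert diff_energy_add[OF assms(1), of "a i"] by simp
  also have "\<dots> \<le> 2 * 2 ^ card J * diff_energy (a i) u + 2 * (2 ^ card J * (\<Sum>j\<in>J. diff_energy (a j) u))"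
    using insert diff_energy_nonneg[OF assms(1)] 
    by (intro add_mono mult_left_mono mult_right_mono) auto
  also have "\<dots> = 2 ^ card (insert i J) * (\<Sum>j\<in>insert i J. diff_energy (a j) u)"
    using insert by (simp add: algebra_simps)
  finally show ?case .
qed auto

lemma diff_energy_add_fun_le:
  assumes "u \<in> l2" "v \<in> l2"
  shows "diff_energy a (u + v) \<le> 2 * diff_energy a u + 2 * diff_energy a v"
proof -
  have "shift a (u + v) - (u + v) = (shift a u - u) + (shift a v - v)"
    by (auto simp: shift_def)
  then show ?thesis unfolding diff_energy_def using assms nsq_add_le[of "shift a u - u" "shift a v - v"]
    by (simp only: l2_diff shift_l2)
qed

lemma diff_energy_le_nsq: "u \<in> l2 \<Longrightarrow> diff_energy a u \<le> 4 * nsq u"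
  using nsq_nonneg[OF l2_add[of "shift a u" u]] diff_energy_eq[of u a]
    Re_ip_commute[of u "shift a u"]
  by (simp add: l2.add_left l2.add_right l2_add ip_shift_shift)

definition dirichlet :: "(int ^ 'd \<Rightarrow> complex) \<Rightarrow> real" where
  "dirichlet u = (\<Sum>j\<in>UNIV. diff_energy (axis j 1) u)"

lemma discrete_laplacian_eq:
  "discrete_laplacian u = (\<Sum>j\<in>UNIV. shift (axis j 1) u + shift (- axis j 1) u - cscale 2 u)"
  by (rule ext) (simp add: discrete_laplacian_def sum_fun_apply shift_def cscale_def)

lemma discrete_laplacian_l2: "u \<in> l2 \<Longrightarrow> discrete_laplacian u \<in> l2"
  unfolding discrete_laplacian_eq by (intro l2_sum l2_diff l2_add l2_scale) auto

lemma ip_laplacian_self: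
  assumes "u \<in> l2"
  shows "Re (ip (discrete_laplacian u) u) = - dirichlet u"
proof -
  have "ip (discrete_laplacian u) u
      = (\<Sum>j\<in>UNIV. ip (shift (axis j 1) u) u + ip (shift (- axis j 1) u) u - 2 * ip u u)"
    using assms unfolding discrete_laplacian_eq
    by (subst l2.sum_left) (auto simp: l2.diff_left l2.add_left l2_add l2_scale l2_diff l2.scale_left)
  moreover have "Re (ip (shift (axis j 1) u) u + ip (shift (- axis j 1) u) u - 2 * ip u u)
      = - diff_energy (axis j 1) u" for j
    using diff_energy_eq[OF assms, of "axis j 1"] diff_energy_eq[OF assms, of "- axis j 1"]
      diff_energy_minus[OF assms, of "axis j 1"] by simp
  ultimately show ?thesis by (simp add: dirichlet_def sum_negf)
qed

lemma ip_laplacian_sym: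
  assumes "u \<in> l2" "v \<in> l2"
  shows "ip (discrete_laplacian u) v = ip u (discrete_laplacian v)"
proof -
  have "ip (discrete_laplacian u) v
      = (\<Sum>j\<in>UNIV. ip (shift (axis j 1) u) v + ip (shift (- axis j 1) u) v - 2 * ip u v)"
    using assms unfolding discrete_laplacian_eq
    by (subst l2.sum_left) (auto simp: l2.diff_left l2.add_left l2_add l2_scale l2_diff l2.scale_left)
  also have "\<dots> = (\<Sum>j\<in>UNIV. ip u (shift (axis j 1) v) + ip u (shift (- axis j 1) v) - 2 * ip u v)"
    by (simp add: ip_shift_left add_ac)
  also have "\<dots> = ip u (discrete_laplacian v)"
    using assms unfolding discrete_laplacian_eq
    by (subst l2.sum_right) (auto simp: l2.diff_right l2.add_right l2_add l2_scale l2_diff l2.scale_right)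
  finally show ?thesis .
qed

section \<open>A random walk with independent coordinates\<close>

definition cube :: "(int ^ 'd) set" where
  "cube = {e. \<forall>j. e $ j \<in> {-1, 0, 1}}"

lemma cube_eq_image: "cube = vec_lambda ` (PiE UNIV (\<lambda>_. {-1, 0, 1}))"
proof -
  have "e \<in> vec_lambda ` (PiE UNIV (\<lambda>_. {-1, 0, 1}))" if "e \<in> cube" for e :: "int ^ 'd"
    using that by (intro image_eqI[of _ _ "vec_nth e"]) (auto simp: cube_def PiE_UNIV_domain)
  then show ?thesis by (auto simp: cube_def PiE_UNIV_domain)
qed

lemma finite_cube [simp]: "finite (cube :: (int ^ 'd) set)"
  unfolding cube_eq_image by (intro finite_imageI finite_PiE) auto

text \<open>
  The distributive law. It reduces computations with the product walk, and later with tensor products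
  of bump functions, to a single coordinate.
\<close>

lemma sum_cube_prod:
  fixes f :: "'d::finite \<Rightarrow> int \<Rightarrow> 'c::comm_semiring_1"
  shows "(\<Sum>e\<in>cube. \<Prod>j\<in>UNIV. f j (e $ j)) = (\<Prod>j\<in>UNIV. \<Sum>k\<in>{-1, 0, 1}. f j k)"
proof -
  have "(\<Sum>e\<in>cube. \<Prod>j\<in>UNIV. f j (e $ j))
      = (\<Sum>g\<in>PiE UNIV (\<lambda>_. {-1, 0, 1}). \<Prod>j\<in>UNIV. f j (g j))"
    unfolding cube_eq_image
    by (subst sum.reindex) (auto intro!: inj_onI simp: vec_eq_iff fun_eq_iff)
  then show ?thesis by (subst prod_sum_PiE) auto
qed

lemma cube_uminus: "- e \<in> cube \<longleftrightarrow> e \<in> cube"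
  by (simp add: cube_def) (metis add.inverse_inverse add.inverse_neutral)

lemma bij_betw_uminus_cube: "bij_betw uminus cube (cube :: (int ^ 'd) set)"
  by (rule bij_betw_byWitness[where f' = uminus]) (auto simp: cube_uminus)

definition step_weight :: "int \<Rightarrow> real" where
  "step_weight k = (if k = 0 then 1 / 2 else 1 / 4)"

definition walk_weight :: "int ^ 'd \<Rightarrow> real" where
  "walk_weight e = (\<Prod>j\<in>UNIV. step_weight (e $ j))"

lemma walk_weight_nonneg: "0 \<le> walk_weight e"
  by (auto simp: walk_weight_def step_weight_def intro!: prod_nonneg)

lemma walk_weight_le_1: "walk_weight e \<le> 1"
  by (auto simp: walk_weight_def step_weight_def intro!: prod_le_1)

lemma walk_weight_uminus: "walk_weight (- e) = walk_weight e"
  by (simp add: walk_weight_def step_weight_def)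

lemma sum_walk_weight: "(\<Sum>e\<in>cube. walk_weight e) = 1"
  unfolding walk_weight_def by (subst sum_cube_prod) (simp add: step_weight_def)

definition walk :: "(int ^ 'd \<Rightarrow> complex) \<Rightarrow> int ^ 'd \<Rightarrow> complex" where
  "walk u = (\<Sum>e\<in>cube. cscale (of_real (walk_weight e)) (shift e u))"

lemma walk_apply: "walk u x = (\<Sum>e\<in>cube. of_real (walk_weight e) * u (x + e))"
  by (simp add: walk_def sum_fun_apply cscale_def shift_def)

lemma walk_l2 [simp]: "u \<in> l2 \<Longrightarrow> walk u \<in> l2"
  unfolding walk_def by (intro l2_sum l2_scale) auto

lemma walk_add: "walk (u + v) = walk u + walk v"
  by (rule ext) (simp add: walk_apply algebra_simps sum.distrib)

lemma walk_scale: "walk (cscale c u) = cscale c (walk u)"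
  by (rule ext) (simp add: walk_apply cscale_def algebra_simps sum_distrib_left)

lemma ip_walk_left:
  assumes "u \<in> l2" "v \<in> l2"
  shows "ip (walk u) v = (\<Sum>e\<in>cube. of_real (walk_weight e) * ip (shift e u) v)"
  using assms unfolding walk_def by (subst l2.sum_left) (auto simp: l2_scale l2.scale_left)

lemma ip_walk_sym:
  assumes "u \<in> l2" "v \<in> l2"
  shows "ip (walk u) v = ip u (walk v)"
proof -
  have "ip (walk u) v = (\<Sum>e\<in>cube. of_real (walk_weight e) * ip u (shift (- e) v))"
    using assms by (simp add: ip_walk_left ip_shift_left)
  also have "\<dots> = (\<Sum>e\<in>cube. of_real (walk_weight e) * ip u (shift e v))"
    using sum.reindex_bij_betw[OF bij_betw_uminus_cube,
        of "\<lambda>e. of_real (walk_weight e) * ip u (shift e v)"]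
    by (simp add: walk_weight_uminus)
  also have "\<dots> = ip u (walk v)"
    using assms unfolding walk_def by (subst l2.sum_right) (auto simp: l2_scale l2.scale_right)
  finally show ?thesis .
qed

text \<open>
  An average of translations is a contraction: pair \<open>walk u\<close> with itself and use that translations are
  isometries.
\<close>

lemma nsq_walk_le:
  fixes u :: "int ^ 'd::finite \<Rightarrow> complex"
  assumes "u \<in> l2"
  shows "nsq (walk u) \<le> nsq u"
proof -
  have "2 * nsq (walk u) = (\<Sum>e\<in>cube. walk_weight e * (2 * Re (ip (shift e u) (walk u))))"
    using assms by (subst (1) ip_walk_left) (auto simp: sum_distrib_left algebra_simps)
  also have "\<dots> \<le> (\<Sum>e\<in>(cube :: (int ^ 'd) set). walk_weight e * (nsq u + nsq (walk u)))"
  proof (intro sum_mono mult_left_mono walk_weight_nonneg)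
    show "2 * Re (ip (shift e u) (walk u)) \<le> nsq u + nsq (walk u)" for e
      using assms Re_ip_le[of "shift e u" "walk u"] by (simp add: ip_shift_shift)
  qed
  also have "\<dots> = nsq u + nsq (walk u)"
    by (simp add: sum_walk_weight flip: sum_distrib_right)
  finally show ?thesis by simp
qed

lemma walk_pow_l2 [simp]: "u \<in> l2 \<Longrightarrow> (walk ^^ m) u \<in> l2"
  by (induction m) auto

lemma ip_walk_pow_sym: "u \<in> l2 \<Longrightarrow> v \<in> l2 \<Longrightarrow> ip ((walk ^^ m) u) v = ip u ((walk ^^ m) v)"
proof (induction m arbitrary: v)
  case (Suc m)
  have "ip ((walk ^^ Suc m) u) v = ip ((walk ^^ m) u) (walk v)"
    using Suc.prems by (simp add: ip_walk_sym)
  also have "\<dots> = ip u ((walk ^^ m) (walk v))"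
    using Suc by simp
  finally show ?case by (simp add: funpow_swap1)
qed simp

lemma nsq_walk_pow_le: "u \<in> l2 \<Longrightarrow> nsq ((walk ^^ m) u) \<le> nsq u"
  by (induction m) (auto intro: order_trans[OF nsq_walk_le])

lemma Re_ip_walk_pow_le:
  assumes "u \<in> l2"
  shows "Re (ip ((walk ^^ m) u) u) \<le> nsq u"
  using Re_ip_le[of "(walk ^^ m) u" u] nsq_walk_pow_le[of u m] assms by simp

text \<open>
  The form \<open>\<langle>(1 - P) u, v\<rangle>\<close> of the walk. It is used instead of the Dirichlet form because it is tied
  algebraically to the powers of \<open>P\<close>.
\<close>

definition energy :: "(int ^ 'd \<Rightarrow> complex) \<Rightarrow> (int ^ 'd \<Rightarrow> complex) \<Rightarrow> complex" where
  "energy u v = ip (u - walk u) v"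

lemma energy_self:
  fixes u :: "int ^ 'd::finite \<Rightarrow> complex"
  assumes "u \<in> l2"
  shows "Re (energy u u) = (\<Sum>e\<in>cube. walk_weight e * diff_energy e u) / 2"
proof -
  have "(\<Sum>e\<in>cube. walk_weight e * diff_energy e u) 
      = (\<Sum>e\<in>(cube :: (int ^ 'd) set). walk_weight e * (2 * nsq u)) - (\<Sum>e\<in>cube. walk_weight e * (2 * Re (ip (shift e u) u)))"
    using assms by (simp add: diff_energy_eq right_diff_distrib sum_subtractf)
  also have "\<dots> = 2 * nsq u - 2 * Re (ip (walk u) u)"
  proof -
    have "(\<Sum>e\<in>(cube :: (int ^ 'd) set). walk_weight e * (2 * nsq u)) = 2 * nsq u"
      by (simp add: sum_walk_weight flip: sum_distrib_right)
    moreover have "(\<Sum>e\<in>cube. walk_weight e * (2 * Re (ip (shift e u) u))) = 2 * Re (ip (walk u) u)"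
      using assms by (simp add: ip_walk_left sum_distrib_left mult_ac)
    ultimately show ?thesis by simp
  qed
  finally show ?thesis using assms by (simp add: energy_def l2.diff_left)
qed

lemma energy_nonneg: "u \<in> l2 \<Longrightarrow> 0 \<le> Re (energy u u)"
  by (simp add: energy_self sum_nonneg walk_weight_nonneg diff_energy_nonneg)

interpretation energy: hermitian_form l2 energy
proof
  show "energy w u = cnj (energy u w)" if "u \<in> l2" "w \<in> l2" for u w :: "int ^ 'd \<Rightarrow> complex"
    using that ip_walk_sym[of w u] ip_cnj[of w u] ip_cnj[of w "walk u"] 
    by (simp add: energy_def l2.diff_left)
  show "energy (u + v) w = energy u w + energy v w" if "u \<in> l2" "v \<in> l2" "w \<in> l2"
    for u v w :: "int ^ 'd \<Rightarrow> complex"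
    using that by (simp add: energy_def l2.diff_left walk_add l2.add_left l2_add)
  show "energy (cscale c u) w = c * energy u w" if "u \<in> l2" "w \<in> l2"
    for u w :: "int ^ 'd \<Rightarrow> complex" and c
    using that by (simp add: energy_def l2.diff_left walk_scale l2.scale_left l2_scale algebra_simps)
qed (auto simp: l2_subspace energy_nonneg)

text \<open>
  A step of the cube is a composition of at most one unit step along each axis, and the difference
  energy of a composition is controlled by those of its parts.
\<close>

lemma sum_diff_energy_cube_le:
  assumes "u \<in> l2"
  shows "(\<Sum>e\<in>cube. diff_energy e u) \<le> 6 ^ CARD('d) * dirichlet (u :: int ^ 'd::finite \<Rightarrow> complex)"
proof -
  have card: "card (cube :: (int ^ 'd) set) = 3 ^ CARD('d)"
    using sum_cube_prod[of "\<lambda>(_::'d) _. 1::nat"] by (simp add: numeral_3_eq_3)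
  have "diff_energy e u \<le> 2 ^ CARD('d) * dirichlet u" if e: "e \<in> cube" for e
  proof -
    have dec: "e = (\<Sum>j\<in>UNIV. axis j (e $ j))"
      by (simp add: vec_eq_iff axis_def)
    have "diff_energy (axis j (e $ j)) u \<le> diff_energy (axis j 1) u" for j
    proof -
      have "e $ j \<in> {-1, 0, 1}" using e by (simp add: cube_def)
      then consider "e $ j = -1" | "e $ j = 0" | "e $ j = 1" by auto
      then show ?thesis
      proof cases
        case 1
        have "axis j (- 1) = - axis j (1::int)" by (simp add: axis_def vec_eq_iff)
        then show ?thesis using 1 diff_energy_minus[OF assms] by simp
      next
        case 2
        have "axis j 0 = (0 :: int ^ 'd)" by (simp add: axis_def vec_eq_iff)
        then show ?thesis unfolding 2 using diff_energy_nonneg[OF assms] by (simp only:) simp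
      qed simp
    qed
    then have "(\<Sum>j\<in>UNIV. diff_energy (axis j (e $ j)) u) \<le> dirichlet u"
      unfolding dirichlet_def by (rule sum_mono)
    then have "2 ^ CARD('d) * (\<Sum>j\<in>UNIV. diff_energy (axis j (e $ j)) u) \<le> 2 ^ CARD('d) * dirichlet u"
      by simp
    then have "diff_energy (\<Sum>j\<in>UNIV. axis j (e $ j)) u \<le> 2 ^ CARD('d) * dirichlet u"
      by (rule order_trans[OF diff_energy_sum[OF assms finite]])
    then show ?thesis using dec by simp
  qed
  then have "(\<Sum>e\<in>cube. diff_energy e u) \<le> (\<Sum>e\<in>(cube :: (int ^ 'd) set). 2 ^ CARD('d) * dirichlet u)"
    by (rule sum_mono)
  also have "\<dots> = (2 * 3) ^ CARD('d) * dirichlet u"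
    by (simp add: card flip: power_mult_distrib)
  finally show ?thesis by simp
qed

lemma energy_le_dirichlet:
  assumes "u \<in> l2"
  shows "Re (energy u u) \<le> 6 ^ CARD('d) * dirichlet (u :: int ^ 'd::finite \<Rightarrow> complex)"
proof -
  have "(\<Sum>e\<in>cube. walk_weight e * diff_energy e u) \<le> (\<Sum>e\<in>cube. diff_energy e u)"
    using diff_energy_nonneg[OF assms] by (intro sum_mono mult_left_le_one_le walk_weight_nonneg walk_weight_le_1) auto
  moreover have "0 \<le> (\<Sum>e\<in>cube. diff_energy e u)"
    using diff_energy_nonneg[OF assms] by (intro sum_nonneg)
  ultimately show ?thesis
    using sum_diff_energy_cube_le[OF assms] assms by (simp add: energy_self)
qed

text \<open>
  With \<open>e k = 2\<^sup>-\<^sup>k \<langle>(1 - P\<^bsup>2^k\<^esup>) u, u\<rangle>\<close> one has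
  \<open>e k - e (k + 1) = 2\<^sup>-\<^sup>k\<^sup>-\<^sup>1 \<parallel>(1 - P\<^bsup>2^k\<^esup>) u\<parallel>\<^sup>2\<close>, so the sum telescopes to at most \<open>e 0\<close>, the energy.
\<close>

lemma sum_walk_defects_le:
  fixes u :: "int ^ 'd::finite \<Rightarrow> complex"
  assumes u: "u \<in> l2"
  shows "(\<Sum>k<K. (1 / 2) ^ (k + 1) * nsq (u - (walk ^^ (2 ^ k)) u)) \<le> Re (energy u u)"
proof -
  define e where "e k = (1 / 2) ^ k * (nsq u - Re (ip ((walk ^^ (2 ^ k)) u) u))" for k
  have step: "(1 / 2) ^ (k + 1) * nsq (u - (walk ^^ (2 ^ k)) u) = e k - e (Suc k)" for k
  proof -
    define T where "T = (walk :: (int ^ 'd \<Rightarrow> complex) \<Rightarrow> _) ^^ (2 ^ k)"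
    have "ip (T u) (T u) = ip ((walk ^^ (2 ^ Suc k)) u) u"
      using ip_walk_pow_sym[of u "T u" "2 ^ k"] ip_walk_pow_sym[of u u "2 ^ Suc k"] u
      by (simp add: T_def mult_2 funpow_add)
    then have "nsq (u - T u) = nsq u - 2 * Re (ip (T u) u) + Re (ip ((walk ^^ (2 ^ Suc k)) u) u)"
      using u Re_ip_commute[of "T u" u] by (simp add: T_def nsq_diff)
    then show ?thesis unfolding e_def T_def[symmetric] by (simp only:) (simp add: field_simps)
  qed
  have "(\<Sum>k<K. (1 / 2) ^ (k + 1) * nsq (u - (walk ^^ (2 ^ k)) u)) = e 0 - e K"
    unfolding step by (rule sum_lessThan_telescope')
  moreover have "0 \<le> e K" using Re_ip_walk_pow_le[OF u] by (simp add: e_def)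
  moreover have "e 0 = Re (energy u u)" using u by (simp add: e_def energy_def l2.diff_left)
  ultimately show ?thesis by simp
qed

section \<open>The return probabilities\<close>

definition delta :: "'a \<Rightarrow> 'a \<Rightarrow> complex" where
  "delta x = (\<lambda>y. if y = x then 1 else 0)"

lemma delta_l2 [simp]: "delta x \<in> l2"
  by (rule l2_finite_support) (simp add: delta_def)

lemma ip_delta: "ip u (delta x) = u x"
proof -
  have "ip u (delta x) = (\<Sum>\<^sub>\<infinity>y\<in>{x}. u y)"
    unfolding ip_def by (rule infsum_cong_neutral) (auto simp: delta_def)
  then show ?thesis by simp
qed

text \<open>
  The probability that \<open>2 m\<close> flips of a fair coin show \<open>m + k\<close> heads: one step of a coordinate amounts
  to two flips.
\<close>

definition flip_prob :: "nat \<Rightarrow> int \<Rightarrow> real" where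
  "flip_prob m k = (if 0 \<le> int m + k then real ((2 * m) choose nat (int m + k)) else 0) / 4 ^ m"

lemma flip_prob_Suc: "flip_prob (Suc m) k = flip_prob m (k - 1) / 4 + flip_prob m k / 2 + flip_prob m (k + 1) / 4"
proof -
  consider "int m + k < -1" | "int m + k = -1" | "int m + k = 0" | "1 \<le> int m + k"
    by linarith
  then show ?thesis
  proof cases
    case 4
    define n where "n = nat (int m + k - 1)"
    have n: "int m + k = int (Suc n)" using 4 by (simp add: n_def)
    then have *: "nat (1 + int m + k) = Suc (Suc n)" "nat (int m + k) = Suc n"
      "nat (int m + (k - 1)) = n" "nat (int m + (k + 1)) = Suc (Suc n)"
      by linarith+
    show ?thesis using n * by (simp add: flip_prob_def field_simps)
  qed (auto simp: flip_prob_def field_simps nat_eq_iff)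
qed

lemma walk_pow_delta:
  "(walk ^^ m) (delta x) y = of_real (\<Prod>j\<in>UNIV. flip_prob m (y $ j - x $ j))"
proof (induction m arbitrary: y)
  case 0
  have "flip_prob 0 k = (if k = 0 then 1 else 0)" for k
    by (simp add: flip_prob_def binomial_eq_0)
  then show ?case by (auto simp: delta_def vec_eq_iff)
next
  case (Suc m)
  have "(walk ^^ Suc m) (delta x) y
      = (\<Sum>e\<in>cube. of_real (\<Prod>j\<in>UNIV. step_weight (e $ j) * flip_prob m (y $ j - x $ j + e $ j)))"
    by (simp add: walk_apply Suc walk_weight_def prod.distrib algebra_simps)
  also have "\<dots> = of_real (\<Sum>e\<in>cube. \<Prod>j\<in>UNIV. step_weight (e $ j) * flip_prob m (y $ j - x $ j + e $ j))"
    by simp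
  also have "(\<Sum>e\<in>cube. \<Prod>j\<in>UNIV. step_weight (e $ j) * flip_prob m (y $ j - x $ j + e $ j))
     = (\<Prod>j\<in>UNIV. \<Sum>k\<in>{-1, 0, 1}. step_weight k * flip_prob m (y $ j - x $ j + k))"
    by (rule sum_cube_prod[of "\<lambda>j k. step_weight k * flip_prob m (y $ j - x $ j + k)"])
  also have "\<dots> = (\<Prod>j\<in>UNIV. flip_prob (Suc m) (y $ j - x $ j))"
    by (simp add: flip_prob_Suc step_weight_def algebra_simps)
  finally show ?case .
qed

lemma flip_prob_0_Suc: "flip_prob (Suc m) 0 = flip_prob m 0 * (2 * real m + 1) / (2 * real m + 2)"
proof -
  have sym: "Suc (2 * m) choose m = Suc (2 * m) choose Suc m"
    using binomial_symmetric[of m "Suc (2 * m)"] by simp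
  have "(2 * Suc m) choose Suc m = 2 * (Suc (2 * m) choose Suc m)"
    using sym by simp
  moreover have "Suc (2 * m) * ((2 * m) choose m) = (Suc (2 * m) choose Suc m) * Suc m"
    by (rule Suc_times_binomial_eq)
  ultimately have "Suc m * ((2 * Suc m) choose Suc m) = 2 * Suc (2 * m) * ((2 * m) choose m)"
    by (simp only: mult_ac)
  then have *: "real (Suc m) * real ((2 * Suc m) choose Suc m) = 2 * real (Suc (2 * m)) * real ((2 * m) choose m)"
    by (metis of_nat_mult of_nat_numeral)
  define X Y where "X = real ((2 * Suc m) choose Suc m)" and "Y = real ((2 * m) choose m)"
  have b: "flip_prob (Suc m) 0 = X / 4 ^ Suc m" "flip_prob m 0 = Y / 4 ^ m"
    unfolding flip_prob_def X_def Y_def by (simp_all add: nat_add_distrib del: binomial_Suc_Suc)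
  have X: "X = 2 * (2 * real m + 1) * Y / (real m + 1)"
    using * unfolding X_def[symmetric] Y_def[symmetric] by (simp add: field_simps)
  have cancel: "2 * a * Y / M / (4 * Q) = Y / Q * a / (2 * M)" if "M \<noteq> 0" "Q \<noteq> 0" for a M Q :: real
    using that by (simp add: field_simps)
  show ?thesis unfolding b X using cancel[of "real m + 1" "4 ^ m" "2 * real m + 1"]
    by (simp add: algebra_simps)
qed

lemma flip_prob_0_pos: "0 < flip_prob m 0"
  by (simp add: flip_prob_def)

text \<open>
  The decay like \<open>m\<close> to the power \<open>-1/2\<close>. The factor \<open>2 m + 1\<close> makes the induction close, since
  \<open>(2 m + 1) (2 m + 3) \<le> (2 m + 2)\<^sup>2\<close>.
\<close>

lemma flip_prob_0_le: "(flip_prob m 0)\<^sup>2 * (2 * real m + 1) \<le> 1"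
proof (induction m)
  case 0
  then show ?case by (simp add: flip_prob_def)
next
  case (Suc m)
  have "(flip_prob (Suc m) 0)\<^sup>2 * (2 * real (Suc m) + 1)
     = ((flip_prob m 0)\<^sup>2 * (2 * real m + 1)) * ((2 * real m + 1) * (2 * real m + 3) / (2 * real m + 2)\<^sup>2)"
    by (simp add: flip_prob_0_Suc power_divide power_mult_distrib field_simps power2_eq_square)
  also have "\<dots> \<le> 1 * 1"
  proof (intro mult_mono Suc)
    have "(2 * real m + 1) * (2 * real m + 3) \<le> (2 * real m + 2)\<^sup>2"
      by (simp add: power2_eq_square algebra_simps)
    then show "(2 * real m + 1) * (2 * real m + 3) / (2 * real m + 2)\<^sup>2 \<le> 1"
      by (subst divide_le_eq_1_pos) auto
  qed auto
  finally show ?case by simp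
qed

text \<open>
  The type argument carries the dimension.
\<close>

definition return_prob :: "'d::finite itself \<Rightarrow> nat \<Rightarrow> real" where
  "return_prob _ m = flip_prob m 0 ^ CARD('d)"

lemma return_prob_nonneg: "0 \<le> return_prob T m"
  using flip_prob_0_pos[of m] by (simp add: return_prob_def)

lemma return_prob_le:
  "return_prob TYPE('d::finite) m \<le> (real m + 1) powr (- (real CARD('d) / 2))"
proof -
  have "(flip_prob m 0)\<^sup>2 \<le> 1 / (real m + 1)"
  proof -
    have "(flip_prob m 0)\<^sup>2 * (real m + 1) \<le> (flip_prob m 0)\<^sup>2 * (2 * real m + 1)"
      by (intro mult_left_mono) auto
    with flip_prob_0_le[of m] show ?thesis by (simp add: pos_le_divide_eq)
  qed
  then have "flip_prob m 0 \<le> sqrt (1 / (real m + 1))" by (rule real_le_rsqrt)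
  also have "\<dots> = (real m + 1) powr (- (1 / 2))"
    by (simp add: powr_minus powr_half_sqrt real_sqrt_divide inverse_eq_divide)
  finally have "flip_prob m 0 ^ CARD('d) \<le> ((real m + 1) powr (- (1 / 2))) ^ CARD('d)"
    using flip_prob_0_pos[of m] by (intro power_mono) auto
  also have "\<dots> = (real m + 1) powr (- (real CARD('d) / 2))"
    by (simp add: powr_powr mult.commute flip: powr_realpow)
  finally show ?thesis by (simp add: return_prob_def)
qed

lemma ip_walk_pow_delta:
  "ip ((walk ^^ a) (delta (x :: int ^ 'd::finite))) ((walk ^^ b) (delta x)) = of_real (return_prob TYPE('d) (a + b))"
proof -
  have "ip ((walk ^^ a) (delta x)) ((walk ^^ b) (delta x)) = ip ((walk ^^ (b + a)) (delta x)) (delta x)"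
    by (subst ip_walk_pow_sym[symmetric]) (simp_all add: funpow_add)
  also have "\<dots> = (walk ^^ (b + a)) (delta x) x" by (rule ip_delta)
  also have "\<dots> = of_real (return_prob TYPE('d) (a + b))"
    by (simp add: walk_pow_delta return_prob_def add.commute)
  finally show ?thesis .
qed

section \<open>The Cwikel-Lieb-Rozenblum inequality on the lattice\<close>

text \<open>
  A discrete comparison of \<open>\<Sum> k\<^sup>-\<^sup>s\<close> with a telescoping sum, by the mean value theorem. The factor
  \<open>2 powr s\<close> compensates for the evaluation of the derivative at an intermediate point of \<open>[a, a + 1]\<close>,
  which is at most \<open>2 a\<close>.
\<close>

lemma power_tail_step:
  assumes "1 < s"
  shows "(real k + 1) powr (- s)
    \<le> 2 powr s / (s - 1) * ((real k + 1) powr (1 - s) - (real (Suc k) + 1) powr (1 - s))"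
proof -
  define a where "a = real k + 1"
  have a: "1 \<le> a" by (simp add: a_def)
  have "\<exists>z. a < z \<and> z < a + 1 \<and>
      (a + 1) powr (1 - s) - a powr (1 - s) = (a + 1 - a) * ((1 - s) * z powr (1 - s - 1))"
    using a by (intro MVT2) (auto intro!: derivative_eq_intros)
  then obtain z where z: "a < z" "z < a + 1"
    "a powr (1 - s) - (a + 1) powr (1 - s) = (s - 1) * z powr (- s)"
    by (auto simp: algebra_simps)
  have "2 powr (- s) * a powr (- s) = (2 * a) powr (- s)"
    using a by (simp add: powr_mult)
  also have "\<dots> \<le> z powr (- s)"
    using a z assms by (intro powr_mono2') auto
  finally have "2 powr s * (2 powr (- s) * a powr (- s)) \<le> 2 powr s * z powr (- s)"
    by (intro mult_left_mono) auto
  moreover have "2 powr s * (2 powr (- s) * a powr (- s)) = a powr (- s)"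
    by (simp flip: mult.assoc powr_add)
  ultimately have "a powr (- s) \<le> 2 powr s * z powr (- s)"
    by (simp only:)
  also have "\<dots> = 2 powr s / (s - 1) * (a powr (1 - s) - (a + 1) powr (1 - s))"
    using assms z(3) by simp
  finally show ?thesis by (simp add: a_def add_ac)
qed

lemma sum_power_tail_le:
  assumes "1 < s"
  shows "(\<Sum>k=m..<N. (real k + 1) powr (- s)) \<le> 2 powr s / (s - 1) * (real m + 1) powr (1 - s)"
proof (cases "m \<le> N")
  case True
  have "(\<Sum>k=m..<N. (real k + 1) powr (- s))
      \<le> (\<Sum>k=m..<N. 2 powr s / (s - 1) * ((real k + 1) powr (1 - s) - (real (Suc k) + 1) powr (1 - s)))"
    using power_tail_step[OF assms] by (intro sum_mono)
  also have "\<dots> = 2 powr s / (s - 1) * (\<Sum>k=m..<N. (real k + 1) powr (1 - s) - (real (Suc k) + 1) powr (1 - s))"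
    by (simp only: sum_distrib_left)
  also have "(\<Sum>k=m..<N. (real k + 1) powr (1 - s) - (real (Suc k) + 1) powr (1 - s))
      = (real m + 1) powr (1 - s) - (real N + 1) powr (1 - s)"
    using sum_Suc_diff'[OF True, of "\<lambda>k. - ((real k + 1) powr (1 - s))"]
    by simp
  also have "2 powr s / (s - 1) * \<dots> \<le> 2 powr s / (s - 1) * (real m + 1) powr (1 - s)"
    using assms by (intro mult_left_mono) auto
  finally show ?thesis .
qed (use assms in auto)

lemma walk_pow_at:
  "u \<in> l2 \<Longrightarrow> (walk ^^ m) u x = ip u ((walk ^^ m) (delta x))"
  by (simp add: ip_delta flip: ip_walk_pow_sym)

text \<open>
  The value at \<open>x\<close> is the inner product of \<open>u\<close> with \<open>P\<^sup>N \<delta>\<^sub>x\<close>, whose squared norm is a return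
  probability.
\<close>

lemma walk_pow_pointwise_tendsto_0:
  fixes u :: "int ^ 'd::finite \<Rightarrow> complex"
  assumes u: "u \<in> l2" and d: "2 \<le> CARD('d)"
  shows "(\<lambda>N. (walk ^^ N) u x) \<longlonglongrightarrow> 0"
proof (rule Lim_null_comparison)
  have "cmod ((walk ^^ N) u x) \<le> (nsq u + 1) / 2 * sqrt (inverse (real (Suc N)))" for N
  proof -
    \<comment> \<open>for this weight both terms of \<open>norm_ip_le\<close> are of order \<open>c\<close>, as the return probability is at most \<open>c\<^sup>2\<close>\<close>
    define c where "c = sqrt (inverse (real (Suc N)))"
    have c: "0 < c" "c\<^sup>2 = inverse (real (Suc N))" by (auto simp: c_def)
    have "nsq ((walk ^^ N) (delta x)) = return_prob TYPE('d) (N + N)"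
      by (simp add: ip_walk_pow_delta)
    also have "\<dots> \<le> (real (N + N) + 1) powr (- (real CARD('d) / 2))"
      by (rule return_prob_le)
    also have "\<dots> \<le> (real (N + N) + 1) powr (- 1)"
      using d by (intro powr_mono) auto
    also have "\<dots> \<le> c\<^sup>2"
      unfolding c by (auto simp: powr_minus field_simps)
    finally have "nsq ((walk ^^ N) (delta x)) / c \<le> c"
      using c by (simp add: pos_divide_le_eq power2_eq_square)
    with norm_ip_le[OF u _ c(1), of "(walk ^^ N) (delta x)"] u
    have "cmod ((walk ^^ N) u x) \<le> (c * nsq u + c) / 2"
      by (simp add: walk_pow_at)
    then show ?thesis by (simp add: c_def algebra_simps)
  qed
  then show "\<forall>\<^sub>F N in sequentially. cmod ((walk ^^ N) u x) \<le> (nsq u + 1) / 2 * sqrt (inverse (real (Suc N)))"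
    by (rule always_eventually[OF allI])
  have "(\<lambda>N. sqrt (inverse (real (Suc N)))) \<longlonglongrightarrow> sqrt 0"
    by (intro tendsto_real_sqrt LIMSEQ_inverse_real_of_nat)
  then show "(\<lambda>N. (nsq u + 1) / 2 * sqrt (inverse (real (Suc N)))) \<longlonglongrightarrow> 0"
    by (intro tendsto_mult_right_zero) simp
qed

text \<open>
  A function without energy is a fixed point of the walk, and the powers of the walk tend to zero.
  This definiteness is what makes orthonormalization in the energy form possible.
\<close>

lemma energy_eq_0:
  fixes u :: "int ^ 'd::finite \<Rightarrow> complex"
  assumes u: "u \<in> l2" and d: "2 \<le> CARD('d)" and "Re (energy u u) = 0"
  shows "u = 0"
proof
  fix x
  have "nsq (u - walk u) = 0"
    using sum_walk_defects_le[OF u, of 1] assms nsq_nonneg[of "u - walk u"] by (simp add: l2_diff)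
  then have "u - walk u = 0" using u by (intro nsq_eq_0 l2_diff) auto
  then have "walk u = u" by simp
  then have "(walk ^^ N) u = u" for N by (induction N) auto
  then show "u x = 0 x"
    using walk_pow_pointwise_tendsto_0[OF u d, of x] by (simp add: LIMSEQ_const_iff)
qed

lemma green_equation:
  fixes f :: "int ^ 'd::finite \<Rightarrow> complex"
  assumes "m \<le> N"
  shows "(\<Sum>k=m..<N. (walk ^^ k) f) - walk (\<Sum>k=m..<N. (walk ^^ k) f) = (walk ^^ m) f - (walk ^^ N) f"
  using assms
proof (induction N rule: dec_induct)
  case base
  have "walk 0 = (0 :: int ^ 'd \<Rightarrow> complex)" using walk_scale[of 0 0] by (simp add: cscale_def flip: zero_fun_def)
  then show ?case
    by (simp only: atLeastLessThan_empty order_refl sum.empty diff_self)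
next
  case (step N)
  define w where "w = (\<Sum>k=m..<N. (walk ^^ k) f)"
  have w: "(\<Sum>k=m..<Suc N. (walk ^^ k) f) = w + (walk ^^ N) f"
    using step.hyps by (simp add: w_def add.commute)
  have "(w + (walk ^^ N) f) - walk (w + (walk ^^ N) f)
      = (w - walk w) + ((walk ^^ N) f - walk ((walk ^^ N) f))"
    by (simp only: walk_add add_diff_add)
  also have "w - walk w = (walk ^^ m) f - (walk ^^ N) f"
    using step.IH by (simp only: w_def)
  also have "(walk ^^ m) f - (walk ^^ N) f + ((walk ^^ N) f - walk ((walk ^^ N) f))
      = (walk ^^ m) f - (walk ^^ Suc N) f"
    by (simp only: funpow.simps o_apply diff_add_cancel add_diff_eq)
  finally show ?case unfolding w .
qed

text \<open>
  The truncated Green function \<open>w = \<Sum> P\<^sup>k \<delta>\<^sub>x\<close>, summed over \<open>m \<le> k < N\<close>, represents the functional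
  \<open>u \<mapsto> (P\<^sup>m u - P\<^sup>N u) x\<close> in the energy form. Bessel's inequality bounds the sum by the energy of
  \<open>w\<close>, which is at most a tail of the series of return probabilities.
\<close>

lemma sum_walk_pow_pointwise_le:
  fixes v :: "nat \<Rightarrow> int ^ 'd::finite \<Rightarrow> complex"
  defines "s \<equiv> real CARD('d) / 2"
  assumes d: "3 \<le> CARD('d)" and v: "energy.orthonormal n v"
  shows "(\<Sum>i<n. (cmod ((walk ^^ m) (v i) x))\<^sup>2) \<le> 2 powr s / (s - 1) * (real m + 1) powr (1 - s)"
proof (rule tendsto_upperbound)
  have s: "1 < s" using d by (simp add: s_def)
  have vl: "v i \<in> l2" if "i < n" for i
    using v that by (auto simp: energy.orthonormal_def)
  show "(\<lambda>N. \<Sum>i<n. (cmod ((walk ^^ m) (v i) x - (walk ^^ N) (v i) x))\<^sup>2) \<longlonglongrightarrow>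
      (\<Sum>i<n. (cmod ((walk ^^ m) (v i) x))\<^sup>2)"
    using walk_pow_pointwise_tendsto_0[OF vl, of _ x] d
    by (auto intro!: tendsto_eq_intros)
  have "(\<Sum>i<n. (cmod ((walk ^^ m) (v i) x - (walk ^^ N) (v i) x))\<^sup>2)
      \<le> 2 powr s / (s - 1) * (real m + 1) powr (1 - s)" if "m \<le> N" for N
  proof -
    define w where "w = (\<Sum>k=m..<N. (walk ^^ k) (delta x))"
    have w: "w \<in> l2" unfolding w_def by (intro l2_sum) auto
    have green: "w - walk w = (walk ^^ m) (delta x) - (walk ^^ N) (delta x)"
      unfolding w_def by (rule green_equation[OF that])
    have "energy (v i) w = (walk ^^ m) (v i) x - (walk ^^ N) (v i) x" if "i < n" for i
    proof -
      have "energy (v i) w = ip (v i) (w - walk w)"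
        using vl[OF that] w by (simp add: energy_def l2.diff_left l2.diff_right ip_walk_sym)
      then show ?thesis
        using vl[OF that] unfolding green by (simp add: l2.diff_right walk_pow_at)
    qed
    then have "(\<Sum>i<n. (cmod ((walk ^^ m) (v i) x - (walk ^^ N) (v i) x))\<^sup>2)
        = (\<Sum>i<n. (cmod (energy (v i) w))\<^sup>2)"
      by simp
    also have "\<dots> \<le> Re (energy w w)" by (rule energy.bessel[OF v w])
    also have "energy w w = (\<Sum>k=m..<N. ip (w - walk w) ((walk ^^ k) (delta x)))"
      unfolding energy_def using w by (subst (3) w_def, subst l2.sum_right) (auto simp: l2_diff)
    also have "Re \<dots> = (\<Sum>k=m..<N. return_prob TYPE('d) (m + k) - return_prob TYPE('d) (N + k))"
      unfolding green by (simp add: l2.diff_left ip_walk_pow_delta)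
    also have "\<dots> \<le> (\<Sum>k=m..<N. (real k + 1) powr (- s))"
    proof (rule sum_mono)
      fix k
      have "return_prob TYPE('d) (m + k) \<le> (real (m + k) + 1) powr (- s)"
        unfolding s_def by (rule return_prob_le)
      also have "\<dots> \<le> (real k + 1) powr (- s)"
        using s by (intro powr_mono2') auto
      finally show "return_prob TYPE('d) (m + k) - return_prob TYPE('d) (N + k) \<le> (real k + 1) powr (- s)"
        using return_prob_nonneg[of "TYPE('d)" "N + k"] by linarith
    qed
    also have "\<dots> \<le> 2 powr s / (s - 1) * (real m + 1) powr (1 - s)"
      by (rule sum_power_tail_le[OF s])
    finally show ?thesis .
  qed
  then show "\<forall>\<^sub>F N in sequentially. (\<Sum>i<n. (cmod ((walk ^^ m) (v i) x - (walk ^^ N) (v i) x))\<^sup>2)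
      \<le> 2 powr s / (s - 1) * (real m + 1) powr (1 - s)"
    unfolding eventually_sequentially by blast
qed simp

lemma dyadic_bracket:
  assumes "0 < y" "y < (1::real)"
  obtains k where "(1 / 2) ^ Suc k \<le> y" "y < (1 / 2) ^ k"
proof -
  obtain m where m: "(1 / 2) ^ m < y"
    using real_arch_pow_inv[of y "1 / 2"] assms by auto
  have "(1 / 2) ^ Suc m \<le> ((1 / 2) ^ m :: real)" by simp
  with m have ex: "(1 / 2) ^ Suc m \<le> y" by linarith
  define k where "k = (LEAST k. (1 / 2) ^ Suc k \<le> y)"
  have k: "(1 / 2) ^ Suc k \<le> y" unfolding k_def by (rule LeastI[of _ m]) (rule ex)
  have "y < (1 / 2) ^ k"
  proof (cases k)
    case (Suc j)
    then have "\<not> (1 / 2) ^ Suc j \<le> y" using not_less_Least[of j "\<lambda>k. (1 / 2) ^ Suc k \<le> y"] by (simp add: k_def)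
    then show ?thesis using Suc by simp
  qed (use assms in simp)
  with k show ?thesis by (rule that)
qed

text \<open>
  With \<open>g k x\<close> the squared defects at scale \<open>2\<^sup>k\<close>, the density \<open>\<rho>\<close> is at most \<open>2 g k\<close> plus a constant
  times \<open>2\<close> to the power \<open>- k (s - 1)\<close>. At a site with \<open>p x < 1/8\<close> one takes \<open>k\<close> with \<open>8 p x\<close> between
  \<open>(1/2)\<^sup>k\<^sup>+\<^sup>1\<close> and \<open>(1/2)\<^sup>k\<close>. Then \<open>2 p x g k x\<close> is at most half of a term of the telescoping sum,
  so that these contributions add up to at most \<open>n / 2\<close>, and the other part is of order \<open>(p x)\<^sup>s\<close>. At the
  remaining sites the bound of \<open>\<rho>\<close> by a constant suffices.
\<close>

lemma sum_potential_density_le: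
  fixes v :: "nat \<Rightarrow> int ^ 'd::finite \<Rightarrow> complex"
  defines "s \<equiv> real CARD('d) / 2"
  assumes d: "3 \<le> CARD('d)" and v: "energy.orthonormal n v"
    and L: "finite L" and p: "\<And>x. x \<in> L \<Longrightarrow> 0 \<le> p x"
  shows "(\<Sum>x\<in>L. p x * (\<Sum>i<n. (cmod (v i x))\<^sup>2))
    \<le> real n / 2 + 2 * (2 powr s / (s - 1)) * 16 powr (s - 1) * (\<Sum>x\<in>L. p x powr s)"
proof -
  define C where "C = 2 powr s / (s - 1)"
  have s: "1 < s" using d by (simp add: s_def)
  have C: "0 \<le> C" using s by (simp add: C_def)
  have vl: "v i \<in> l2" if "i < n" for i
    using v that by (auto simp: energy.orthonormal_def)
  define \<rho> where "\<rho> x = (\<Sum>i<n. (cmod (v i x))\<^sup>2)" for x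
  define g where "g k x = (\<Sum>i<n. (cmod (v i x - (walk ^^ (2 ^ k)) (v i) x))\<^sup>2)" for k x
  have g0: "0 \<le> g k x" for k x by (simp add: g_def sum_nonneg)
  have bound: "(\<Sum>i<n. (cmod ((walk ^^ m) (v i) x))\<^sup>2) \<le> C * (real m + 1) powr (1 - s)" for m x
    unfolding C_def s_def by (rule sum_walk_pow_pointwise_le[OF d v])
  have pw: "\<exists>k. p x * \<rho> x \<le> (1 / 2) ^ Suc k * g k x / 2 + 2 * C * 16 powr (s - 1) * p x powr s"
    if xL: "x \<in> L" for x
  proof -
    consider "p x = 0" | "1 / 8 \<le> p x" | "0 < p x" "p x < 1 / 8" using p[OF xL] by fastforce
    then show ?thesis
    proof cases
      case 1
      then show ?thesis using g0 by auto
    next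
      case 2
      have "\<rho> x \<le> C" using bound[of 0 x] by (simp add: \<rho>_def)
      also have "\<dots> \<le> C * (2 * (16 * p x) powr (s - 1))"
      proof -
        have "1 \<le> (16 * p x) powr (s - 1)" using 2 s by (intro ge_one_powr_ge_zero) auto
        then show ?thesis using C mult_left_mono[of 1 "2 * (16 * p x) powr (s - 1)" C] by simp
      qed
      finally have "p x * \<rho> x \<le> p x * (C * (2 * (16 * p x) powr (s - 1)))"
        using 2 by (intro mult_left_mono) auto
      also have "\<dots> = 2 * C * 16 powr (s - 1) * p x powr s"
        using 2 by (simp add: powr_mult powr_diff)
      finally show ?thesis using g0[of 0 x] by (intro exI[of _ 0]) simp
    next
      case 3
      then obtain k where k: "(1 / 2) ^ Suc k \<le> 8 * p x" "8 * p x < (1 / 2) ^ k"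
        using dyadic_bracket[of "8 * p x"] by auto
      have "\<rho> x \<le> (\<Sum>i<n. 2 * (cmod (v i x - (walk ^^ (2 ^ k)) (v i) x))\<^sup>2 + 2 * (cmod ((walk ^^ (2 ^ k)) (v i) x))\<^sup>2)"
        unfolding \<rho>_def
      proof (rule sum_mono)
        fix i
        show "(cmod (v i x))\<^sup>2 \<le> 2 * (cmod (v i x - (walk ^^ (2 ^ k)) (v i) x))\<^sup>2 + 2 * (cmod ((walk ^^ (2 ^ k)) (v i) x))\<^sup>2"
          using cmod_add_sq_le[of "v i x - (walk ^^ (2 ^ k)) (v i) x" "(walk ^^ (2 ^ k)) (v i) x"] by simp
      qed
      also have "\<dots> = 2 * g k x + 2 * (\<Sum>i<n. (cmod ((walk ^^ (2 ^ k)) (v i) x))\<^sup>2)"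
        by (simp add: g_def sum.distrib sum_distrib_left)
      also have "(\<Sum>i<n. (cmod ((walk ^^ (2 ^ k)) (v i) x))\<^sup>2) \<le> C * (real (2 ^ k) + 1) powr (1 - s)"
        by (rule bound)
      also have "(real (2 ^ k) + 1) powr (1 - s) \<le> (1 / (16 * p x)) powr (1 - s)"
      proof (rule powr_mono2')
        have "1 / (16 * p x) \<le> 2 ^ k"
          using k(1) 3 by (simp add: power_one_over field_simps)
        then show "1 / (16 * p x) \<le> real (2 ^ k) + 1" by simp
      qed (use s 3 in auto)
      also have "\<dots> = (16 * p x) powr (s - 1)"
        using 3 powr_divide[of 1 "16 * p x" "1 - s"] powr_minus[of "16 * p x" "s - 1"]
        by (simp add: inverse_eq_divide)
      finally have "\<rho> x \<le> 2 * g k x + 2 * (C * (16 * p x) powr (s - 1))"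
        using C by (simp add: mult_left_mono)
      then have "p x * \<rho> x \<le> p x * (2 * g k x + 2 * (C * (16 * p x) powr (s - 1)))"
        using 3 by (intro mult_left_mono) auto
      also have "\<dots> = 8 * p x * g k x / 4 + 2 * C * 16 powr (s - 1) * p x powr s"
        using 3 by (simp add: powr_mult powr_diff algebra_simps)
      also have "8 * p x * g k x / 4 \<le> (1 / 2) ^ Suc k * g k x / 2"
        using mult_right_mono[OF less_imp_le[OF k(2)] g0[of k x]] by simp
      finally show ?thesis by (intro exI[of _ k]) simp
    qed
  qed
  then obtain \<kappa> where \<kappa>: "\<And>x. x \<in> L \<Longrightarrow>
      p x * \<rho> x \<le> (1 / 2) ^ Suc (\<kappa> x) * g (\<kappa> x) x / 2 + 2 * C * 16 powr (s - 1) * p x powr s"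
    by metis
  obtain K where K: "\<And>x. x \<in> L \<Longrightarrow> \<kappa> x < K"
    using L finite_nat_set_iff_bounded[of "\<kappa> ` L"] by auto
  have "(\<Sum>x\<in>L. (1 / 2) ^ Suc (\<kappa> x) * g (\<kappa> x) x) \<le> (\<Sum>x\<in>L. \<Sum>k<K. (1 / 2) ^ Suc k * g k x)"
  proof (rule sum_mono)
    fix x assume "x \<in> L"
    then show "(1 / 2) ^ Suc (\<kappa> x) * g (\<kappa> x) x \<le> (\<Sum>k<K. (1 / 2) ^ Suc k * g k x)"
      using member_le_sum[of "\<kappa> x" "{..<K}" "\<lambda>k. (1 / 2) ^ Suc k * g k x"] K g0 by auto
  qed
  also have "\<dots> = (\<Sum>i<n. \<Sum>k<K. (1 / 2) ^ Suc k * (\<Sum>x\<in>L. (cmod ((v i - (walk ^^ (2 ^ k)) (v i)) x))\<^sup>2))"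
    unfolding g_def sum_distrib_left
    by (subst sum.swap, subst (2) sum.swap, subst sum.swap) simp
  also have "\<dots> \<le> (\<Sum>i<n. \<Sum>k<K. (1 / 2) ^ (k + 1) * nsq (v i - (walk ^^ (2 ^ k)) (v i)))"
  proof (intro sum_mono)
    fix i k assume "i \<in> {..<n}"
    then have l: "v i - (walk ^^ (2 ^ k)) (v i) \<in> l2" using vl by (intro l2_diff) auto
    have "(\<Sum>x\<in>L. (cmod ((v i - (walk ^^ (2 ^ k)) (v i)) x))\<^sup>2) \<le> nsq (v i - (walk ^^ (2 ^ k)) (v i))"
      unfolding nsq_eq[OF l] using L l2_summable[OF l] by (intro finite_sum_le_infsum) auto
    then show "(1 / 2) ^ Suc k * (\<Sum>x\<in>L. (cmod ((v i - (walk ^^ (2 ^ k)) (v i)) x))\<^sup>2)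
      \<le> (1 / 2) ^ (k + 1) * nsq (v i - (walk ^^ (2 ^ k)) (v i))"
      by simp
  qed
  also have "\<dots> \<le> (\<Sum>i<n. Re (energy (v i) (v i)))"
    using vl by (intro sum_mono sum_walk_defects_le) auto
  also have "\<dots> = real n" using v by (simp add: energy.orthonormal_def)
  finally have *: "(\<Sum>x\<in>L. (1 / 2) ^ Suc (\<kappa> x) * g (\<kappa> x) x) \<le> real n" .
  have "(\<Sum>x\<in>L. p x * \<rho> x)
      \<le> (\<Sum>x\<in>L. (1 / 2) ^ Suc (\<kappa> x) * g (\<kappa> x) x / 2 + 2 * C * 16 powr (s - 1) * p x powr s)"
    by (intro sum_mono \<kappa>)
  also have "\<dots> = (\<Sum>x\<in>L. (1 / 2) ^ Suc (\<kappa> x) * g (\<kappa> x) x) / 2 + 2 * C * 16 powr (s - 1) * (\<Sum>x\<in>L. p x powr s)"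
    by (simp only: sum.distrib sum_distrib_left sum_divide_distrib)
  also have "\<dots> \<le> real n / 2 + 2 * C * 16 powr (s - 1) * (\<Sum>x\<in>L. p x powr s)"
    using * by simp
  finally show ?thesis by (simp add: \<rho>_def C_def)
qed

section \<open>Smooth partitions of unity\<close>

text \<open>
  The classical functions that vanish to infinite order at \<open>0\<close>. The powers are included so that the
  family is closed under differentiation up to linear combinations.
\<close>

definition flat :: "nat \<Rightarrow> real \<Rightarrow> real" where
  "flat n t = (if 0 < t then exp (- (1 / t)) * (1 / t) ^ n else 0)"

lemma flat_tendsto_0: "(flat n \<longlongrightarrow> 0) (at 0)"
proof (rule filterlim_split_at)
  show "(flat n \<longlongrightarrow> 0) (at_left 0)"
    by (rule tendsto_eventually) (auto simp: flat_def eventually_at_left_field intro!: exI[of _ "-1"])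
  have "((\<lambda>t. (inverse t) ^ n / exp (inverse t)) \<longlongrightarrow> 0) (at_right (0::real))"
    by (rule filterlim_compose[OF tendsto_power_div_exp_0 filterlim_inverse_at_top_right])
  moreover have "\<forall>\<^sub>F t in at_right 0. (inverse t) ^ n / exp (inverse t) = flat n t"
    by (auto simp: flat_def eventually_at_right_field inverse_eq_divide exp_minus field_simps
        intro!: exI[of _ 1])
  ultimately show "(flat n \<longlongrightarrow> 0) (at_right 0)"
    by (rule Lim_transform_eventually)
qed

lemma flat_DERIV: "(flat n has_real_derivative (flat (n + 2) t - real n * flat (n + 1) t)) (at t)"
proof -
  consider "t < 0" | "t = 0" | "0 < t" by linarith
  then show ?thesis
  proof cases
    case 1
    have "((\<lambda>_. 0) has_real_derivative 0) (at t)" by simp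
    then have "(flat n has_real_derivative 0) (at t)"
      by (rule has_field_derivative_transform_within_open[where S = "{..<0}"]) (use 1 in \<open>auto simp: flat_def\<close>)
    then show ?thesis using 1 by (simp add: flat_def)
  next
    case 2
    have "flat n h / h = flat (n + 1) h" for h
      by (simp add: flat_def)
    then have "(flat n has_real_derivative 0) (at 0)"
      using flat_tendsto_0[of "n + 1"] by (simp add: has_field_derivative_iff flat_def[of n 0])
    then show ?thesis using 2 by (simp add: flat_def)
  next
    case 3
    have "((\<lambda>t. exp (- (1 / t)) * (1 / t) ^ n) has_real_derivative
       (flat (n + 2) t - real n * flat (n + 1) t)) (at t)"
      using 3
      by (auto intro!: derivative_eq_intros simp: flat_def power2_eq_square)
         (cases n; simp add: field_simps)
    then show ?thesis
      by (rule has_field_derivative_transform_within_open[where S = "{0<..}"]) (use 3 in \<open>auto simp: flat_def\<close>)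
  qed
qed

text \<open>
  A class of functions that is closed under differentiation. It is generated from the flat functions
  rather than described by differentiability of all orders because closure under products and
  reciprocals is then immediate.
\<close>

inductive elementary :: "(real \<Rightarrow> real) \<Rightarrow> bool" where
  const: "elementary (\<lambda>_. c)"
| flat: "elementary (flat n)"
| add: "elementary f \<Longrightarrow> elementary g \<Longrightarrow> elementary (\<lambda>t. f t + g t)"
| mult: "elementary f \<Longrightarrow> elementary g \<Longrightarrow> elementary (\<lambda>t. f t * g t)"
| affine: "elementary f \<Longrightarrow> elementary (\<lambda>t. f (a * t + b))"
| inverse: "elementary f \<Longrightarrow> (\<And>t. f t \<noteq> 0) \<Longrightarrow> elementary (\<lambda>t. inverse (f t))"

lemma elementary_cmult: "elementary f \<Longrightarrow> elementary (\<lambda>t. c * f t)"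
  by (intro elementary.mult elementary.const)

lemma elementary_has_derivative:
  "elementary f \<Longrightarrow> \<exists>f'. elementary f' \<and> (\<forall>t. (f has_real_derivative f' t) (at t))"
proof (induction rule: elementary.induct)
  case (const c)
  show ?case by (intro exI[of _ "\<lambda>_. 0"]) (auto intro: elementary.const)
next
  case (flat n)
  show ?case
    using elementary.add[OF elementary.flat[of "n + 2"] elementary_cmult[OF elementary.flat[of "n + 1"], of "- real n"]]
      flat_DERIV[of n]
    by (intro exI[of _ "\<lambda>t. flat (n + 2) t + - real n * flat (n + 1) t"]) auto
next
  case (add f g)
  then obtain f' g' where "elementary f'" "elementary g'"
    "\<And>t. (f has_real_derivative f' t) (at t)" "\<And>t. (g has_real_derivative g' t) (at t)" by blast
  then show ?case
    by (intro exI[of _ "\<lambda>t. f' t + g' t"]) (auto intro: elementary.add DERIV_add)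
next
  case (mult f g)
  then obtain f' g' where "elementary f'" "elementary g'"
    "\<And>t. (f has_real_derivative f' t) (at t)" "\<And>t. (g has_real_derivative g' t) (at t)" by blast
  with mult show ?case
    by (intro exI[of _ "\<lambda>t. f' t * g t + g' t * f t"]) (auto intro: elementary.add elementary.mult DERIV_mult)
next
  case (affine f a b)
  then obtain f' where f': "elementary f'" "\<And>t. (f has_real_derivative f' t) (at t)" by blast
  have "((\<lambda>t. f (a * t + b)) has_real_derivative a * f' (a * t + b)) (at t)" for t
  proof -
    have "((\<lambda>t. f (a * t + b)) has_real_derivative f' (a * t + b) * a) (at t)"
      by (rule DERIV_chain2[OF f'(2)]) (auto intro!: derivative_eq_intros)
    then show ?thesis by (simp add: mult.commute)
  qed
  with f' show ?case
    by (intro exI[of _ "\<lambda>t. a * f' (a * t + b)"]) (auto intro: elementary_cmult elementary.affine)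
next
  case (inverse f)
  then obtain f' where f': "elementary f'" "\<And>t. (f has_real_derivative f' t) (at t)" by blast
  have "((\<lambda>t. inverse (f t)) has_real_derivative (- 1) * (inverse (f t) * f' t * inverse (f t))) (at t)" for t
    using DERIV_inverse'[OF f'(2) inverse.hyps(2)] by simp
  moreover have "elementary (\<lambda>t. (- 1) * (inverse (f t) * f' t * inverse (f t)))"
    by (intro elementary_cmult elementary.mult elementary.inverse f'(1) inverse.hyps)
  ultimately show ?case by blast
qed

lemma elementary_DERIV: "elementary f \<Longrightarrow> (f has_real_derivative deriv f t) (at t)"
  using elementary_has_derivative DERIV_imp_deriv by metis

lemma elementary_deriv: "elementary f \<Longrightarrow> elementary (deriv f)"
proof -
  assume "elementary f"
  then obtain f' where f': "elementary f'" "\<And>t. (f has_real_derivative f' t) (at t)"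
    using elementary_has_derivative by blast
  then have "deriv f = f'" by (auto intro: DERIV_imp_deriv)
  with f' show ?thesis by simp
qed

definition smooth_step :: "real \<Rightarrow> real" where
  "smooth_step t = flat 0 (t + 1 / 4) * inverse (flat 0 (t + 1 / 4) + flat 0 (1 / 4 - t))"

lemma smooth_step_denominator: "0 < flat 0 (t + 1 / 4) + flat 0 (1 / 4 - t)"
  by (auto simp: flat_def add_pos_pos)

lemma smooth_step_elementary: "elementary smooth_step"
proof -
  have *: "elementary (\<lambda>t. flat 0 (1 * t + 1 / 4))" "elementary (\<lambda>t. flat 0 ((- 1) * t + 1 / 4))"
    by (intro elementary.affine elementary.flat)+
  have "elementary (\<lambda>t. flat 0 (1 * t + 1 / 4) * inverse (flat 0 (1 * t + 1 / 4) + flat 0 ((- 1) * t + 1 / 4)))"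
  proof (intro elementary.mult elementary.inverse elementary.add *)
    show "flat 0 (1 * t + 1 / 4) + flat 0 ((- 1) * t + 1 / 4) \<noteq> 0" for t
      using smooth_step_denominator[of t] by simp
  qed
  then show ?thesis by (simp add: smooth_step_def[abs_def])
qed

lemma smooth_step_left: "t \<le> - 1 / 4 \<Longrightarrow> smooth_step t = 0"
  by (simp add: smooth_step_def flat_def)

lemma smooth_step_right: "1 / 4 \<le> t \<Longrightarrow> smooth_step t = 1"
  by (simp add: smooth_step_def flat_def)

lemma smooth_step_bounds: "\<bar>smooth_step t\<bar> \<le> 1"
proof -
  have "0 \<le> flat 0 (t + 1 / 4)" "0 \<le> flat 0 (1 / 4 - t)" by (auto simp: flat_def)
  then show ?thesis
    using smooth_step_denominator[of t] by (simp add: smooth_step_def abs_mult field_simps)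
qed

lemma deriv_smooth_step_0: "t < - 1 / 4 \<or> 1 / 4 < t \<Longrightarrow> deriv smooth_step t = 0"
proof (erule disjE)
  assume t: "t < - 1 / 4"
  have "((\<lambda>_. 0) has_real_derivative 0) (at t)" by simp
  then have "(smooth_step has_real_derivative 0) (at t)"
    by (rule has_field_derivative_transform_within_open[where S = "{..<- 1 / 4}"]) (use t in \<open>auto simp: smooth_step_left\<close>)
  then show ?thesis by (rule DERIV_imp_deriv)
next
  assume t: "1 / 4 < t"
  have "((\<lambda>_. 1) has_real_derivative 0) (at t)" by simp
  then have "(smooth_step has_real_derivative 0) (at t)"
    by (rule has_field_derivative_transform_within_open[where S = "{1 / 4<..}"]) (use t in \<open>auto simp: smooth_step_right\<close>)
  then show ?thesis by (rule DERIV_imp_deriv)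
qed

lemma deriv_smooth_step_bounded: "\<exists>M. \<forall>t. \<bar>deriv smooth_step t\<bar> \<le> M"
proof -
  have "continuous_on {-1..1} (deriv smooth_step)"
    using elementary_DERIV[OF elementary_deriv[OF smooth_step_elementary]]
    by (intro continuous_at_imp_continuous_on ballI) (rule DERIV_isCont)
  then have "compact (deriv smooth_step ` {-1..1})"
    by (intro compact_continuous_image) auto
  then obtain M where M: "\<And>t. t \<in> {-1..1} \<Longrightarrow> \<bar>deriv smooth_step t\<bar> \<le> M"
    using compact_imp_bounded bounded_iff by (metis imageI real_norm_def)
  have "\<bar>deriv smooth_step t\<bar> \<le> max M 0" for t
    using M[of t] deriv_smooth_step_0[of t] by (cases "t \<in> {-1..1}") (auto simp: abs_if split: if_splits)
  then show ?thesis by blast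
qed

text \<open>
  The integer translates of \<open>hat\<close> sum to one because the defining difference telescopes, and
  \<open>hat\<close> equals one on the middle half of the unit interval because of the overlap width \<open>1/4\<close>.
\<close>

definition hat :: "real \<Rightarrow> real" where
  "hat t = smooth_step t - smooth_step (t - 1)"

lemma hat_DERIV: "(hat has_real_derivative (deriv smooth_step t - deriv smooth_step (t - 1))) (at t)"
proof -
  have "((\<lambda>t. smooth_step (t - 1)) has_real_derivative deriv smooth_step (t - 1) * 1) (at t)"
    by (rule DERIV_chain2[OF elementary_DERIV[OF smooth_step_elementary]]) (auto intro!: derivative_eq_intros)
  then show ?thesis
    unfolding hat_def[abs_def] using elementary_DERIV[OF smooth_step_elementary, of t]
    by (auto intro!: derivative_eq_intros)
qed

lemma deriv_hat: "deriv hat t = deriv smooth_step t - deriv smooth_step (t - 1)"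
  using hat_DERIV by (rule DERIV_imp_deriv)

lemma hat_elementary: "elementary hat"
proof -
  have "elementary (\<lambda>t. smooth_step t + (- 1) * smooth_step (1 * t + (- 1)))"
    by (intro elementary.add elementary.affine elementary_cmult smooth_step_elementary)
  then show ?thesis by (simp add: hat_def[abs_def])
qed

lemma hat_translate_elementary: "elementary (\<lambda>t. hat (t - a))"
  using elementary.affine[OF hat_elementary, of 1 "- a"] by simp

lemma hat_translate_deriv: "deriv (\<lambda>t. hat (t - a)) t = deriv hat (t - a)"
proof -
  have "((\<lambda>t. hat (t - a)) has_real_derivative deriv hat (t - a) * 1) (at t)"
    by (rule DERIV_chain2[OF elementary_DERIV[OF hat_elementary]]) (auto intro!: derivative_eq_intros)
  then show ?thesis using DERIV_imp_deriv by fastforce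
qed

lemma hat_outside: "t \<le> - 1 / 4 \<or> 5 / 4 \<le> t \<Longrightarrow> hat t = 0"
  by (auto simp: hat_def smooth_step_left smooth_step_right)

lemma deriv_hat_outside: "t < - 1 / 4 \<or> 5 / 4 < t \<Longrightarrow> deriv hat t = 0"
  by (auto simp: deriv_hat deriv_smooth_step_0)

lemma hat_inside: "1 / 4 \<le> t \<Longrightarrow> t \<le> 3 / 4 \<Longrightarrow> hat t = 1"
  by (simp add: hat_def smooth_step_left smooth_step_right)

lemma sum_deriv_hat:
  assumes "0 \<le> t" "t < 1"
  shows "(\<Sum>k\<in>{-1, 0, 1::int}. deriv hat (t - of_int k)) = 0"
  using assms by (simp add: deriv_hat deriv_smooth_step_0)

lemma hat_bounded: "\<exists>M\<ge>1. \<forall>t. \<bar>hat t\<bar> \<le> M \<and> \<bar>deriv hat t\<bar> \<le> M"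
proof -
  obtain M where M: "\<And>t. \<bar>deriv smooth_step t\<bar> \<le> M" using deriv_smooth_step_bounded by blast
  have "\<bar>hat t\<bar> \<le> 2 + 2 * M \<and> \<bar>deriv hat t\<bar> \<le> 2 + 2 * M" for t
    using smooth_step_bounds[of t] smooth_step_bounds[of "t - 1"] M[of t] M[of "t - 1"]
    unfolding hat_def deriv_hat by linarith
  moreover have "0 \<le> M" using M[of 0] by linarith
  ultimately show ?thesis by (intro exI[of _ "2 + 2 * M"]) auto
qed

section \<open>Combinations of tensor products as test functions\<close>

definition tensor :: "('d::finite \<Rightarrow> real \<Rightarrow> real) \<Rightarrow> real ^ 'd \<Rightarrow> complex" where
  "tensor f \<xi> = of_real (\<Prod>j\<in>UNIV. f j (\<xi> $ j))"

lemma tensor_has_derivative: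
  assumes "\<And>j. elementary (f j)"
  shows "(tensor f has_derivative (\<lambda>v. \<Sum>j\<in>UNIV. of_real (v $ j) * tensor (f(j := deriv (f j))) \<xi>)) (at \<xi>)"
proof -
  have 1: "((\<lambda>\<xi>. f j (\<xi> $ j)) has_derivative (\<lambda>v. deriv (f j) (\<xi> $ j) * v $ j)) (at \<xi>)" for j
  proof -
    have "(f j has_derivative (*) (deriv (f j) (\<xi> $ j))) (at (\<xi> $ j))"
      using elementary_DERIV[OF assms] by (simp add: has_field_derivative_def)
    moreover have "((\<lambda>\<xi>. \<xi> $ j) has_derivative (\<lambda>v. v $ j)) (at \<xi>)"
      by (intro bounded_linear_imp_has_derivative bounded_linear_vec_nth)
    ultimately show ?thesis
      using has_derivative_compose by fastforce
  qed
  have "((\<lambda>\<xi>. \<Prod>j\<in>UNIV. f j (\<xi> $ j)) has_derivative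
      (\<lambda>v. \<Sum>i\<in>UNIV. deriv (f i) (\<xi> $ i) * v $ i * (\<Prod>j\<in>UNIV - {i}. f j (\<xi> $ j)))) (at \<xi>)"
    by (intro has_derivative_prod 1)
  then have 2: "(tensor f has_derivative
      (\<lambda>v. of_real (\<Sum>i\<in>UNIV. deriv (f i) (\<xi> $ i) * v $ i * (\<Prod>j\<in>UNIV - {i}. f j (\<xi> $ j))))) (at \<xi>)"
    unfolding tensor_def[abs_def] by (rule has_derivative_of_real)
  have "tensor (f(i := deriv (f i))) \<xi> = of_real (deriv (f i) (\<xi> $ i) * (\<Prod>j\<in>UNIV - {i}. f j (\<xi> $ j)))" for i
    unfolding tensor_def by (subst prod.remove[of _ i]) auto
  with 2 show ?thesis by (simp add: mult_ac)
qed

definition tensor_comb ::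
    "'i set \<Rightarrow> ('i \<Rightarrow> complex) \<Rightarrow> ('i \<Rightarrow> 'd::finite \<Rightarrow> real \<Rightarrow> real) \<Rightarrow> real ^ 'd \<Rightarrow> complex" where
  "tensor_comb X c f \<xi> = (\<Sum>x\<in>X. c x * tensor (f x) \<xi>)"

lemma tensor_comb_has_derivative:
  assumes "\<And>x j. elementary (f x j)"
  shows "(tensor_comb X c f has_derivative
    (\<lambda>v. \<Sum>x\<in>X. c x * (\<Sum>j\<in>UNIV. of_real (v $ j) * tensor ((f x)(j := deriv (f x j))) \<xi>))) (at \<xi>)"
  unfolding tensor_comb_def[abs_def]
  by (intro has_derivative_sum has_derivative_mult_right tensor_has_derivative assms)

lemma partial_derivative_tensor_comb:
  assumes "\<And>x j. elementary (f x j)"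
  shows "partial_derivative k (tensor_comb X c f) = tensor_comb X c (\<lambda>x. (f x)(k := deriv (f x k)))"
proof
  fix \<xi>
  have "(\<Sum>j\<in>UNIV. of_real (axis k 1 $ j) * tensor ((f x)(j := deriv (f x j))) \<xi>)
      = tensor ((f x)(k := deriv (f x k))) \<xi>" for x
  proof -
    have "(\<Sum>j\<in>UNIV. of_real (axis k 1 $ j) * tensor ((f x)(j := deriv (f x j))) \<xi>)
       = (\<Sum>j\<in>UNIV. if j = k then tensor ((f x)(j := deriv (f x j))) \<xi> else 0)"
      by (intro sum.cong) (auto simp: axis_def)
    then show ?thesis by simp
  qed
  then show "partial_derivative k (tensor_comb X c f) \<xi> = tensor_comb X c (\<lambda>x. (f x)(k := deriv (f x k))) \<xi>"
    unfolding partial_derivative_def frechet_derivative_at[OF tensor_comb_has_derivative[where f = f and X = X and c = c and \<xi> = \<xi>, OF assms], symmetric]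
    by (simp add: tensor_comb_def)
qed

lemma iterated_partial_derivative_tensor_comb:
  assumes "\<And>x j. elementary (f x j)"
  shows "\<exists>g. (\<forall>x j. elementary (g x j)) \<and> foldr partial_derivative js (tensor_comb X c f) = tensor_comb X c g"
proof (induction js)
  case (Cons k js)
  then obtain g where g: "\<And>x j. elementary (g x j)"
    "foldr partial_derivative js (tensor_comb X c f) = tensor_comb X c g" by blast
  show ?case
  proof (intro exI conjI allI)
    show "elementary (((g x)(k := deriv (g x k))) j)" for x j
      using g(1) by (auto intro: elementary_deriv)
    show "foldr partial_derivative (k # js) (tensor_comb X c f)
        = tensor_comb X c (\<lambda>x. (g x)(k := deriv (g x k)))"
      by (simp only: foldr_Cons o_apply g(2) partial_derivative_tensor_comb[OF g(1)])
  qed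
qed (use assms in auto)

lemma tensor_comb_continuous:
  assumes "\<And>x j. elementary (f x j)"
  shows "continuous_on UNIV (tensor_comb X c f)"
  by (intro continuous_at_imp_continuous_on ballI has_derivative_continuous[OF tensor_comb_has_derivative] assms)

lemma test_function_tensor_comb:
  assumes "\<And>x j. elementary (f x j)" and "bounded {\<xi>. tensor_comb X c f \<xi> \<noteq> 0}"
  shows "test_function (tensor_comb X c f)"
  unfolding test_function_def
proof (intro conjI allI)
  fix js
  obtain g where g: "\<And>x j. elementary (g x j)"
    "foldr partial_derivative js (tensor_comb X c f) = tensor_comb X c g"
    using iterated_partial_derivative_tensor_comb[of f] assms by blast
  show "foldr partial_derivative js (tensor_comb X c f) differentiable_on UNIV"
    unfolding g(2) differentiable_on_def differentiable_def
    using tensor_comb_has_derivative[where f = g and X = X and c = c, OF g(1)] by blast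
qed (use assms in simp)

lemma gradient_tensor_comb:
  assumes "\<And>x j. elementary (f x j)"
  shows "gradient (tensor_comb X c f) \<xi> = (\<chi> k. tensor_comb X c (\<lambda>x. (f x)(k := deriv (f x k))) \<xi>)"
  by (simp add: gradient_def partial_derivative_tensor_comb[OF assms])

lemma in_H1_tensor_comb:
  assumes "\<And>x j. elementary (f x j)" and "bounded {\<xi>. tensor_comb X c f \<xi> \<noteq> 0}"
  shows "in_H1 (tensor_comb X c f) (gradient (tensor_comb X c f))"
  unfolding in_H1_def
proof (intro conjI exI[of _ "\<lambda>_. tensor_comb X c f"] allI)
  show "tensor_comb X c f \<in> borel_measurable lebesgue"
    by (intro measurable_completion) (simp add: borel_measurable_continuous_onI tensor_comb_continuous assms)
  have "continuous_on UNIV (gradient (tensor_comb X c f))"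
    unfolding gradient_tensor_comb[OF assms(1), abs_def]
    by (intro continuous_on_vec_lambda tensor_comb_continuous) (use assms in \<open>auto intro: elementary_deriv\<close>)
  then show "gradient (tensor_comb X c f) \<in> borel_measurable lebesgue"
    by (intro measurable_completion) (simp add: borel_measurable_continuous_onI)
qed (use test_function_tensor_comb[OF assms] in auto)

section \<open>The Hardy inequality on the lattice\<close>

definition lattice_floor :: "real ^ 'd \<Rightarrow> int ^ 'd" where
  "lattice_floor \<xi> = (\<chi> j. \<lfloor>\<xi> $ j\<rfloor>)"

definition interpolant :: "(int ^ 'd::finite \<Rightarrow> complex) \<Rightarrow> real ^ 'd \<Rightarrow> complex" where
  "interpolant u = tensor_comb {x. u x \<noteq> 0} u (\<lambda>x j t. hat (t - of_int (x $ j)))"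

lemma interpolant_eq:
  "interpolant u \<xi> = (\<Sum>x | u x \<noteq> 0. u x * of_real (\<Prod>j\<in>UNIV. hat (\<xi> $ j - of_int (x $ j))))"
  by (simp add: interpolant_def tensor_comb_def tensor_def)

lemma interpolant_in_H1:
  fixes u :: "int ^ 'd::finite \<Rightarrow> complex"
  assumes fin: "finite {x. u x \<noteq> 0}"
  shows "in_H1 (interpolant u) (gradient (interpolant u))"
  unfolding interpolant_def
proof (rule in_H1_tensor_comb)
  show "elementary (\<lambda>t. hat (t - of_int (x $ j)))" for x :: "int ^ 'd" and j
    by (rule hat_translate_elementary)
  let ?U = "tensor_comb {x. u x \<noteq> 0} u (\<lambda>x j t. hat (t - of_int (x $ j)))"
  define v where "v x = ((\<chi> j. of_int (x $ j)) :: real ^ 'd)" for x :: "int ^ 'd"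
  have "{\<xi>. ?U \<xi> \<noteq> 0} \<subseteq> (\<Union>x\<in>{x. u x \<noteq> 0}. cbox (v x - (\<chi> j. 1 / 4)) (v x + (\<chi> j. 5 / 4)))"
  proof
    fix \<xi> assume "\<xi> \<in> {\<xi>. ?U \<xi> \<noteq> 0}"
    then have "(\<Sum>x | u x \<noteq> 0. u x * of_real (\<Prod>j\<in>UNIV. hat (\<xi> $ j - of_int (x $ j)))) \<noteq> 0"
      unfolding interpolant_def[symmetric] interpolant_eq by simp
    then obtain x where x: "u x \<noteq> 0" "(\<Prod>j\<in>UNIV. hat (\<xi> $ j - of_int (x $ j))) \<noteq> 0"
      by (rule sum.not_neutral_contains_not_neutral) auto
    then have "hat (\<xi> $ j - of_int (x $ j)) \<noteq> 0" for j by auto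
    then have "\<not> (\<xi> $ j - of_int (x $ j) \<le> - 1 / 4 \<or> 5 / 4 \<le> \<xi> $ j - of_int (x $ j))" for j
      using hat_outside by blast
    then have inside: "\<not> \<xi> $ j - of_int (x $ j) \<le> - 1 / 4" "\<not> 5 / 4 \<le> \<xi> $ j - of_int (x $ j)" for j
      by blast+
    have "of_int (x $ j) - 1 / 4 \<le> \<xi> $ j \<and> \<xi> $ j \<le> of_int (x $ j) + 5 / 4" for j
      using inside[of j] by linarith
    then have "\<xi> \<in> cbox (v x - (\<chi> j. 1 / 4)) (v x + (\<chi> j. 5 / 4))"
      by (simp add: mem_box_cart v_def)
    with x show "\<xi> \<in> (\<Union>x\<in>{x. u x \<noteq> 0}. cbox (v x - (\<chi> j. 1 / 4)) (v x + (\<chi> j. 5 / 4)))" by blast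
  qed
  moreover have "bounded (\<Union>x\<in>{x. u x \<noteq> 0}. cbox (v x - (\<chi> j. 1 / 4)) (v x + (\<chi> j. 5 / 4)))"
    using fin by (intro bounded_UN) auto
  ultimately show "bounded {\<xi>. ?U \<xi> \<noteq> 0}" by (rule bounded_subset[rotated])
qed

lemma gradient_interpolant:
  "gradient (interpolant u) \<xi> $ k = (\<Sum>x | u x \<noteq> 0. u x *
     of_real (\<Prod>j\<in>UNIV. (if j = k then deriv hat else hat) (\<xi> $ j - of_int (x $ j))))"
proof -
  let ?f = "\<lambda>x j t. hat (t - of_int (x $ j))"
  have "gradient (interpolant u) \<xi> $ k
      = (\<Sum>x | u x \<noteq> 0. u x * of_real (\<Prod>j\<in>UNIV. ((?f x)(k := deriv (?f x k))) j (\<xi> $ j)))"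
    unfolding interpolant_def
    by (subst gradient_tensor_comb[OF hat_translate_elementary])
       (simp only: vec_lambda_beta tensor_comb_def tensor_def)
  moreover have "((?f x)(k := deriv (?f x k))) j (\<xi> $ j)
      = (if j = k then deriv hat else hat) (\<xi> $ j - of_int (x $ j))" for x j
    by (simp add: hat_translate_deriv)
  ultimately show ?thesis by (simp only:)
qed

text \<open>
  At a point of the cell of \<open>y\<close> only the neighbours \<open>y + e\<close> of \<open>y\<close> contribute, and constants have
  gradient zero since the translates of \<open>hat\<close> form a partition of unity. So only differences of
  \<open>u\<close> remain.
\<close>

lemma norm_gradient_interpolant_le:
  fixes u :: "int ^ 'd::finite \<Rightarrow> complex"
  assumes fin: "finite {x. u x \<noteq> 0}" and M: "1 \<le> M" "\<And>t. \<bar>hat t\<bar> \<le> M" "\<And>t. \<bar>deriv hat t\<bar> \<le> M"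
  shows "(norm (gradient (interpolant u) \<xi>))\<^sup>2
    \<le> real CARD('d) * real (card (cube :: (int ^ 'd) set)) * M ^ (2 * CARD('d)) *
      (\<Sum>e\<in>cube. (cmod (u (lattice_floor \<xi> + e) - u (lattice_floor \<xi>)))\<^sup>2)"
proof -
  define y where "y = lattice_floor \<xi>"
  define \<tau> where "\<tau> j = \<xi> $ j - of_int (y $ j)" for j
  have \<tau>: "0 \<le> \<tau> j" "\<tau> j < 1" for j
    unfolding \<tau>_def y_def lattice_floor_def by (auto simp: diff_less_eq) linarith
  define q where "q = (\<Sum>e\<in>cube. (cmod (u (y + e) - u y))\<^sup>2)"
  have comp: "(cmod (gradient (interpolant u) \<xi> $ k))\<^sup>2 \<le> real (card (cube :: (int ^ 'd) set)) * M ^ (2 * CARD('d)) * q" for k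
  proof -
    define F where "F j = (if j = k then deriv hat else hat)" for j
    define T where "T x = (\<Prod>j\<in>UNIV. F j (\<xi> $ j - of_int (x $ j)))" for x :: "int ^ 'd"
    have T_e: "T (y + e) = (\<Prod>j\<in>UNIV. F j (\<tau> j - of_int (e $ j)))" for e
      by (simp add: T_def \<tau>_def algebra_simps)
    \<comment> \<open>the support of the bump function exceeds the unit cell by \<open>1/4\<close> only\<close>
    have T_out: "T x = 0" if "x - y \<notin> cube" for x
    proof -
      have "\<exists>j. x $ j - y $ j \<notin> {-1, 0, 1}" using that by (simp add: cube_def)
      then obtain j where "x $ j - y $ j \<notin> {-1, 0, 1}" by blast
      then have "x $ j - y $ j \<le> -2 \<or> 2 \<le> x $ j - y $ j" by auto
      then have "real_of_int (x $ j - y $ j) \<le> -2 \<or> 2 \<le> real_of_int (x $ j - y $ j)"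
        by linarith
      then have "2 \<le> \<xi> $ j - of_int (x $ j) \<or> \<xi> $ j - of_int (x $ j) < - 1"
        using \<tau>[of j] unfolding \<tau>_def by auto
      then have "F j (\<xi> $ j - of_int (x $ j)) = 0"
        by (auto simp: F_def hat_outside deriv_hat_outside)
      then show ?thesis unfolding T_def by auto
    qed
    have "gradient (interpolant u) \<xi> $ k = (\<Sum>x | u x \<noteq> 0. u x * of_real (T x))"
      by (simp add: gradient_interpolant T_def F_def)
    also have "\<dots> = (\<Sum>x\<in>(\<lambda>e. y + e) ` cube. u x * of_real (T x))"
    proof (rule sum.mono_neutral_cong[OF _ fin])
      show "u i * of_real (T i) = 0" if "i \<in> {x. u x \<noteq> 0} - (\<lambda>e. y + e) ` cube" for i
      proof -
        have "i - y \<notin> cube"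
        proof
          assume "i - y \<in> cube"
          then have "i \<in> (\<lambda>e. y + e) ` cube" by (intro image_eqI[of _ _ "i - y"]) auto
          with that show False by blast
        qed
        then show ?thesis by (simp add: T_out)
      qed
    qed auto
    also have "\<dots> = (\<Sum>e\<in>cube. u (y + e) * of_real (T (y + e)))"
      by (subst sum.reindex) (auto simp: inj_on_def)
    also have "\<dots> = (\<Sum>e\<in>cube. (u (y + e) - u y) * of_real (T (y + e))) + u y * of_real (\<Sum>e\<in>cube. T (y + e))"
      by (simp add: algebra_simps sum_distrib_left sum_subtractf)
    also have "(\<Sum>e\<in>cube. T (y + e)) = (\<Prod>j\<in>UNIV. \<Sum>i\<in>{-1, 0, 1}. F j (\<tau> j - of_int i))"
      unfolding T_e by (rule sum_cube_prod)
    \<comment> \<open>the factor of the coordinate \<open>k\<close> contains derivatives and sums to zero\<close>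
    also have "\<dots> = 0"
      using sum_deriv_hat[OF \<tau>, of k] by (intro prod_zero bexI[of _ k]) (auto simp: F_def)
    finally have eq: "gradient (interpolant u) \<xi> $ k = (\<Sum>e\<in>cube. (u (y + e) - u y) * of_real (T (y + e)))"
      by simp
    have T_le: "\<bar>T x\<bar> \<le> M ^ CARD('d)" for x
    proof -
      have "\<bar>T x\<bar> \<le> (\<Prod>j\<in>(UNIV :: 'd set). M)"
        unfolding T_def abs_prod by (intro prod_mono) (auto simp: F_def M)
      then show ?thesis by simp
    qed
    have "cmod (gradient (interpolant u) \<xi> $ k) \<le> (\<Sum>e\<in>cube. cmod (u (y + e) - u y) * M ^ CARD('d))"
      unfolding eq by (intro sum_norm_le) (auto simp: norm_mult T_le mult_left_mono)
    then have "(cmod (gradient (interpolant u) \<xi> $ k))\<^sup>2 \<le> (\<Sum>e\<in>cube. cmod (u (y + e) - u y) * M ^ CARD('d))\<^sup>2"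
      by (intro power_mono) auto
    also have "\<dots> \<le> (\<Sum>e\<in>cube. (cmod (u (y + e) - u y) * M ^ CARD('d))\<^sup>2) * card (cube :: (int ^ 'd) set)"
      by (rule sum_squared_le_sum_of_squares)
    also have "\<dots> = real (card (cube :: (int ^ 'd) set)) * M ^ (2 * CARD('d)) * q"
      by (simp add: q_def power_mult_distrib sum_distrib_left sum_distrib_right mult_ac flip: power_mult)
    finally show ?thesis .
  qed
  have "(norm (gradient (interpolant u) \<xi>))\<^sup>2 = (\<Sum>k\<in>UNIV. (cmod (gradient (interpolant u) \<xi> $ k))\<^sup>2)"
    by (simp add: norm_vec_def L2_set_def sum_nonneg)
  also have "\<dots> \<le> (\<Sum>k\<in>(UNIV :: 'd set). real (card (cube :: (int ^ 'd) set)) * M ^ (2 * CARD('d)) * q)"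
    by (intro sum_mono comp)
  finally show ?thesis by (simp add: q_def y_def mult_ac)
qed

text \<open>
  On the middle half of the cell of \<open>y\<close> the bump function of \<open>y\<close> equals one and the supports of its
  other translates are not reached.
\<close>

lemma interpolant_inner_cube:
  fixes u :: "int ^ 'd::finite \<Rightarrow> complex"
  assumes fin: "finite {x. u x \<noteq> 0}"
    and \<xi>: "\<And>j. of_int (y $ j) + 1 / 4 \<le> \<xi> $ j" "\<And>j. \<xi> $ j \<le> of_int (y $ j) + 3 / 4"
  shows "interpolant u \<xi> = u y"
proof -
  define T where "T x = (\<Prod>j\<in>UNIV. hat (\<xi> $ j - of_int (x $ j)))" for x :: "int ^ 'd"
  have "T y = 1"
    unfolding T_def
  proof (intro prod.neutral ballI hat_inside)
    fix j
    show "1 / 4 \<le> \<xi> $ j - of_int (y $ j)" using \<xi>(1)[of j] by linarith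
    show "\<xi> $ j - of_int (y $ j) \<le> 3 / 4" using \<xi>(2)[of j] by linarith
  qed
  have "T x = 0" if "x \<noteq> y" for x
  proof -
    obtain j where "x $ j \<noteq> y $ j" using \<open>x \<noteq> y\<close> by (auto simp: vec_eq_iff)
    then have "x $ j \<le> y $ j - 1 \<or> y $ j + 1 \<le> x $ j" by linarith
    then have "real_of_int (x $ j) \<le> real_of_int (y $ j) - 1 \<or> real_of_int (y $ j) + 1 \<le> real_of_int (x $ j)"
      by linarith
    then have "\<xi> $ j - of_int (x $ j) \<le> - 1 / 4 \<or> 5 / 4 \<le> \<xi> $ j - of_int (x $ j)"
      using \<xi>(1)[of j] \<xi>(2)[of j] by auto
    then have "hat (\<xi> $ j - of_int (x $ j)) = 0" by (rule hat_outside)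
    then show ?thesis unfolding T_def by auto
  qed
  then have "(\<Sum>x | u x \<noteq> 0. u x * of_real (T x)) = (\<Sum>x | u x \<noteq> 0. if x = y then u y * of_real (T y) else 0)"
    by (intro sum.cong) auto
  also have "\<dots> = u y" using fin \<open>T y = 1\<close> by (simp add: sum.delta)
  finally show ?thesis by (simp add: interpolant_eq T_def)
qed

lemma emeasure_translated_cube:
  fixes y :: "int ^ 'd::finite"
  assumes "a \<le> b"
  shows "emeasure lebesgue (cbox (\<chi> j. of_int (y $ j) + a) (\<chi> j. of_int (y $ j) + b) :: (real ^ 'd) set)
    = ennreal ((b - a) ^ CARD('d))"
proof -
  have ne: "cbox (\<chi> j. of_int (y $ j) + a) (\<chi> j. of_int (y $ j) + b) \<noteq> ({} :: (real ^ 'd) set)"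
    using assms by (auto simp: interval_ne_empty_cart)
  have "emeasure lebesgue (cbox (\<chi> j. of_int (y $ j) + a) (\<chi> j. of_int (y $ j) + b) :: (real ^ 'd) set)
    = ennreal (measure lborel (cbox (\<chi> j. of_int (y $ j) + a) (\<chi> j. of_int (y $ j) + b) :: (real ^ 'd) set))"
    using emeasure_lborel_cbox_finite by (subst emeasure_eq_ennreal_measure[symmetric]) (auto simp: less_top)
  then show ?thesis by (simp add: content_cbox_cart[OF ne])
qed

text \<open>
  The continuous inequality is applied to the interpolant. Its left side is bounded from below by the
  middle halves of the cells, of volume \<open>2\<^sup>-\<^sup>d\<close>, where the interpolant equals \<open>u\<close> and the weight is the
  constant \<open>W y\<close>; its right side is bounded from above by differences of neighbouring values.
\<close>

lemma hardy_inequality_finite_support: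
  "\<exists>C\<ge>0. \<forall>W H (u :: int ^ 'd::finite \<Rightarrow> complex). (\<forall>x. 0 \<le> W x) \<longrightarrow> 0 \<le> H \<longrightarrow>
     hardy_inequality (cell_extension W) H \<longrightarrow> finite {x. u x \<noteq> 0} \<longrightarrow>
     (\<Sum>x | u x \<noteq> 0. W x * (cmod (u x))\<^sup>2) \<le> C * H * dirichlet u"
proof -
  obtain M where M: "1 \<le> M" "\<And>t. \<bar>hat t\<bar> \<le> M" "\<And>t. \<bar>deriv hat t\<bar> \<le> M"
    using hat_bounded by blast
  define K where "K = real CARD('d) * real (card (cube :: (int ^ 'd) set)) * M ^ (2 * CARD('d))"
  have K: "0 \<le> K" using M by (simp add: K_def)
  have main: "(\<Sum>x | u x \<noteq> 0. W x * (cmod (u x))\<^sup>2) \<le> 2 ^ CARD('d) * K * 6 ^ CARD('d) * H * dirichlet u"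
    if W: "\<And>x. 0 \<le> W x" and H: "0 \<le> H" "hardy_inequality (cell_extension W) H"
      and fin: "finite {x. u x \<noteq> 0}"
    for W H and u :: "int ^ 'd \<Rightarrow> complex"
  proof -
    define U where "U = interpolant u"
    define X where "X = {x. u x \<noteq> 0}"
    define Q where "Q y = (cbox (\<chi> j. of_int (y $ j) + 1 / 4) (\<chi> j. of_int (y $ j) + 3 / 4) :: (real ^ 'd) set)" for y :: "int ^ 'd"
    define Q1 where "Q1 y = (cbox (\<chi> j. of_int (y $ j) + 0) (\<chi> j. of_int (y $ j) + 1) :: (real ^ 'd) set)" for y :: "int ^ 'd"
    define g where "g y = (\<Sum>e\<in>cube. (cmod (u (y + e) - u y))\<^sup>2)" for y
    define Y where "Y = (\<Union>e\<in>cube. (\<lambda>x. x - e) ` X)"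
    have u: "u \<in> l2" using fin by (rule l2_finite_support)
    have finX: "finite X" using fin by (simp add: X_def)
    have finY: "finite Y" using finX by (simp add: Y_def)
    have g0: "0 \<le> g y" for y by (simp add: g_def sum_nonneg)
    have gY: "g y = 0" if "y \<notin> Y" for y
    proof -
      have out: "u (y + e) = 0" if "e \<in> cube" for e
      proof (rule ccontr)
        assume "u (y + e) \<noteq> 0"
        then have "y \<in> (\<lambda>x. x - e) ` X" by (intro image_eqI[of _ _ "y + e"]) (auto simp: X_def)
        with that \<open>y \<notin> Y\<close> show False by (auto simp: Y_def)
      qed
      have "0 \<in> (cube :: (int ^ 'd) set)" by (simp add: cube_def)
      then have "u y = 0" using out[of 0] by simp
      with out show ?thesis unfolding g_def by (intro sum.neutral) simp
    qed
    have cellQ: "lattice_floor \<xi> = y" if "\<xi> \<in> Q y" for \<xi> y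
    proof -
      have "\<lfloor>\<xi> $ j\<rfloor> = y $ j" for j
      proof -
        have "of_int (y $ j) + 1 / 4 \<le> \<xi> $ j" "\<xi> $ j \<le> of_int (y $ j) + 3 / 4"
          using that by (auto simp: Q_def mem_box_cart)
        then show ?thesis by (intro floor_unique) linarith+
      qed
      then show ?thesis by (simp add: lattice_floor_def vec_eq_iff)
    qed
    have inQ1: "\<xi> \<in> Q1 (lattice_floor \<xi>)" for \<xi>
      by (auto simp: Q1_def mem_box_cart lattice_floor_def)
    have meas: "(\<lambda>\<xi>. c * indicator (cbox a b) \<xi>) \<in> borel_measurable lebesgue"
      for c :: ennreal and a b :: "real ^ 'd"
      by (intro measurable_completion) measurable
    have "(\<Sum>y\<in>X. ennreal (W y * (cmod (u y))\<^sup>2) * emeasure lebesgue (Q y))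
        = (\<integral>\<^sup>+\<xi>. (\<Sum>y\<in>X. ennreal (W y * (cmod (u y))\<^sup>2) * indicator (Q y) \<xi>) \<partial>lebesgue)"
      by (subst nn_integral_sum) (auto simp: Q_def nn_integral_cmult_indicator intro: meas)
    also have "\<dots> \<le> (\<integral>\<^sup>+\<xi>. ennreal (cell_extension W \<xi> * (cmod (U \<xi>))\<^sup>2) \<partial>lebesgue)"
    proof (rule nn_integral_mono)
      fix \<xi> :: "real ^ 'd"
      show "(\<Sum>y\<in>X. ennreal (W y * (cmod (u y))\<^sup>2) * indicator (Q y) \<xi>)
         \<le> ennreal (cell_extension W \<xi> * (cmod (U \<xi>))\<^sup>2)"
      proof (cases "\<exists>y\<in>X. \<xi> \<in> Q y")
        case True
        then obtain y where y: "y \<in> X" "\<xi> \<in> Q y" by auto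
        have "(\<Sum>y\<in>X. ennreal (W y * (cmod (u y))\<^sup>2) * indicator (Q y) \<xi>)
            = (\<Sum>z\<in>X. if z = y then ennreal (W y * (cmod (u y))\<^sup>2) else 0)"
          using cellQ y by (intro sum.cong) (auto simp: indicator_def)
        also have "\<dots> = ennreal (W y * (cmod (u y))\<^sup>2)" using finX y by simp
        also have "u y = U \<xi>"
          unfolding U_def using y(2) fin
          by (intro interpolant_inner_cube[symmetric]) (auto simp: Q_def mem_box_cart)
        also have "W y = cell_extension W \<xi>"
          using cellQ[OF y(2)] by (simp add: cell_extension_def lattice_floor_def)
        finally show ?thesis by simp
      next
        case False
        then have "(\<Sum>y\<in>X. ennreal (W y * (cmod (u y))\<^sup>2) * indicator (Q y) \<xi>) = 0"
          by (intro sum.neutral) auto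
        then show ?thesis by simp
      qed
    qed
    also have "\<dots> \<le> ennreal H * (\<integral>\<^sup>+\<xi>. ennreal ((norm (gradient U \<xi>))\<^sup>2) \<partial>lebesgue)"
      using H(2) interpolant_in_H1[OF fin] unfolding hardy_inequality_def U_def by blast
    also have "\<dots> \<le> ennreal H * (\<integral>\<^sup>+\<xi>. (\<Sum>y\<in>Y. ennreal (K * g y) * indicator (Q1 y) \<xi>) \<partial>lebesgue)"
    proof (intro mult_left_mono nn_integral_mono)
      fix \<xi> :: "real ^ 'd"
      have le: "(norm (gradient U \<xi>))\<^sup>2 \<le> K * g (lattice_floor \<xi>)"
        unfolding U_def K_def g_def by (rule norm_gradient_interpolant_le[OF fin M])
      show "ennreal ((norm (gradient U \<xi>))\<^sup>2) \<le> (\<Sum>y\<in>Y. ennreal (K * g y) * indicator (Q1 y) \<xi>)"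
      proof (cases "lattice_floor \<xi> \<in> Y")
        case True
        have "ennreal ((norm (gradient U \<xi>))\<^sup>2) \<le> ennreal (K * g (lattice_floor \<xi>)) * indicator (Q1 (lattice_floor \<xi>)) \<xi>"
          using le inQ1[of \<xi>] by (simp add: ennreal_leI)
        also have "\<dots> \<le> (\<Sum>y\<in>Y. ennreal (K * g y) * indicator (Q1 y) \<xi>)"
          using True finY by (intro member_le_sum) auto
        finally show ?thesis .
      next
        case False
        then have "(norm (gradient U \<xi>))\<^sup>2 \<le> 0" using le by (simp add: gY)
        then show ?thesis by simp
      qed
    qed simp
    also have "(\<integral>\<^sup>+\<xi>. (\<Sum>y\<in>Y. ennreal (K * g y) * indicator (Q1 y) \<xi>) \<partial>lebesgue)
        = (\<Sum>y\<in>Y. ennreal (K * g y) * emeasure lebesgue (Q1 y))"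
      by (subst nn_integral_sum) (auto simp: Q1_def nn_integral_cmult_indicator intro: meas)
    also have "\<dots> = ennreal (\<Sum>y\<in>Y. K * g y)"
    proof -
      have "emeasure lebesgue (Q1 y) = 1" for y
        using emeasure_translated_cube[of 0 1 y] by (simp add: Q1_def)
      then show ?thesis using K g0 by (simp add: sum_ennreal)
    qed
    also have "(\<Sum>y\<in>X. ennreal (W y * (cmod (u y))\<^sup>2) * emeasure lebesgue (Q y))
        = ennreal (\<Sum>y\<in>X. W y * (cmod (u y))\<^sup>2 * (1 / 2) ^ CARD('d))"
    proof -
      have "ennreal (W y * (cmod (u y))\<^sup>2) * emeasure lebesgue (Q y) = ennreal (W y * (cmod (u y))\<^sup>2 * (1 / 2) ^ CARD('d))" for y
        using W emeasure_translated_cube[of "1 / 4" "3 / 4" y] by (simp add: Q_def ennreal_mult')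
      then show ?thesis using W by (simp add: sum_ennreal)
    qed
    finally have "ennreal (\<Sum>y\<in>X. W y * (cmod (u y))\<^sup>2 * (1 / 2) ^ CARD('d)) \<le> ennreal (H * (\<Sum>y\<in>Y. K * g y))"
      using H K g0 by (simp add: ennreal_mult' sum_nonneg)
    then have "(\<Sum>y\<in>X. W y * (cmod (u y))\<^sup>2 * (1 / 2) ^ CARD('d)) \<le> H * (\<Sum>y\<in>Y. K * g y)"
      using H K g0 by (subst (asm) ennreal_le_iff) (auto intro!: mult_nonneg_nonneg sum_nonneg)
    then have "(\<Sum>y\<in>X. W y * (cmod (u y))\<^sup>2) * (1 / 2) ^ CARD('d) \<le> H * K * (\<Sum>y\<in>Y. g y)"
      by (simp add: sum_distrib_left sum_distrib_right mult_ac)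
    also have "(\<Sum>y\<in>Y. g y) \<le> 6 ^ CARD('d) * dirichlet u"
    proof -
      have "(\<Sum>y\<in>Y. g y) = (\<Sum>e\<in>cube. \<Sum>y\<in>Y. (cmod ((shift e u - u) y))\<^sup>2)"
        unfolding g_def by (subst sum.swap) (simp add: shift_def)
      also have "\<dots> \<le> (\<Sum>e\<in>cube. diff_energy e u)"
      proof (rule sum_mono)
        fix e :: "int ^ 'd"
        have l: "shift e u - u \<in> l2" using u by (intro l2_diff) auto
        show "(\<Sum>y\<in>Y. (cmod ((shift e u - u) y))\<^sup>2) \<le> diff_energy e u"
          unfolding diff_energy_def nsq_eq[OF l] using finY l2_summable[OF l] by (intro finite_sum_le_infsum) auto
      qed
      also have "\<dots> \<le> 6 ^ CARD('d) * dirichlet u" by (rule sum_diff_energy_cube_le[OF u])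
      finally show ?thesis .
    qed
    finally have "(\<Sum>y\<in>X. W y * (cmod (u y))\<^sup>2) * (1 / 2) ^ CARD('d) \<le> H * K * (6 ^ CARD('d) * dirichlet u)"
      using H K by (simp add: mult_left_mono)
    then show ?thesis by (simp add: X_def field_simps)
  qed
  show ?thesis
    using K by (intro exI[of _ "2 ^ CARD('d) * K * 6 ^ CARD('d)"]) (use main in auto)
qed

lemma dirichlet_nonneg: "u \<in> l2 \<Longrightarrow> 0 \<le> dirichlet u"
  by (simp add: dirichlet_def sum_nonneg diff_energy_nonneg)

lemma dirichlet_add_le:
  "u \<in> l2 \<Longrightarrow> v \<in> l2 \<Longrightarrow> dirichlet (u + v) \<le> 2 * dirichlet u + 2 * dirichlet v"
  unfolding dirichlet_def sum_distrib_left sum.distrib[symmetric]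
  by (intro sum_mono diff_energy_add_fun_le)

lemma dirichlet_le_nsq:
  fixes u :: "int ^ 'd::finite \<Rightarrow> complex"
  assumes "u \<in> l2" 
  shows "dirichlet u \<le> 4 * real CARD('d) * nsq u"
  using sum_mono[of UNIV "\<lambda>j. diff_energy (axis j 1) u" "\<lambda>_. 4 * nsq u"] diff_energy_le_nsq[OF assms]
  by (simp add: dirichlet_def)

lemma l2_truncation:
  assumes u: "u \<in> l2" and "0 < \<epsilon>" and F: "finite F"
  shows "\<exists>v. finite {x. v x \<noteq> 0} \<and> (\<forall>x\<in>F. v x = u x) \<and> nsq (v - u) \<le> \<epsilon>"
proof -
  let ?f = "\<lambda>x. (cmod (u x))\<^sup>2"
  obtain G where G: "finite G" "dist (sum ?f G) (infsum ?f UNIV) \<le> \<epsilon>"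
    using infsum_finite_approximation[OF l2_summable[OF u] \<open>0 < \<epsilon>\<close>] by auto
  define L where "L = F \<union> G"
  have L: "finite L" using F G by (simp add: L_def)
  define v where "v x = (if x \<in> L then u x else 0)" for x
  have v: "finite {x. v x \<noteq> 0}" by (rule finite_subset[OF _ L]) (auto simp: v_def)
  have vl: "v - u \<in> l2" by (rule l2_diff[OF l2_finite_support[OF v] u])
  have "nsq (v - u) = (\<Sum>\<^sub>\<infinity>x\<in>UNIV - L. ?f x)"
    unfolding nsq_eq[OF vl] by (rule infsum_cong_neutral) (auto simp: v_def norm_minus_commute)
  also have "\<dots> = infsum ?f UNIV - infsum ?f L"
    using L by (intro infsum_Diff l2_summable[OF u]) auto
  also have "\<dots> \<le> infsum ?f UNIV - sum ?f G"
    using L by (simp add: L_def F G sum_mono2)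
  also have "\<dots> \<le> \<epsilon>" using G by (simp add: dist_real_def)
  finally show ?thesis using v by (intro exI[of _ v]) (auto simp: v_def L_def)
qed

text \<open>
  For a general square summable \<open>u\<close> a truncation \<open>v\<close> is used that agrees with \<open>u\<close> on \<open>F\<close>. The Dirichlet
  form of \<open>v\<close> is estimated by those of \<open>u\<close> and \<open>v - u\<close>, at the price of a factor \<open>2\<close>.
\<close>

lemma hardy_inequality_lattice:
  "\<exists>C\<ge>0. \<forall>W H (u :: int ^ 'd::finite \<Rightarrow> complex) F. (\<forall>x. 0 \<le> W x) \<longrightarrow> 0 \<le> H \<longrightarrow>
     hardy_inequality (cell_extension W) H \<longrightarrow> u \<in> l2 \<longrightarrow> finite F \<longrightarrow>
     (\<Sum>x\<in>F. W x * (cmod (u x))\<^sup>2) \<le> C * H * dirichlet u"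
proof -
  obtain C where C: "0 \<le> C" "\<And>W H (u :: int ^ 'd \<Rightarrow> complex). (\<And>x. 0 \<le> W x) \<Longrightarrow> 0 \<le> H \<Longrightarrow>
     hardy_inequality (cell_extension W) H \<Longrightarrow> finite {x. u x \<noteq> 0} \<Longrightarrow>
     (\<Sum>x | u x \<noteq> 0. W x * (cmod (u x))\<^sup>2) \<le> C * H * dirichlet u"
    using hardy_inequality_finite_support[where 'd = 'd] by blast
  have "(\<Sum>x\<in>F. W x * (cmod (u x))\<^sup>2) \<le> 2 * C * H * dirichlet u"
    if W: "\<And>x. 0 \<le> W x" and H: "0 \<le> H" "hardy_inequality (cell_extension W) H"
      and u: "u \<in> l2" and F: "finite F" for W H F and u :: "int ^ 'd \<Rightarrow> complex"
  proof (rule field_le_epsilon)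
    fix \<epsilon> :: real assume \<epsilon>: "0 < \<epsilon>"
    \<comment> \<open>the denominator makes the truncation error at most \<open>\<epsilon>\<close>, and is positive also if \<open>C\<close> or \<open>H\<close> vanishes\<close>
    define \<delta> where "\<delta> = \<epsilon> / (8 * real CARD('d) * C * H + 1)"
    have den: "0 < 8 * real CARD('d) * C * H + 1" using C H by (simp add: add_nonneg_pos)
    have \<delta>: "0 < \<delta>" using \<epsilon> den by (simp add: \<delta>_def)
    obtain v where v: "finite {x. v x \<noteq> 0}" "\<And>x. x \<in> F \<Longrightarrow> v x = u x" "nsq (v - u) \<le> \<delta>"
      using l2_truncation[OF u \<delta> F] by blast
    have vl: "v \<in> l2" using v by (intro l2_finite_support)
    have "dirichlet v = dirichlet (u + (v - u))" by simp
    also have "\<dots> \<le> 2 * dirichlet u + 2 * dirichlet (v - u)"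
      using u vl by (intro dirichlet_add_le l2_diff)
    also have "dirichlet (v - u) \<le> 4 * real CARD('d) * nsq (v - u)"
      using u vl by (intro dirichlet_le_nsq l2_diff)
    also have "\<dots> \<le> 4 * real CARD('d) * \<delta>" using v by (intro mult_left_mono) auto
    finally have D: "dirichlet v \<le> 2 * dirichlet u + 8 * real CARD('d) * \<delta>" by simp
    have "(\<Sum>x\<in>F. W x * (cmod (u x))\<^sup>2) = (\<Sum>x\<in>F. W x * (cmod (v x))\<^sup>2)"
      using v by (intro sum.cong) auto
    also have "\<dots> = (\<Sum>x\<in>F \<inter> {x. v x \<noteq> 0}. W x * (cmod (v x))\<^sup>2)"
      using F by (intro sum.mono_neutral_right) auto
    also have "\<dots> \<le> (\<Sum>x | v x \<noteq> 0. W x * (cmod (v x))\<^sup>2)"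
      using v W by (intro sum_mono2) auto
    also have "\<dots> \<le> C * H * dirichlet v"
      by (rule C(2)[OF W H v(1)])
    also have "\<dots> \<le> C * H * (2 * dirichlet u + 8 * real CARD('d) * \<delta>)"
      using C H D by (intro mult_left_mono) auto
    also have "\<dots> = 2 * C * H * dirichlet u + (8 * real CARD('d) * C * H) * \<delta>"
      by (simp add: algebra_simps)
    also have "(8 * real CARD('d) * C * H) * \<delta> \<le> \<epsilon>"
    proof -
      have "(8 * real CARD('d) * C * H) * \<delta> \<le> (8 * real CARD('d) * C * H + 1) * \<delta>"
        using \<delta> by (intro mult_right_mono) auto
      also have "\<dots> = \<epsilon>" using den by (simp add: \<delta>_def)
      finally show ?thesis .
    qed
    finally show "(\<Sum>x\<in>F. W x * (cmod (u x))\<^sup>2) \<le> 2 * C * H * dirichlet u + \<epsilon>" by simp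
  qed
  then show ?thesis using C by (intro exI[of _ "2 * C"]) auto
qed

text \<open>
  The best constant \<open>1\<close> is an infimum of admissible constants, so some admissible constant lies below \<open>2\<close>.
\<close>

lemma normalized_hardy_inequality:
  assumes "normalized_hardy_weight W"
  shows "hardy_inequality W 2"
proof -
  let ?S = "{H. 0 \<le> H \<and> hardy_inequality W H}"
  have "?S \<noteq> {}" "Inf ?S = 1"
    using assms by (auto simp: normalized_hardy_weight_def hardy_weight_def hardy_constant_def)
  then obtain H where H: "0 \<le> H" "hardy_inequality W H" "H < 2"
    using cInf_lessD[of ?S 2] by auto
  show ?thesis
    unfolding hardy_inequality_def
  proof (intro allI impI)
    fix U :: "real ^ 'a \<Rightarrow> complex" and G assume "in_H1 U G"
    then have "(\<integral>\<^sup>+\<xi>. ennreal (W \<xi> * (cmod (U \<xi>))\<^sup>2) \<partial>lebesgue) \<le> ennreal H * (\<integral>\<^sup>+\<xi>. ennreal ((norm (G \<xi>))\<^sup>2) \<partial>lebesgue)"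
      using H by (simp add: hardy_inequality_def)
    also have "\<dots> \<le> ennreal 2 * (\<integral>\<^sup>+\<xi>. ennreal ((norm (G \<xi>))\<^sup>2) \<partial>lebesgue)"
      using H by (intro mult_right_mono ennreal_leI) auto
    finally show "(\<integral>\<^sup>+\<xi>. ennreal (W \<xi> * (cmod (U \<xi>))\<^sup>2) \<partial>lebesgue) \<le> ennreal 2 * (\<integral>\<^sup>+\<xi>. ennreal ((norm (G \<xi>))\<^sup>2) \<partial>lebesgue)" .
  qed
qed

section \<open>Eigenvectors of negative eigenvalues\<close>

definition potential :: "real \<Rightarrow> (int ^ 'd \<Rightarrow> real) \<Rightarrow> (int ^ 'd \<Rightarrow> complex) \<Rightarrow> int ^ 'd \<Rightarrow> complex" where
  "potential \<alpha> V u = (\<lambda>x. of_real (\<alpha> * V x) * u x)"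

lemma schroedinger_eq: "schroedinger \<alpha> V u = - discrete_laplacian u - potential \<alpha> V u"
  by (rule ext) (simp add: schroedinger_def potential_def)

lemma discrete_laplacian_add: "discrete_laplacian (u + v) = discrete_laplacian u + discrete_laplacian v"
  by (rule ext) (simp add: discrete_laplacian_def algebra_simps flip: sum.distrib)

lemma discrete_laplacian_scale: "discrete_laplacian (cscale c u) = cscale c (discrete_laplacian u)"
  by (rule ext) (simp add: discrete_laplacian_def cscale_def algebra_simps sum_distrib_left)

lemma potential_add: "potential \<alpha> V (u + v) = potential \<alpha> V u + potential \<alpha> V v"
  by (rule ext) (simp add: potential_def algebra_simps)

lemma potential_scale: "potential \<alpha> V (cscale c u) = cscale c (potential \<alpha> V u)"
  by (rule ext) (simp add: potential_def cscale_def algebra_simps)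

lemma ip_potential_sym: "ip (potential \<alpha> V u) v = ip u (potential \<alpha> V v)"
  unfolding ip_def potential_def by (simp add: mult_ac)

lemma eigenspace_iff:
  "u \<in> eigenspace \<alpha> V \<mu> \<longleftrightarrow> u \<in> l2 \<and> - discrete_laplacian u - potential \<alpha> V u = cscale (of_real \<mu>) u"
  by (auto simp: eigenspace_def schroedinger_eq cscale_def fun_eq_iff)

lemma eigenspace_potential_eq:
  assumes "u \<in> eigenspace \<alpha> V \<mu>"
  shows "potential \<alpha> V u = - discrete_laplacian u - cscale (of_real \<mu>) u"
proof -
  have eq: "- discrete_laplacian u - potential \<alpha> V u = cscale (of_real \<mu>) u"
    using assms unfolding eigenspace_iff by (rule conjunct2)
  show ?thesis unfolding eq[symmetric] by (simp only: diff_diff_eq2 add_diff_cancel_left')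
qed

lemma eigenspace_l2: "u \<in> eigenspace \<alpha> V \<mu> \<Longrightarrow> u \<in> l2"
  by (simp add: eigenspace_iff)

lemma l2_uminus: "u \<in> l2 \<Longrightarrow> - u \<in> l2"
  using cfun.subspace_neg[OF l2_subspace] .

text \<open>
  For unbounded \<open>V\<close> this rests on the eigenvalue equation, which expresses \<open>\<alpha> V u\<close> by \<open>u\<close> and its
  Laplacian.
\<close>

lemma eigenspace_potential_l2:
  assumes "u \<in> eigenspace \<alpha> V \<mu>"
  shows "potential \<alpha> V u \<in> l2"
  using eigenspace_l2[OF assms] unfolding eigenspace_potential_eq[OF assms]
  by (intro l2_diff l2_uminus discrete_laplacian_l2 l2_scale)

lemma ip_uminus_left: "u \<in> l2 \<Longrightarrow> w \<in> l2 \<Longrightarrow> ip (- u) w = - ip u w"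
  using l2.diff_left[of 0 u w] l2.zero_left[of w] l2_zero by simp

lemma eigenspace_subspace: "cfun.subspace (eigenspace \<alpha> V \<mu>)"
proof (rule cfun.subspaceI)
  show "0 \<in> eigenspace \<alpha> V \<mu>"
    using l2_zero by (simp add: eigenspace_def schroedinger_def discrete_laplacian_def)
next
  fix u v assume u: "u \<in> eigenspace \<alpha> V \<mu>" and v: "v \<in> eigenspace \<alpha> V \<mu>"
  have "schroedinger \<alpha> V (u + v) x = schroedinger \<alpha> V u x + schroedinger \<alpha> V v x" for x
    by (simp add: schroedinger_eq discrete_laplacian_add potential_add)
  with u v show "u + v \<in> eigenspace \<alpha> V \<mu>"
    by (simp add: eigenspace_def l2_add algebra_simps)
next
  fix c u assume u: "u \<in> eigenspace \<alpha> V \<mu>"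
  have "schroedinger \<alpha> V (cscale c u) x = c * schroedinger \<alpha> V u x" for x
    by (simp add: schroedinger_eq discrete_laplacian_scale potential_scale) (simp add: cscale_def algebra_simps)
  with u show "cscale c u \<in> eigenspace \<alpha> V \<mu>"
    by (simp add: eigenspace_def l2_scale) (simp add: cscale_def algebra_simps)
qed

lemma eigenvectors_orthogonal:
  assumes u: "u \<in> eigenspace \<alpha> V \<mu>" and v: "v \<in> eigenspace \<alpha> V \<nu>" and "\<mu> \<noteq> \<nu>"
  shows "ip u v = 0"
proof -
  note l = eigenspace_l2[OF u] eigenspace_l2[OF v] eigenspace_potential_l2[OF u] eigenspace_potential_l2[OF v]
  have eu: "cscale (of_real \<mu>) u = - discrete_laplacian u - potential \<alpha> V u"
    and ev: "cscale (of_real \<nu>) v = - discrete_laplacian v - potential \<alpha> V v"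
    using u v by (auto simp: eigenspace_iff)
  have "of_real \<mu> * ip u v = - ip (discrete_laplacian u) v - ip (potential \<alpha> V u) v"
    unfolding ip_scale_left[symmetric] eu
    using l by (simp add: l2.diff_left ip_uminus_left l2_uminus discrete_laplacian_l2)
  also have "\<dots> = - ip u (discrete_laplacian v) - ip u (potential \<alpha> V v)"
    using l by (simp add: ip_laplacian_sym ip_potential_sym)
  also have "\<dots> = ip u (- discrete_laplacian v - potential \<alpha> V v)"
    using l ip_uminus_left[of "discrete_laplacian v" u] ip_cnj[of u "discrete_laplacian v"] ip_cnj[of u "- discrete_laplacian v"]
    by (simp add: l2.diff_right l2_uminus discrete_laplacian_l2)
  also have "\<dots> = of_real \<nu> * ip u v"
    unfolding ev[symmetric] using l by (simp add: l2.scale_right)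
  finally show ?thesis using \<open>\<mu> \<noteq> \<nu>\<close> by simp
qed

definition spectral_sum :: "real \<Rightarrow> (int ^ 'd \<Rightarrow> real) \<Rightarrow> real set \<Rightarrow> (int ^ 'd \<Rightarrow> complex) set" where
  "spectral_sum \<alpha> V M = {\<Sum>\<mu>\<in>M. f \<mu> | f. \<forall>\<mu>\<in>M. f \<mu> \<in> eigenspace \<alpha> V \<mu>}"

lemma spectral_sum_l2: "spectral_sum \<alpha> V M \<subseteq> l2"
proof
  fix u assume "u \<in> spectral_sum \<alpha> V M"
  then obtain f where "u = (\<Sum>\<mu>\<in>M. f \<mu>)" "\<And>\<mu>. \<mu> \<in> M \<Longrightarrow> f \<mu> \<in> eigenspace \<alpha> V \<mu>"
    unfolding spectral_sum_def by blast
  then show "u \<in> l2" using l2_sum[of M f] eigenspace_l2 by blast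
qed

lemma spectral_sum_subspace: "cfun.subspace (spectral_sum \<alpha> V M)"
proof (rule cfun.subspaceI)
  show "0 \<in> spectral_sum \<alpha> V M"
    unfolding spectral_sum_def using cfun.subspace_0[OF eigenspace_subspace]
    by (auto intro!: exI[of _ "\<lambda>_. 0"])
next
  fix u v assume "u \<in> spectral_sum \<alpha> V M" "v \<in> spectral_sum \<alpha> V M"
  then obtain f g where "u = (\<Sum>\<mu>\<in>M. f \<mu>)" "v = (\<Sum>\<mu>\<in>M. g \<mu>)"
    "\<forall>\<mu>\<in>M. f \<mu> \<in> eigenspace \<alpha> V \<mu>" "\<forall>\<mu>\<in>M. g \<mu> \<in> eigenspace \<alpha> V \<mu>"
    unfolding spectral_sum_def by blast
  then have "u + v = (\<Sum>\<mu>\<in>M. f \<mu> + g \<mu>)" "\<forall>\<mu>\<in>M. f \<mu> + g \<mu> \<in> eigenspace \<alpha> V \<mu>"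
    by (auto simp: sum.distrib intro: cfun.subspace_add[OF eigenspace_subspace])
  then show "u + v \<in> spectral_sum \<alpha> V M" unfolding spectral_sum_def by blast
next
  fix c u assume "u \<in> spectral_sum \<alpha> V M"
  then obtain f where f: "u = (\<Sum>\<mu>\<in>M. f \<mu>)" "\<forall>\<mu>\<in>M. f \<mu> \<in> eigenspace \<alpha> V \<mu>"
    unfolding spectral_sum_def by blast
  have "cscale c u = (\<Sum>\<mu>\<in>M. cscale c (f \<mu>))" unfolding f(1) by (rule cfun.scale_sum_right)
  moreover have "\<forall>\<mu>\<in>M. cscale c (f \<mu>) \<in> eigenspace \<alpha> V \<mu>"
    using f by (auto intro: cfun.subspace_scale[OF eigenspace_subspace])
  ultimately show "cscale c u \<in> spectral_sum \<alpha> V M" unfolding spectral_sum_def by blast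
qed

lemma eigenspace_subset_spectral_sum:
  assumes "finite M" "\<mu> \<in> M"
  shows "eigenspace \<alpha> V \<mu> \<subseteq> spectral_sum \<alpha> V M"
proof
  fix u assume u: "u \<in> eigenspace \<alpha> V \<mu>"
  define f where "f \<nu> = (if \<nu> = \<mu> then u else 0)" for \<nu>
  have "u = (\<Sum>\<nu>\<in>M. f \<nu>)" using assms by (simp add: f_def sum.delta)
  moreover have "\<forall>\<nu>\<in>M. f \<nu> \<in> eigenspace \<alpha> V \<nu>"
    using u cfun.subspace_0[OF eigenspace_subspace] by (auto simp: f_def)
  ultimately show "u \<in> spectral_sum \<alpha> V M" unfolding spectral_sum_def by blast
qed

lemma discrete_laplacian_sum: "discrete_laplacian (\<Sum>i\<in>A. f i) = (\<Sum>i\<in>A. discrete_laplacian (f i))"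
proof (induction A rule: infinite_finite_induct)
  case (insert i A)
  show ?case unfolding sum.insert[OF insert.hyps(1,2)] discrete_laplacian_add insert.IH ..
qed (auto simp: discrete_laplacian_def fun_eq_iff)

lemma potential_sum: "potential \<alpha> V (\<Sum>i\<in>A. f i) = (\<Sum>i\<in>A. potential \<alpha> V (f i))"
proof (induction A rule: infinite_finite_induct)
  case (insert i A)
  show ?case unfolding sum.insert[OF insert.hyps(1,2)] potential_add insert.IH ..
qed (auto simp: potential_def fun_eq_iff)

text \<open>
  The eigenspaces are orthogonal to each other, so the form of the operator at \<open>\<Sum> f \<mu>\<close> equals
  \<open>\<Sum> \<mu> \<parallel>f \<mu>\<parallel>\<^sup>2\<close>, and all \<open>\<mu>\<close> are negative.
\<close>

lemma spectral_sum_form: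
  assumes M: "finite M" "M \<subseteq> {..<0}" and u: "u \<in> spectral_sum \<alpha> V M"
  shows "potential \<alpha> V u \<in> l2" and "dirichlet u \<le> Re (ip (potential \<alpha> V u) u)"
proof -
  obtain f where f: "u = (\<Sum>\<mu>\<in>M. f \<mu>)" "\<And>\<mu>. \<mu> \<in> M \<Longrightarrow> f \<mu> \<in> eigenspace \<alpha> V \<mu>"
    using u unfolding spectral_sum_def by blast
  have fl: "f \<mu> \<in> l2" if "\<mu> \<in> M" for \<mu> using eigenspace_l2[OF f(2)[OF that]] .
  have ul: "u \<in> l2" using u spectral_sum_l2 by blast
  show pl: "potential \<alpha> V u \<in> l2"
    unfolding f(1) potential_sum using f(2) by (intro l2_sum eigenspace_potential_l2)
  have "- discrete_laplacian u - potential \<alpha> V u = (\<Sum>\<mu>\<in>M. - discrete_laplacian (f \<mu>) - potential \<alpha> V (f \<mu>))"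
    unfolding f(1) potential_sum discrete_laplacian_sum by (simp only: sum_subtractf sum_negf)
  also have "\<dots> = (\<Sum>\<mu>\<in>M. cscale (of_real \<mu>) (f \<mu>))"
    using f(2) by (intro sum.cong) (auto simp: eigenspace_iff)
  finally have eq: "- discrete_laplacian u - potential \<alpha> V u = (\<Sum>\<mu>\<in>M. cscale (of_real \<mu>) (f \<mu>))" .
  have "ip (- discrete_laplacian u - potential \<alpha> V u) u = (\<Sum>\<mu>\<in>M. of_real \<mu> * ip (f \<mu>) u)"
    unfolding eq using fl ul by (subst l2.sum_left) (auto simp: l2_scale ip_scale_left)
  also have "\<dots> = (\<Sum>\<mu>\<in>M. of_real \<mu> * ip (f \<mu>) (f \<mu>))"
  proof (intro sum.cong refl)
    fix \<mu> assume \<mu>: "\<mu> \<in> M"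
    have "ip (f \<mu>) u = (\<Sum>\<nu>\<in>M. ip (f \<mu>) (f \<nu>))"
      unfolding f(1) using fl \<mu> by (intro l2.sum_right) auto
    also have "\<dots> = (\<Sum>\<nu>\<in>M. if \<nu> = \<mu> then ip (f \<mu>) (f \<mu>) else 0)"
    proof (intro sum.cong refl)
      fix \<nu> assume "\<nu> \<in> M"
      then show "ip (f \<mu>) (f \<nu>) = (if \<nu> = \<mu> then ip (f \<mu>) (f \<mu>) else 0)"
        using eigenvectors_orthogonal[OF f(2)[OF \<mu>] f(2)[of \<nu>]] by auto
    qed
    finally show "of_real \<mu> * ip (f \<mu>) u = of_real \<mu> * ip (f \<mu>) (f \<mu>)" using M \<mu> by simp
  qed
  finally have "Re (ip (- discrete_laplacian u - potential \<alpha> V u) u) = (\<Sum>\<mu>\<in>M. \<mu> * nsq (f \<mu>))"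
    by simp
  moreover have "\<dots> \<le> 0"
    using M fl by (intro sum_nonpos) (auto intro!: mult_nonpos_nonneg nsq_nonneg)
  moreover have "Re (ip (- discrete_laplacian u - potential \<alpha> V u) u) = dirichlet u - Re (ip (potential \<alpha> V u) u)"
    using ul pl ip_laplacian_self[OF ul]
    by (simp add: l2.diff_left ip_uminus_left l2_uminus discrete_laplacian_l2)
  ultimately show "dirichlet u \<le> Re (ip (potential \<alpha> V u) u)" by linarith
qed

lemma independent_eigenvectors_Union:
  assumes M: "finite M"
    and B: "\<And>\<mu>. \<mu> \<in> M \<Longrightarrow> finite (B \<mu>) \<and> B \<mu> \<subseteq> eigenspace \<alpha> V \<mu> \<and> cfun.independent (B \<mu>)"
  shows "cfun.independent (\<Union>\<mu>\<in>M. B \<mu>)" and "card (\<Union>\<mu>\<in>M. B \<mu>) = (\<Sum>\<mu>\<in>M. card (B \<mu>))"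
proof -
  have disj: "B \<mu> \<inter> B \<nu> = {}" if "\<mu> \<in> M" "\<nu> \<in> M" "\<mu> \<noteq> \<nu>" for \<mu> \<nu>
  proof (rule ccontr)
    assume "B \<mu> \<inter> B \<nu> \<noteq> {}"
    then obtain v where v: "v \<in> B \<mu>" "v \<in> B \<nu>" by blast
    have "ip v v = 0" using v B that by (intro eigenvectors_orthogonal[of v \<alpha> V \<mu> v \<nu>]) auto
    moreover have "v \<in> l2" using v B that by (auto intro: eigenspace_l2)
    ultimately have "v = 0" by (intro nsq_eq_0) auto
    then show False using v B[OF that(1)] cfun.dependent_zero by blast
  qed
  show "card (\<Union>\<mu>\<in>M. B \<mu>) = (\<Sum>\<mu>\<in>M. card (B \<mu>))"
    using M B disj by (intro card_UN_disjoint) auto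
  have fin: "finite (\<Union>\<mu>\<in>M. B \<mu>)" using M B by auto
  show "cfun.independent (\<Union>\<mu>\<in>M. B \<mu>)"
  proof
    assume "cfun.dependent (\<Union>\<mu>\<in>M. B \<mu>)"
    then obtain c where c: "\<exists>v\<in>\<Union>\<mu>\<in>M. B \<mu>. c v \<noteq> 0" "(\<Sum>v\<in>(\<Union>\<mu>\<in>M. B \<mu>). cscale (c v) v) = 0"
      unfolding cfun.dependent_finite[OF fin] by blast
    define f where "f \<mu> = (\<Sum>v\<in>B \<mu>. cscale (c v) v)" for \<mu>
    have f: "f \<mu> \<in> eigenspace \<alpha> V \<mu>" if "\<mu> \<in> M" for \<mu>
      unfolding f_def using B[OF that]
      by (intro cfun.subspace_sum[OF eigenspace_subspace] cfun.subspace_scale[OF eigenspace_subspace]) auto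
    have sum0: "(\<Sum>\<mu>\<in>M. f \<mu>) = 0"
      using c(2) M B disj by (subst (asm) sum.UNION_disjoint) (auto simp: f_def)
    have "f \<mu> = 0" if \<mu>: "\<mu> \<in> M" for \<mu>
    proof (rule nsq_eq_0)
      show l: "f \<mu> \<in> l2" using f[OF \<mu>] by (rule eigenspace_l2)
      have "ip (f \<mu>) (f \<mu>) = (\<Sum>\<nu>\<in>M. if \<nu> = \<mu> then ip (f \<mu>) (f \<mu>) else 0)"
        using M \<mu> by simp
      also have "\<dots> = (\<Sum>\<nu>\<in>M. ip (f \<nu>) (f \<mu>))"
        using eigenvectors_orthogonal[OF f f[OF \<mu>]] by (intro sum.cong) auto
      also have "\<dots> = ip (\<Sum>\<nu>\<in>M. f \<nu>) (f \<mu>)"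
        using f l by (intro l2.sum_left[symmetric]) (auto intro: eigenspace_l2)
      also have "\<dots> = 0" unfolding sum0 using l by (rule l2.zero_left)
      finally show "nsq (f \<mu>) = 0" by simp
    qed
    then have "c v = 0" if "\<mu> \<in> M" "v \<in> B \<mu>" for \<mu> v
      using B[OF that(1)] cfun.dependent_finite[of "B \<mu>"] that unfolding f_def by blast
    with c(1) show False by blast
  qed
qed

text \<open>
  The sizes of independent sets form a nonempty bounded set of natural numbers, which has a maximum.
\<close>

lemma edim_attained:
  assumes "edim E \<le> enat k"
  shows "\<exists>B. finite B \<and> B \<subseteq> E \<and> cfun.independent B \<and> edim E = enat (card B)"
proof -
  define S where "S = card ` {B. finite B \<and> B \<subseteq> E \<and> cfun.independent B}"
  have le: "m \<le> k" if "m \<in> S" for m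
  proof -
    have "enat m \<le> edim E" using that by (auto simp: S_def edim_def intro: SUP_upper)
    also note assms
    finally show ?thesis by simp
  qed
  have fin: "finite S" using le by (intro finite_subset[of S "{..k}"]) auto
  have "S \<noteq> {}" unfolding S_def using cfun.independent_empty by blast
  then have "Max S \<in> S" by (rule Max_in[OF fin])
  then obtain B where B: "finite B" "B \<subseteq> E" "cfun.independent B" "Max S = card B" by (auto simp: S_def)
  have "edim E = enat (card B)"
  proof (rule antisym)
    show "edim E \<le> enat (card B)"
      unfolding edim_def B(4)[symmetric] using fin by (intro SUP_least) (auto simp: S_def)
    show "enat (card B) \<le> edim E"
      unfolding edim_def using B by (intro SUP_upper) auto
  qed
  with B show ?thesis by blast
qed

text \<open>
  The sum over all negative eigenvalues is a supremum of finite sums, and bases of finitely many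
  eigenspaces combine to one independent set. It therefore suffices to bound the size of finite
  independent sets in the sums of finitely many eigenspaces.
\<close>

lemma N_minus_le:
  assumes "\<And>M I. finite M \<Longrightarrow> M \<subseteq> {..<0} \<Longrightarrow> finite I \<Longrightarrow> I \<subseteq> spectral_sum \<alpha> V M \<Longrightarrow>
      cfun.independent I \<Longrightarrow> card I \<le> k"
  shows "N_minus \<alpha> V \<le> enat k"
proof -
  have "(\<Sum>\<mu>\<in>M. edim (eigenspace \<alpha> V \<mu>)) \<le> enat k" if M: "finite M" "M \<subseteq> {..<0}" for M
  proof -
    have "edim (eigenspace \<alpha> V \<mu>) \<le> enat k" if "\<mu> \<in> M" for \<mu>
      unfolding edim_def
    proof (rule SUP_least)
      fix B assume "B \<in> {B. finite B \<and> B \<subseteq> eigenspace \<alpha> V \<mu> \<and> cfun.independent B}"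
      then show "enat (card B) \<le> enat k"
        using assms[OF M, of B] eigenspace_subset_spectral_sum[OF M(1) that, of \<alpha> V] by auto
    qed
    then have "\<forall>\<mu>\<in>M. \<exists>B. finite B \<and> B \<subseteq> eigenspace \<alpha> V \<mu> \<and> cfun.independent B \<and>
        edim (eigenspace \<alpha> V \<mu>) = enat (card B)"
      using edim_attained by blast
    then obtain B where B: "\<And>\<mu>. \<mu> \<in> M \<Longrightarrow> finite (B \<mu>) \<and> B \<mu> \<subseteq> eigenspace \<alpha> V \<mu> \<and> cfun.independent (B \<mu>)"
      "\<And>\<mu>. \<mu> \<in> M \<Longrightarrow> edim (eigenspace \<alpha> V \<mu>) = enat (card (B \<mu>))"
      by metis
    have "(\<Sum>\<mu>\<in>M. edim (eigenspace \<alpha> V \<mu>)) = enat (\<Sum>\<mu>\<in>M. card (B \<mu>))"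
      using M(1) B(2) by (induction M) (auto simp: zero_enat_def)
    also have "(\<Sum>\<mu>\<in>M. card (B \<mu>)) = card (\<Union>\<mu>\<in>M. B \<mu>)"
      using independent_eigenvectors_Union(2)[OF M(1) B(1)] by simp
    also have "enat \<dots> \<le> enat k"
      using assms[OF M, of "\<Union>\<mu>\<in>M. B \<mu>"] M(1) B(1) independent_eigenvectors_Union(1)[OF M(1) B(1)]
        eigenspace_subset_spectral_sum[OF M(1), of _ \<alpha> V]
      by (auto simp: subset_iff)
    finally show ?thesis .
  qed
  then show ?thesis
    unfolding N_minus_def by (subst nonneg_infsum_complete) (auto intro!: SUP_least)
qed

section \<open>Counting negative eigenvalues by a part of the potential\<close>

text \<open>
  Where \<open>V \<le> t W\<close>, the potential is absorbed by half of the Dirichlet form by means of the Hardy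
  inequality. What remains is a form that involves \<open>V\<close> on the set \<open>V > t W\<close> only.
\<close>

lemma dirichlet_le_large_potential:
  fixes u :: "int ^ 'd::finite \<Rightarrow> complex"
  assumes u: "u \<in> l2" "potential \<alpha> V u \<in> l2" and form: "dirichlet u \<le> Re (ip (potential \<alpha> V u) u)"
    and hardy: "\<And>F. finite F \<Longrightarrow> (\<Sum>x\<in>F. W x * (cmod (u x))\<^sup>2) \<le> c * dirichlet u"
    and \<alpha>: "0 < \<alpha>" and t: "0 < t" "\<alpha> * t * c \<le> 1 / 2"
  shows "(\<lambda>x. \<alpha> * V x * (cmod (u x))\<^sup>2) summable_on {x. V x > t * W x}"
    and "dirichlet u \<le> 2 * (\<Sum>\<^sub>\<infinity>x\<in>{x. V x > t * W x}. \<alpha> * V x * (cmod (u x))\<^sup>2)"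
proof -
  define a where "a x = \<alpha> * V x * (cmod (u x))\<^sup>2" for x
  define A where "A = {x. V x > t * W x}"
  have Re_eq: "Re (potential \<alpha> V u x * cnj (u x)) = a x" for x
  proof -
    have "potential \<alpha> V u x * cnj (u x) = of_real (\<alpha> * V x) * of_real ((cmod (u x))\<^sup>2)"
      by (simp only: complex_norm_square potential_def mult.assoc)
    also have "\<dots> = of_real (a x)" unfolding a_def by (rule of_real_mult[symmetric])
    finally show ?thesis by simp
  qed
  have sum: "a summable_on UNIV"
    using summable_on_Re[OF ip_summable[OF u(2,1)]] by (simp only: Re_eq)
  have sA: "a summable_on A" and sB: "a summable_on (- A)"
    by (rule summable_on_subset_banach[OF sum subset_UNIV])+
  have "Re (ip (potential \<alpha> V u) u) = infsum a UNIV"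
    unfolding ip_def using infsum_Re[OF ip_summable[OF u(2,1)]] by (simp only: Re_eq)
  also have "\<dots> = infsum a A + infsum a (- A)"
    using infsum_Un_disjoint[OF sA sB] by simp
  also have "infsum a (- A) \<le> dirichlet u / 2"
  proof (rule infsum_le_finite_sums[OF sB])
    fix F assume F: "finite F" "F \<subseteq> - A"
    have "sum a F \<le> (\<Sum>x\<in>F. \<alpha> * t * (W x * (cmod (u x))\<^sup>2))"
    proof (rule sum_mono)
      fix x assume "x \<in> F"
      then have "V x \<le> t * W x" using F by (auto simp: A_def)
      then have "\<alpha> * V x * (cmod (u x))\<^sup>2 \<le> \<alpha> * (t * W x) * (cmod (u x))\<^sup>2"
        using \<alpha> by (intro mult_right_mono mult_left_mono) auto
      then show "a x \<le> \<alpha> * t * (W x * (cmod (u x))\<^sup>2)" by (simp add: a_def mult_ac)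
    qed
    also have "\<dots> \<le> \<alpha> * t * (c * dirichlet u)"
      unfolding sum_distrib_left[symmetric] using \<alpha> t F by (intro mult_left_mono hardy) auto
    also have "\<dots> \<le> dirichlet u / 2"
      using mult_right_mono[OF t(2) dirichlet_nonneg[OF u(1)]] by (simp add: mult_ac)
    finally show "sum a F \<le> dirichlet u / 2" .
  qed
  finally have "dirichlet u \<le> 2 * infsum a A" using form by linarith
  with sA show "(\<lambda>x. \<alpha> * V x * (cmod (u x))\<^sup>2) summable_on {x. V x > t * W x}"
    "dirichlet u \<le> 2 * (\<Sum>\<^sub>\<infinity>x\<in>{x. V x > t * W x}. \<alpha> * V x * (cmod (u x))\<^sup>2)"
    by (simp_all add: a_def[abs_def] A_def)
qed

lemma has_sum_sum:
  fixes f :: "'i \<Rightarrow> 'a \<Rightarrow> real"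
  assumes "\<And>i. i \<in> I \<Longrightarrow> (f i has_sum a i) A"
  shows "((\<lambda>x. \<Sum>i\<in>I. f i x) has_sum (\<Sum>i\<in>I. a i)) A"
  using assms
proof (induction I rule: infinite_finite_induct)
  case (insert i I)
  have "((\<lambda>x. f i x + (\<Sum>i\<in>I. f i x)) has_sum (a i + (\<Sum>i\<in>I. a i))) A"
    by (rule has_sum_add[OF insert.prems insert.IH[OF insert.prems]]) simp_all
  with insert.hyps show ?case by simp
qed simp_all

text \<open>
  The factor of \<open>\<Sum> p\<^sup>s\<close> in \<open>sum_potential_density_le\<close>.
\<close>

definition clr_constant :: "'d::finite itself \<Rightarrow> real" where
  "clr_constant _ = (let s = real CARD('d) / 2 in 2 * (2 powr s / (s - 1)) * 16 powr (s - 1))"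

text \<open>
  Let \<open>v\<close> be an orthonormal system in \<open>G\<close> for the energy form, with as many members as \<open>I\<close>. Its total
  energy \<open>n\<close> is at most a constant times the sum of the Dirichlet forms, hence at most
  \<open>\<Sum> p \<Sum>\<^sub>i \<bar>v i\<bar>\<^sup>2\<close> over the set \<open>V > t W\<close> for a multiple \<open>p\<close> of \<open>\<alpha> V\<close>. The bound
  of that sum by \<open>n / 2\<close> plus a multiple of \<open>\<Sum> p\<^sup>s\<close> can then be solved for \<open>n\<close>.
\<close>

lemma card_le_large_potential:
  fixes V W :: "int ^ 'd::finite \<Rightarrow> real"
  defines "s \<equiv> real CARD('d) / 2" and "C1 \<equiv> clr_constant TYPE('d)"
  assumes d: "3 \<le> CARD('d)" and V: "\<And>x. 0 \<le> V x"
    and \<alpha>: "0 < \<alpha>" and t: "0 < t" "\<alpha> * t * c \<le> 1 / 2"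
    and G: "cfun.subspace G" "G \<subseteq> l2"
    and form: "\<And>u. u \<in> G \<Longrightarrow> potential \<alpha> V u \<in> l2" "\<And>u. u \<in> G \<Longrightarrow> dirichlet u \<le> Re (ip (potential \<alpha> V u) u)"
    and hardy: "\<And>u F. u \<in> G \<Longrightarrow> finite F \<Longrightarrow> (\<Sum>x\<in>F. W x * (cmod (u x))\<^sup>2) \<le> c * dirichlet u"
    and Y: "\<And>L. finite L \<Longrightarrow> L \<subseteq> {x. V x > t * W x} \<Longrightarrow> (\<Sum>x\<in>L. V x powr s) \<le> Y"
    and I: "finite I" "I \<subseteq> G" "cfun.independent I"
  shows "real (card I) \<le> 2 * C1 * (2 * 6 ^ CARD('d)) powr s * \<alpha> powr s * Y"
proof -
  define C2 where "C2 = (2 * 6 ^ CARD('d) :: real)"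
  have s: "1 < s" using d by (simp add: s_def)
  have C1: "0 \<le> C1" using s by (simp add: C1_def clr_constant_def s_def Let_def)
  have C2: "0 < C2" by (simp add: C2_def)
  define n where "n = card I"
  define A where "A = {x. V x > t * W x}"
  have "\<exists>v. energy.orthonormal n v \<and> (\<forall>i<n. v i \<in> G)"
  proof (rule energy.gram_schmidt[OF _ G I])
    show "u = 0" if "u \<in> l2" "Re (energy u u) = 0" for u :: "int ^ 'd \<Rightarrow> complex"
      using energy_eq_0[OF that(1) _ that(2)] d by simp
  qed (simp add: n_def)
  then obtain v where v: "energy.orthonormal n v" "\<And>i. i < n \<Longrightarrow> v i \<in> G"
    by blast
  define p where "p x = C2 * \<alpha> * V x" for x
  have p0: "0 \<le> p x" for x using C2 \<alpha> V by (simp add: p_def)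
  have vl: "v i \<in> l2" if "i < n" for i using v(2)[OF that] G by auto
  have sA: "(\<lambda>x. \<alpha> * V x * (cmod (v i x))\<^sup>2) summable_on A" if "i < n" for i
    unfolding A_def
    by (rule dirichlet_le_large_potential(1)[where W = W and c = c];
        (rule vl[OF that] form[OF v(2)[OF that]] \<alpha> t | (rule hardy[OF v(2)[OF that]], assumption)))
  have dir: "dirichlet (v i) \<le> 2 * (\<Sum>\<^sub>\<infinity>x\<in>A. \<alpha> * V x * (cmod (v i x))\<^sup>2)" if "i < n" for i
    unfolding A_def
    by (rule dirichlet_le_large_potential(2)[where W = W and c = c];
        (rule vl[OF that] form[OF v(2)[OF that]] \<alpha> t | (rule hardy[OF v(2)[OF that]], assumption)))
  have one: "1 \<le> (\<Sum>\<^sub>\<infinity>x\<in>A. p x * (cmod (v i x))\<^sup>2)" if "i < n" for i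
  proof -
    have "1 = Re (energy (v i) (v i))" using v(1) that by (simp add: energy.orthonormal_def)
    also have "\<dots> \<le> 6 ^ CARD('d) * dirichlet (v i)" by (rule energy_le_dirichlet[OF vl[OF that]])
    also have "\<dots> \<le> 6 ^ CARD('d) * (2 * (\<Sum>\<^sub>\<infinity>x\<in>A. \<alpha> * V x * (cmod (v i x))\<^sup>2))"
      using dir[OF that] by (intro mult_left_mono) auto
    also have "\<dots> = (\<Sum>\<^sub>\<infinity>x\<in>A. C2 * (\<alpha> * V x * (cmod (v i x))\<^sup>2))"
      by (subst infsum_cmult_right') (simp add: C2_def)
    finally show ?thesis by (simp add: p_def mult_ac)
  qed
  have sp: "(\<lambda>x. p x * (cmod (v i x))\<^sup>2) summable_on A" if "i < n" for i
    using summable_on_cmult_right[OF sA[OF that], of C2] by (simp add: p_def mult_ac)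
  have swap: "((\<lambda>x. \<Sum>i<n. p x * (cmod (v i x))\<^sup>2) has_sum
      (\<Sum>i<n. \<Sum>\<^sub>\<infinity>x\<in>A. p x * (cmod (v i x))\<^sup>2)) A"
    using sp by (intro has_sum_sum has_sum_infsum) auto
  have "real n = (\<Sum>i<n. 1)" by simp
  also have "\<dots> \<le> (\<Sum>i<n. \<Sum>\<^sub>\<infinity>x\<in>A. p x * (cmod (v i x))\<^sup>2)"
    using one by (intro sum_mono) auto
  also have "\<dots> = (\<Sum>\<^sub>\<infinity>x\<in>A. \<Sum>i<n. p x * (cmod (v i x))\<^sup>2)"
    using swap by (rule infsumI[symmetric])
  also have "\<dots> \<le> real n / 2 + C1 * (C2 powr s * \<alpha> powr s * Y)"
  proof (rule infsum_le_finite_sums)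
    show "(\<lambda>x. \<Sum>i<n. p x * (cmod (v i x))\<^sup>2) summable_on A"
      using swap by (rule has_sum_imp_summable)
    fix L assume L: "finite L" "L \<subseteq> A"
    have "(\<Sum>x\<in>L. \<Sum>i<n. p x * (cmod (v i x))\<^sup>2) = (\<Sum>x\<in>L. p x * (\<Sum>i<n. (cmod (v i x))\<^sup>2))"
      by (simp add: sum_distrib_left)
    also have "\<dots> \<le> real n / 2 + C1 * (\<Sum>x\<in>L. p x powr s)"
      unfolding C1_def clr_constant_def s_def Let_def by (rule sum_potential_density_le[OF d v(1) L(1) p0])
    also have "(\<Sum>x\<in>L. p x powr s) = C2 powr s * \<alpha> powr s * (\<Sum>x\<in>L. V x powr s)"
      using C2 \<alpha> V by (simp add: p_def powr_mult sum_distrib_left)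
    also have "C1 * \<dots> \<le> C1 * (C2 powr s * \<alpha> powr s * Y)"
      using C1 Y[OF L(1)] L(2) by (intro mult_left_mono) (auto simp: A_def)
    finally show "(\<Sum>x\<in>L. \<Sum>i<n. p x * (cmod (v i x))\<^sup>2) \<le> real n / 2 + C1 * (C2 powr s * \<alpha> powr s * Y)"
      by simp
  qed
  finally show ?thesis by (simp add: n_def C2_def mult_ac)
qed

section \<open>Dyadic decomposition of the weak quasi-norm\<close>

lemma weak_tail_finite_le:
  fixes W :: "int ^ 'd::finite \<Rightarrow> real"
  assumes "finite L" "L \<subseteq> {x. V x > \<tau> * W x}" and fin: "weak_tail q W V \<tau> < \<infinity>"
  shows "\<tau> powr q * (\<Sum>x\<in>L. W x powr (real CARD('d) / 2)) \<le> enn2real (weak_tail q W V \<tau>)"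
proof -
  have "ennreal (\<tau> powr q * (\<Sum>x\<in>L. W x powr (real CARD('d) / 2)))
      = ennreal (\<tau> powr q) * (\<Sum>x\<in>L. ennreal (W x powr (real CARD('d) / 2)))"
    by (simp add: ennreal_mult sum_nonneg sum_ennreal)
  also have "\<dots> \<le> weak_tail q W V \<tau>"
    unfolding weak_tail_def using assms
    by (intro mult_left_mono, subst nonneg_infsum_complete) (auto intro!: SUP_upper)
  also have "\<dots> = ennreal (enn2real (weak_tail q W V \<tau>))" using fin by simp
  finally show ?thesis by (subst (asm) ennreal_le_iff) auto
qed

text \<open>
  A geometrically weighted sum of the weak tails at the levels \<open>2\<^sup>l t\<close>, which majorizes the sum of
  \<open>V\<^sup>d\<^sup>/\<^sup>2\<close> over the set \<open>V > t W\<close> after rescaling. Both assertions about the number of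
  eigenvalues are read off from it.
\<close>

definition dyadic_tail :: "real \<Rightarrow> (int ^ 'd::finite \<Rightarrow> real) \<Rightarrow> (int ^ 'd \<Rightarrow> real) \<Rightarrow> real \<Rightarrow> real" where
  "dyadic_tail q W V t
     = (\<Sum>l. (2 powr (real CARD('d) / 2 - q)) ^ l * enn2real (weak_tail q W V (2 ^ l * t)))"

lemma weak_tail_le_quasinorm: "0 < \<tau> \<Longrightarrow> weak_tail q W V \<tau> \<le> weak_quasinorm_power q W V"
  unfolding weak_quasinorm_power_def by (intro SUP_upper) auto

lemma enn2real_weak_tail_le:
  assumes "weak_quasinorm_power q W V < \<infinity>" "0 < \<tau>"
  shows "enn2real (weak_tail q W V \<tau>) \<le> enn2real (weak_quasinorm_power q W V)"
  using assms weak_tail_le_quasinorm[OF assms(2), of q W V] by (intro enn2real_mono) auto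

lemma dyadic_ratio:
  assumes "s < q"
  shows "0 < 2 powr (s - q)" "2 powr (s - q) < (1::real)"
  using assms powr_less_one[of 2 "s - q"] by auto

lemma dyadic_tail_summable:
  fixes W :: "int ^ 'd::finite \<Rightarrow> real"
  assumes q: "real CARD('d) / 2 < q" and fin: "weak_quasinorm_power q W V < \<infinity>" and "0 < t"
  shows "summable (\<lambda>l. (2 powr (real CARD('d) / 2 - q)) ^ l * enn2real (weak_tail q W V (2 ^ l * t)))"
proof (rule summable_comparison_test)
  show "summable (\<lambda>l. (2 powr (real CARD('d) / 2 - q)) ^ l * enn2real (weak_quasinorm_power q W V))"
    using dyadic_ratio[OF q] by (intro summable_mult2 summable_geometric) auto
  show "\<exists>N. \<forall>l\<ge>N. norm ((2 powr (real CARD('d) / 2 - q)) ^ l * enn2real (weak_tail q W V (2 ^ l * t)))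
      \<le> (2 powr (real CARD('d) / 2 - q)) ^ l * enn2real (weak_quasinorm_power q W V)"
    using \<open>0 < t\<close> by (auto intro!: exI[of _ 0] mult_left_mono enn2real_weak_tail_le[OF fin] simp: abs_mult)
qed

lemma dyadic_tail_le:
  fixes W :: "int ^ 'd::finite \<Rightarrow> real"
  assumes q: "real CARD('d) / 2 < q" and fin: "weak_quasinorm_power q W V < \<infinity>" and t: "0 < t"
  shows "dyadic_tail q W V t
    \<le> 1 / (1 - 2 powr (real CARD('d) / 2 - q)) * enn2real (weak_quasinorm_power q W V)"
proof -
  let ?r = "2 powr (real CARD('d) / 2 - q)"
  have geo: "summable (\<lambda>l. ?r ^ l)" "(\<Sum>l. ?r ^ l) = 1 / (1 - ?r)"
    using dyadic_ratio[OF q] by (auto intro!: summable_geometric suminf_geometric)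
  have "dyadic_tail q W V t \<le> (\<Sum>l. ?r ^ l * enn2real (weak_quasinorm_power q W V))"
    unfolding dyadic_tail_def using t geo
    by (intro suminf_le dyadic_tail_summable[OF q fin t] summable_mult2 mult_left_mono enn2real_weak_tail_le[OF fin]) auto
  then show ?thesis using geo suminf_mult2[OF geo(1), of "enn2real (weak_quasinorm_power q W V)"] by simp
qed

text \<open>
  Every level \<open>2\<^sup>l t\<close> tends to zero with \<open>t\<close>, and the terms are dominated by a geometric series times
  the quasi-norm.
\<close>

lemma dyadic_tail_tendsto_0:
  fixes W :: "int ^ 'd::finite \<Rightarrow> real"
  assumes q: "real CARD('d) / 2 < q" and fin: "weak_quasinorm_power q W V < \<infinity>"
    and lim: "(weak_tail q W V \<longlongrightarrow> 0) (at_right 0)"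
  shows "(dyadic_tail q W V \<longlongrightarrow> 0) (at_right 0)"
proof -
  let ?r = "2 powr (real CARD('d) / 2 - q)"
  define K where "K = enn2real (weak_quasinorm_power q W V)"
  have g: "((\<lambda>t. enn2real (weak_tail q W V t)) \<longlongrightarrow> 0) (at_right 0)"
    using lim by (intro tendsto_enn2real) auto
  have "((\<lambda>t. \<Sum>l. ?r ^ l * enn2real (weak_tail q W V (2 ^ l * t))) \<longlongrightarrow> (\<Sum>l::nat. 0)) (at_right 0)"
  proof (rule tannerys_theorem[THEN conjunct2, THEN conjunct2])
    fix l :: nat
    have "filterlim (\<lambda>t. 2 ^ l * t) (at_right 0) (at_right (0::real))"
      unfolding filterlim_at
      by (auto intro!: tendsto_eq_intros simp: eventually_at_right_field intro: exI[of _ 1])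
    from filterlim_compose[OF g this]
    show "((\<lambda>t. ?r ^ l * enn2real (weak_tail q W V (2 ^ l * t))) \<longlongrightarrow> 0) (at_right 0)"
      by (intro tendsto_mult_right_zero)
  next
    have pos: "\<forall>\<^sub>F t in at_right (0::real). 0 < t" by (rule eventually_at_right_less)
    show "\<forall>\<^sub>F (l, t) in at_top \<times>\<^sub>F at_right 0. norm (?r ^ l * enn2real (weak_tail q W V (2 ^ l * t))) \<le> ?r ^ l * K"
      using eventually_prodI[OF always_eventually[of "\<lambda>_. True" at_top] pos]
      by (rule eventually_mono)
         (auto intro!: mult_left_mono enn2real_weak_tail_le[OF fin] simp: abs_mult K_def)
    show "summable (\<lambda>l. ?r ^ l * K)"
      using dyadic_ratio[OF q] by (intro summable_mult2 summable_geometric) auto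
  qed simp
  then show ?thesis by (simp add: dyadic_tail_def[abs_def])
qed

text \<open>
  A site with \<open>2\<^sup>l t < V / W \<le> 2\<^sup>l\<^sup>+\<^sup>1 t\<close> contributes at most \<open>(2\<^sup>l\<^sup>+\<^sup>1 t W)\<^sup>s\<close>, and the sites at
  level \<open>l\<close> are counted by the weak tail at \<open>2\<^sup>l t\<close>. The ratio of consecutive levels is \<open>2\<close> to the
  power \<open>s - q\<close>, so the levels form a convergent series.
\<close>

lemma sum_large_potential_le:
  fixes W :: "int ^ 'd::finite \<Rightarrow> real"
  defines "s \<equiv> real CARD('d) / 2"
  assumes q: "s < q" and fin: "weak_quasinorm_power q W V < \<infinity>" and t: "0 < t"
    and W: "\<And>x. 0 < W x" and L: "finite L" "L \<subseteq> {x. V x > t * W x}"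
  shows "(\<Sum>x\<in>L. V x powr s) \<le> 2 powr s * t powr (s - q) * dyadic_tail q W V t"
proof -
  define r where "r = 2 powr (s - q)"
  define g where "g \<tau> = enn2real (weak_tail q W V \<tau>)" for \<tau>
  have s: "0 < s" by (simp add: s_def)
  define h where "h l x = (if V x > 2 ^ l * t * W x then (2 ^ Suc l * t) powr s * W x powr s else 0)" for l x
  have h0: "0 \<le> h l x" for l x by (simp add: h_def)
  have "\<exists>l. V x powr s \<le> h l x" if "x \<in> L" for x
  proof -
    have V: "t * W x < V x" using that L by auto
    have tW: "0 < t * W x" using t W[of x] by simp
    then obtain l where l: "(1 / 2) ^ Suc l \<le> t * W x / V x" "t * W x / V x < (1 / 2) ^ l"
      using dyadic_bracket[of "t * W x / V x"] V by auto
    have Vpos: "0 < V x" using V tW by linarith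
    have 1: "2 ^ l * t * W x < V x" using l(2) Vpos by (simp add: power_one_over field_simps)
    have "V x \<le> 2 ^ Suc l * t * W x" using l(1) Vpos by (simp add: power_one_over field_simps)
    then have "V x powr s \<le> (2 ^ Suc l * t * W x) powr s" using s Vpos by (intro powr_mono2) auto
    also have "\<dots> = h l x" using 1 t W[of x] by (simp add: h_def powr_mult)
    finally show ?thesis by blast
  qed
  then obtain l where l: "\<And>x. x \<in> L \<Longrightarrow> V x powr s \<le> h (l x) x" by metis
  obtain N where N: "\<And>x. x \<in> L \<Longrightarrow> l x < N"
    using L finite_nat_set_iff_bounded[of "l ` L"] by auto
  have "(\<Sum>x\<in>L. V x powr s) \<le> (\<Sum>x\<in>L. \<Sum>k<N. h k x)"
  proof (rule sum_mono)
    fix x assume x: "x \<in> L"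
    have "h (l x) x \<le> (\<Sum>k<N. h k x)" using N[OF x] h0 by (intro member_le_sum) auto
    with l[OF x] show "V x powr s \<le> (\<Sum>k<N. h k x)" by linarith
  qed
  also have "\<dots> = (\<Sum>k<N. \<Sum>x\<in>L. h k x)" by (rule sum.swap)
  also have "\<dots> \<le> (\<Sum>k<N. 2 powr s * t powr (s - q) * (r ^ k * g (2 ^ k * t)))"
  proof (rule sum_mono)
    fix k
    define \<tau> where "\<tau> = 2 ^ k * t"
    have \<tau>: "0 < \<tau>" using t by (simp add: \<tau>_def)
    have "(\<Sum>x\<in>L. h k x) = (2 * \<tau>) powr s * (\<Sum>x\<in>{x\<in>L. V x > \<tau> * W x}. W x powr s)"
      unfolding sum.inter_filter[OF L(1)] sum_distrib_left
      by (intro sum.cong) (auto simp: h_def \<tau>_def mult_ac)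
    also have "\<dots> \<le> (2 * \<tau>) powr s * (\<tau> powr (- q) * g \<tau>)"
    proof (rule mult_left_mono)
      have "weak_tail q W V \<tau> < \<infinity>" using weak_tail_le_quasinorm[OF \<tau>] fin by (rule le_less_trans)
      then have "\<tau> powr q * (\<Sum>x\<in>{x\<in>L. V x > \<tau> * W x}. W x powr s) \<le> g \<tau>"
        unfolding g_def s_def using L by (intro weak_tail_finite_le) auto
      then show "(\<Sum>x\<in>{x\<in>L. V x > \<tau> * W x}. W x powr s) \<le> \<tau> powr (- q) * g \<tau>"
        using \<tau> by (simp add: powr_minus field_simps)
    qed simp
    also have "\<dots> = 2 powr s * \<tau> powr (s - q) * g \<tau>"
      using \<tau> by (simp add: powr_mult powr_diff powr_minus field_simps)
    also have "\<tau> powr (s - q) = r ^ k * t powr (s - q)"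
    proof -
      have "(2 ^ k :: real) powr (s - q) = r ^ k"
        unfolding r_def by (simp add: powr_powr mult.commute flip: powr_realpow)
      then show ?thesis using t by (simp add: \<tau>_def powr_mult)
    qed
    finally show "(\<Sum>x\<in>L. h k x) \<le> 2 powr s * t powr (s - q) * (r ^ k * g (2 ^ k * t))"
      by (simp add: \<tau>_def mult_ac)
  qed
  also have "\<dots> = 2 powr s * t powr (s - q) * (\<Sum>k<N. r ^ k * g (2 ^ k * t))"
    by (simp only: sum_distrib_left)
  also have "(\<Sum>k<N. r ^ k * g (2 ^ k * t)) \<le> dyadic_tail q W V t"
    unfolding dyadic_tail_def r_def g_def s_def
    by (intro sum_le_suminf dyadic_tail_summable[OF q[unfolded s_def] fin t]) auto
  finally show ?thesis by (simp add: mult_left_mono)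
qed

lemma N_minus_le_dyadic_tail:
  assumes d: "3 \<le> CARD('d::finite)" and q: "real CARD('d) / 2 < q"
  shows "\<exists>C\<ge>0. \<exists>c>0. \<forall>(W :: int ^ 'd \<Rightarrow> real) V \<alpha>. (\<forall>x. 0 < W x) \<longrightarrow>
     normalized_hardy_weight (cell_extension W) \<longrightarrow> (\<forall>x. 0 \<le> V x) \<longrightarrow>
     weak_quasinorm_power q W V < \<infinity> \<longrightarrow> 0 < \<alpha> \<longrightarrow>
     ennreal_of_enat (N_minus \<alpha> V) \<le> ennreal (C * \<alpha> powr q * dyadic_tail q W V (1 / (c * \<alpha>)))"
proof -
  define s where "s = real CARD('d) / 2"
  define C1 where "C1 = 2 * clr_constant TYPE('d) * (2 * 6 ^ CARD('d)) powr s"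
  have C1: "0 \<le> C1" using d by (simp add: C1_def clr_constant_def Let_def)
  obtain CH where CH: "0 \<le> CH" "\<And>W H (u :: int ^ 'd \<Rightarrow> complex) F. (\<And>x. 0 \<le> W x) \<Longrightarrow> 0 \<le> H \<Longrightarrow>
     hardy_inequality (cell_extension W) H \<Longrightarrow> u \<in> l2 \<Longrightarrow> finite F \<Longrightarrow>
     (\<Sum>x\<in>F. W x * (cmod (u x))\<^sup>2) \<le> CH * H * dirichlet u"
    using hardy_inequality_lattice[where 'd = 'd] by blast
  \<comment> \<open>adding \<open>1\<close> only keeps the constant positive, for the division below\<close>
  define c where "c = 2 * CH + 1"
  have c: "0 < c" using CH by (simp add: c_def)
  define C where "C = C1 * 2 powr s * (2 * c) powr (q - s)"
  have "ennreal_of_enat (N_minus \<alpha> V) \<le> ennreal (C * \<alpha> powr q * dyadic_tail q W V (1 / (2 * c * \<alpha>)))"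
    if W: "\<And>x. 0 < W x" and hw: "normalized_hardy_weight (cell_extension W)"
      and V: "\<And>x. 0 \<le> V x" and fin: "weak_quasinorm_power q W V < \<infinity>" and \<alpha>: "0 < \<alpha>"
    for W V :: "int ^ 'd \<Rightarrow> real" and \<alpha>
  proof -
    \<comment> \<open>the largest level at which the Hardy part costs no more than half of the Dirichlet form\<close>
    define t where "t = 1 / (2 * c * \<alpha>)"
    have t: "0 < t" "\<alpha> * t * c \<le> 1 / 2" using c \<alpha> by (auto simp: t_def)
    define Y where "Y = 2 powr s * t powr (s - q) * dyadic_tail q W V t"
    define X where "X = C1 * \<alpha> powr s * Y"
    have bound: "real (card I) \<le> X"
      if M: "finite M" "M \<subseteq> {..<0}" and I: "finite I" "I \<subseteq> spectral_sum \<alpha> V M" "cfun.independent I" for M I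
    proof -
      have hardy: "(\<Sum>x\<in>F. W x * (cmod (u x))\<^sup>2) \<le> c * dirichlet u"
        if "u \<in> spectral_sum \<alpha> V M" "finite F" for u F
      proof -
        have u: "u \<in> l2" using that spectral_sum_l2 by blast
        have "(\<Sum>x\<in>F. W x * (cmod (u x))\<^sup>2) \<le> CH * 2 * dirichlet u"
          using normalized_hardy_inequality[OF hw] u that less_imp_le[OF W] by (intro CH(2)) auto
        also have "\<dots> \<le> c * dirichlet u"
          using dirichlet_nonneg[OF u] by (intro mult_right_mono) (auto simp: c_def)
        finally show ?thesis .
      qed
      have large: "(\<Sum>x\<in>L. V x powr (real CARD('d) / 2)) \<le> Y" if "finite L" "L \<subseteq> {x. V x > t * W x}" for L
        unfolding Y_def s_def by (rule sum_large_potential_le[OF q fin t(1) W that])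
      have "real (card I) \<le> 2 * clr_constant TYPE('d) * (2 * 6 ^ CARD('d)) powr (real CARD('d) / 2)
          * \<alpha> powr (real CARD('d) / 2) * Y"
        by (rule card_le_large_potential[where W = W and c = c, OF d V \<alpha> t spectral_sum_subspace spectral_sum_l2
              spectral_sum_form(1)[OF M] spectral_sum_form(2)[OF M] hardy large I]; assumption)
      then show ?thesis by (simp add: X_def C1_def s_def)
    qed
    have X0: "0 \<le> X" using bound[of "{}" "{}"] cfun.independent_empty by simp
    have "N_minus \<alpha> V \<le> enat (nat \<lfloor>X\<rfloor>)"
    proof (rule N_minus_le)
      fix M I
      assume "finite M" "M \<subseteq> {..<0}" "finite I" "I \<subseteq> spectral_sum \<alpha> V M" "cfun.independent I"
      from bound[OF this] show "card I \<le> nat \<lfloor>X\<rfloor>" by (simp add: le_nat_floor)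
    qed
    then have "ennreal_of_enat (N_minus \<alpha> V) \<le> ennreal_of_enat (enat (nat \<lfloor>X\<rfloor>))"
      by (simp only: ennreal_of_enat_le_iff)
    also have "\<dots> = ennreal (real (nat \<lfloor>X\<rfloor>))" by (simp add: ennreal_of_nat_eq_real_of_nat)
    also have "\<dots> \<le> ennreal X" using X0 by (intro ennreal_leI) simp
    also have "X = C * \<alpha> powr q * dyadic_tail q W V t"
    proof -
      have "t powr (s - q) = (2 * c * \<alpha>) powr (q - s)"
        using c \<alpha> powr_divide[of 1 "2 * c * \<alpha>" "s - q"] powr_minus[of "2 * c * \<alpha>" "q - s"]
        by (simp add: t_def inverse_eq_divide)
      also have "\<dots> = (2 * c) powr (q - s) * \<alpha> powr (q - s)"
        using c \<alpha> by (simp add: powr_mult)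
      finally have "\<alpha> powr s * t powr (s - q) = (2 * c) powr (q - s) * \<alpha> powr q"
        using \<alpha> by (simp add: powr_diff)
      then show ?thesis by (simp add: X_def Y_def C_def mult_ac)
    qed
    finally show ?thesis by (simp add: t_def)
  qed
  moreover have "0 \<le> C" using C1 by (simp add: C_def)
  moreover have "0 < 2 * c" using c by simp
  ultimately show ?thesis by (intro exI[of _ C] exI[of _ "2 * c"] conjI allI impI) simp_all
qed

theorem theorem5p2:
  fixes q :: real
  assumes "CARD('d::finite) \<ge> 3"
    and "real CARD('d) / 2 < q"
  shows "\<exists>C::real. 0 \<le> C \<and>
    (\<forall>(W :: int ^ 'd \<Rightarrow> real) (V :: int ^ 'd \<Rightarrow> real).
      (\<forall>x. 0 < W x) \<longrightarrow> normalized_hardy_weight (cell_extension W) \<longrightarrow> (\<forall>x. 0 \<le> V x) \<longrightarrow>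
      weak_quasinorm_power q W V < \<infinity> \<longrightarrow>
        (\<forall>\<alpha>>0. ennreal_of_enat (N_minus \<alpha> V)
            \<le> ennreal (C * \<alpha> powr q) * weak_quasinorm_power q W V) \<and>
        ((weak_tail q W V \<longlongrightarrow> 0) (at_right 0) \<and> (weak_tail q W V \<longlongrightarrow> 0) at_top \<longrightarrow>
          ((\<lambda>\<alpha>. ennreal_of_enat (N_minus \<alpha> V) / ennreal (\<alpha> powr q)) \<longlongrightarrow> 0) at_top))"
proof -
  obtain C c where C: "0 \<le> C" "0 < c" and main: "\<And>(W :: int ^ 'd \<Rightarrow> real) V \<alpha>. (\<And>x. 0 < W x) \<Longrightarrow>
     normalized_hardy_weight (cell_extension W) \<Longrightarrow> (\<And>x. 0 \<le> V x) \<Longrightarrow>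
     weak_quasinorm_power q W V < \<infinity> \<Longrightarrow> 0 < \<alpha> \<Longrightarrow>
     ennreal_of_enat (N_minus \<alpha> V) \<le> ennreal (C * \<alpha> powr q * dyadic_tail q W V (1 / (c * \<alpha>)))"
    using N_minus_le_dyadic_tail[OF assms] by blast
  define R where "R = 1 / (1 - 2 powr (real CARD('d) / 2 - q))"
  have R: "0 \<le> R" using dyadic_ratio[OF assms(2)] by (simp add: R_def)
  have bound: "ennreal_of_enat (N_minus \<alpha> V) \<le> ennreal (C * R * \<alpha> powr q) * weak_quasinorm_power q W V"
    if W: "\<And>x. 0 < W x" and hw: "normalized_hardy_weight (cell_extension W)"
      and V: "\<And>x. 0 \<le> V x" and fin: "weak_quasinorm_power q W V < \<infinity>" and \<alpha>: "0 < \<alpha>"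
    for W V :: "int ^ 'd \<Rightarrow> real" and \<alpha>
  proof -
    have "dyadic_tail q W V (1 / (c * \<alpha>)) \<le> R * enn2real (weak_quasinorm_power q W V)"
      unfolding R_def using C \<alpha> by (intro dyadic_tail_le assms(2) fin) simp
    then have "C * \<alpha> powr q * dyadic_tail q W V (1 / (c * \<alpha>))
        \<le> C * \<alpha> powr q * (R * enn2real (weak_quasinorm_power q W V))"
      using C by (intro mult_left_mono) auto
    also have "\<dots> = (C * R * \<alpha> powr q) * enn2real (weak_quasinorm_power q W V)"
      by (simp add: mult_ac)
    finally have "ennreal_of_enat (N_minus \<alpha> V)
        \<le> ennreal ((C * R * \<alpha> powr q) * enn2real (weak_quasinorm_power q W V))"
      using main[OF W hw V fin \<alpha>] by (meson ennreal_leI order_trans)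
    also have "\<dots> = ennreal (C * R * \<alpha> powr q) * weak_quasinorm_power q W V"
      using fin C R by (simp add: ennreal_mult')
    finally show ?thesis .
  qed
  have limit: "((\<lambda>\<alpha>. ennreal_of_enat (N_minus \<alpha> V) / ennreal (\<alpha> powr q)) \<longlongrightarrow> 0) at_top"
    if W: "\<And>x. 0 < W x" and hw: "normalized_hardy_weight (cell_extension W)"
      and V: "\<And>x. 0 \<le> V x" and fin: "weak_quasinorm_power q W V < \<infinity>"
      and lim: "(weak_tail q W V \<longlongrightarrow> 0) (at_right 0)"
    for W V :: "int ^ 'd \<Rightarrow> real"
  proof (rule tendsto_sandwich[OF _ _ tendsto_const])
    have "filterlim (\<lambda>\<alpha>. inverse (c * \<alpha>)) (at_right 0) at_top"
      using C by (intro filterlim_compose[OF filterlim_inverse_at_right_top] 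
          filterlim_tendsto_pos_mult_at_top[OF tendsto_const _ filterlim_ident]) auto
    then have "((\<lambda>\<alpha>. dyadic_tail q W V (1 / (c * \<alpha>))) \<longlongrightarrow> 0) at_top"
      using filterlim_compose[OF dyadic_tail_tendsto_0[OF assms(2) fin lim]] by (simp only: inverse_eq_divide)
    then have "((\<lambda>\<alpha>. C * dyadic_tail q W V (1 / (c * \<alpha>))) \<longlongrightarrow> 0) at_top"
      by (rule tendsto_mult_right_zero)
    then show "((\<lambda>\<alpha>. ennreal (C * dyadic_tail q W V (1 / (c * \<alpha>)))) \<longlongrightarrow> 0) at_top"
      using tendsto_ennrealI by fastforce
    show "\<forall>\<^sub>F \<alpha> in at_top. ennreal_of_enat (N_minus \<alpha> V) / ennreal (\<alpha> powr q)
        \<le> ennreal (C * dyadic_tail q W V (1 / (c * \<alpha>)))"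
      using eventually_gt_at_top[of 0]
    proof eventually_elim
      case (elim \<alpha>)
      have D: "0 \<le> dyadic_tail q W V (1 / (c * \<alpha>))"
        unfolding dyadic_tail_def using C elim
        by (intro suminf_nonneg dyadic_tail_summable[OF assms(2) fin]) auto
      have "ennreal_of_enat (N_minus \<alpha> V) / ennreal (\<alpha> powr q)
          \<le> ennreal (C * \<alpha> powr q * dyadic_tail q W V (1 / (c * \<alpha>))) / ennreal (\<alpha> powr q)"
        by (intro divide_right_mono_ennreal main[OF W hw V fin elim])
      also have "\<dots> = ennreal (C * dyadic_tail q W V (1 / (c * \<alpha>)))"
        using C D elim by (subst divide_ennreal) auto
      finally show ?case .
    qed
  qed auto
  show ?thesis
  proof (intro exI[of _ "C * R"] conjI allI impI)
    show "0 \<le> C * R" using C R by simp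
  next
    fix W V :: "int ^ 'd \<Rightarrow> real" and \<alpha> :: real
    assume "\<forall>x. 0 < W x" "normalized_hardy_weight (cell_extension W)" "\<forall>x. 0 \<le> V x"
      "weak_quasinorm_power q W V < \<infinity>" "0 < \<alpha>"
    then show "ennreal_of_enat (N_minus \<alpha> V) \<le> ennreal (C * R * \<alpha> powr q) * weak_quasinorm_power q W V"
      by (intro bound) auto
  next
    fix W V :: "int ^ 'd \<Rightarrow> real"
    assume "\<forall>x. 0 < W x" "normalized_hardy_weight (cell_extension W)" "\<forall>x. 0 \<le> V x"
      "weak_quasinorm_power q W V < \<infinity>"
      "(weak_tail q W V \<longlongrightarrow> 0) (at_right 0) \<and> (weak_tail q W V \<longlongrightarrow> 0) at_top"
    then show "((\<lambda>\<alpha>. ennreal_of_enat (N_minus \<alpha> V) / ennreal (\<alpha> powr q)) \<longlongrightarrow> 0) at_top"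
      by (intro limit[of W]) auto
  qed
qed

end
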